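(* Let $0<p\le1$, $C\ge1$, and let $\mu\in\mathcal{M}^p_C$ be such that (1) $\mu$ is quasi-irreducible, and (2) $L_1(\mu)>L_2(\mu)$. Then there are positive constants $C_0$ and $\delta$ and a function $c:(0,\infty)\to(0,\infty)$ with $c(\varepsilon)\sim\varepsilon^2/\log(1/\varepsilon)$ as $\varepsilon\to0$ (in the sense that the two quantities are comparable up to positive multiplicative constants for small $\varepsilon$), such that for every measure $\nu\in\mathcal{M}^p_C$ with $W_p(\nu,\mu)<\delta$, all $n\ge1$, every $\varepsilon>0$ and every unit vector $v\in\mathbb{R}^m$, $$\nu^{\mathbb{N}}\left\{\omega\in\mathrm{Mat}_m(\mathbb{R})^{\mathbb{N}}:\left|\frac1n\log\|A^n(\omega)v\|-L_1(\nu)\right|>\varepsilon\right\}<C_0\,e^{-c(\varepsilon)n}.$$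
   Context: $\mathrm{Mat}_m(\mathbb{R})$ is the space of real $m\times m$ matrices with the operator norm for the Euclidean norm on $\mathbb{R}^m$. For a Borel probability measure $\mu$ on $\mathrm{Mat}_m(\mathbb{R})$ put $\bar\Theta_p(\mu)=\int\|g\|^p\,d\mu(g)$ and $\underline\Theta_p(\mu)=\sup_{\|v\|=1}\int\|gv\|^{-p}\,d\mu(g)$ (with $0^{-p}=+\infty$), and let $\mathcal{M}^p_C$ be the set of all $\mu$ with $\bar\Theta_p(\mu)\le C$ and $\underline\Theta_p(\mu)\le C$. $W_p(\mu,\nu)=\inf_\pi\iint\|g-g'\|^p\,d\pi(g,g')$, the infimum over all couplings $\pi$ of $\mu$ and $\nu$. For $\omega=(\omega_n)_{n\ge0}$ write $A^n(\omega)=\omega_{n-1}\cdots\omega_1\omega_0$. $L_1(\mu)$ and $L_2(\mu)\in[-\infty,\infty)$ are the $\mu^{\mathbb{N}}$-almost sure limits of $\frac1n\log\|A^n(\omega)\|$ and $\frac1n\log s_2(A^n(\omega))$, with $s_2$ the second largest singular value. $\mu$ is quasi-irreducible if for every proper nonzero linear subspace $E\subset\mathbb{R}^m$ such that $gE\subseteq E$ for $\mu$-almost every $g$, $\lim_n\frac1n\log\|A^n(\omega)|_E\|=L_1(\mu)$ for $\mu^{\mathbb{N}}$-a.e. $\omega$. *)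

theory Defs
  imports "HOL-Probability.Probability"
begin

abbreviation opnorm :: "real^'m^'m \<Rightarrow> real" where
  "opnorm A \<equiv> onorm ((*v) A)"

definition opnorm_on :: "(real^'m) set \<Rightarrow> real^'m^'m \<Rightarrow> real" where
  "opnorm_on E A = (SUP v\<in>{v \<in> E. norm v = 1}. norm (A *v v))"

(* Singular values: square roots of the eigenvalues of the transpose of A times A, each
   repeated according to its multiplicity. That matrix is symmetric, so the (geometric)
   multiplicity is the dimension of the eigenspace and the multiset has size CARD('m). *)
definition singular_eigenspace :: "real^'m^'m \<Rightarrow> real \<Rightarrow> (real^'m) set" where
  "singular_eigenspace A s = {x. (transpose A ** A) *v x = s\<^sup>2 *\<^sub>R x}"

definition singular_values :: "real^'m^'m \<Rightarrow> real multiset" where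
  "singular_values A =
     (\<Sum>s\<in>{s. 0 \<le> s \<and> singular_eigenspace A s \<noteq> {0}}.
        replicate_mset (dim (singular_eigenspace A s)) s)"

(* The k-th largest singular value, k = 1, 2, ...; as usual it is 0 for k > CARD('m), so that
   the second Lyapunov exponent of 1 x 1 matrices is minus infinity. *)
definition singular_value :: "nat \<Rightarrow> real^'m^'m \<Rightarrow> real" where
  "singular_value k A =
     (let xs = rev (sorted_list_of_multiset (singular_values A))
      in if k \<le> length xs then xs ! (k - 1) else 0)"

(* Natural logarithm on [0, \<infinity>) with log 0 = -\<infinity> (the library has ln 0 = 0). *)
definition elog :: "real \<Rightarrow> ereal" where
  "elog x = (if x = 0 then -\<infinity> else ereal (ln x))"

definition Theta_upper :: "real \<Rightarrow> (real^'m^'m) measure \<Rightarrow> ennreal" where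
  "Theta_upper p \<mu> = (\<integral>\<^sup>+ g. ennreal (opnorm g powr p) \<partial>\<mu>)"

(* In ennreal, inverse 0 is \<infinity>, which gives 0 to the power -p the value +\<infinity>. *)
definition Theta_lower :: "real \<Rightarrow> (real^'m^'m) measure \<Rightarrow> ennreal" where
  "Theta_lower p \<mu> =
     (SUP v\<in>{v. norm v = 1}. \<integral>\<^sup>+ g. inverse (ennreal (norm (g *v v) powr p)) \<partial>\<mu>)"

definition moment_class :: "real \<Rightarrow> real \<Rightarrow> (real^'m^'m) measure set" where
  "moment_class p C = {\<mu>. prob_space \<mu> \<and> sets \<mu> = sets borel \<and>
     Theta_upper p \<mu> \<le> ennreal C \<and> Theta_lower p \<mu> \<le> ennreal C}"

definition couplings ::
  "(real^'m^'m) measure \<Rightarrow> (real^'m^'m) measure \<Rightarrow> ((real^'m^'m) \<times> (real^'m^'m)) measure set" where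
  "couplings \<mu> \<nu> = {\<pi>. prob_space \<pi> \<and> sets \<pi> = sets (borel \<Otimes>\<^sub>M borel) \<and>
     distr \<pi> borel fst = \<mu> \<and> distr \<pi> borel snd = \<nu>}"

(* No p-th root: for p \<le> 1 the transport cost itself is a metric. *)
definition Wasserstein :: "real \<Rightarrow> (real^'m^'m) measure \<Rightarrow> (real^'m^'m) measure \<Rightarrow> ennreal" where
  "Wasserstein p \<mu> \<nu> =
     (INF \<pi>\<in>couplings \<mu> \<nu>. \<integral>\<^sup>+ (g, g'). ennreal (opnorm (g - g') powr p) \<partial>\<pi>)"

abbreviation iid :: "(real^'m^'m) measure \<Rightarrow> (nat \<Rightarrow> real^'m^'m) measure" where
  "iid \<mu> \<equiv> PiM UNIV (\<lambda>_. \<mu>)"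

primrec cocycle :: "nat \<Rightarrow> (nat \<Rightarrow> real^'m^'m) \<Rightarrow> real^'m^'m" where
  "cocycle 0 \<omega> = mat 1"
| "cocycle (Suc n) \<omega> = \<omega> n ** cocycle n \<omega>"

(* Both limits exist and are almost surely constant on the moment classes. *)
definition lyapunov1 :: "(real^'m^'m) measure \<Rightarrow> ereal" where
  "lyapunov1 \<mu> = (THE L. AE \<omega> in iid \<mu>.
     (\<lambda>n. elog (opnorm (cocycle n \<omega>)) / ereal (real n)) \<longlonglongrightarrow> L)"

definition lyapunov2 :: "(real^'m^'m) measure \<Rightarrow> ereal" where
  "lyapunov2 \<mu> = (THE L. AE \<omega> in iid \<mu>.
     (\<lambda>n. elog (singular_value 2 (cocycle n \<omega>)) / ereal (real n)) \<longlonglongrightarrow> L)"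

definition quasi_irreducible :: "(real^'m^'m) measure \<Rightarrow> bool" where
  "quasi_irreducible \<mu> \<longleftrightarrow>
     (\<forall>E. subspace E \<and> E \<noteq> {0} \<and> E \<noteq> UNIV \<and> (AE g in \<mu>. (*v) g ` E \<subseteq> E) \<longrightarrow>
        (AE \<omega> in iid \<mu>.
           (\<lambda>n. elog (opnorm_on E (cocycle n \<omega>)) / ereal (real n)) \<longlonglongrightarrow> lyapunov1 \<mu>))"

end

theory Submission
  imports Defs
begin

text \<open>
  Write \<open>A\<^sup>n\<close> for the product of the first \<open>n\<close> factors and \<open>\<phi>\<^sub>n v\<close> for the mean of \<open>ln |A\<^sup>n v|\<close>, that is
  \<open>mean_log (law \<nu> n) v\<close>. The whole theorem follows from one bound: \<open>|\<phi>\<^sub>n v - \<phi>\<^sub>n w| \<le> K\<close> for all \<open>n\<close> and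
  all unit vectors, with the same \<open>K\<close> for all \<open>\<nu>\<close> near \<open>\<mu>\<close> in the moment class. By the Markov property of the direction of
  \<open>A\<^sup>n v\<close>, the sequence \<open>\<phi>\<^sub>n v\<close> is then additive up to \<open>K\<close>, so \<open>\<phi>\<^sub>n v = n l + O(K)\<close>. Moreover, revealing one
  factor \<open>g\<close> changes the conditional mean of \<open>ln |A\<^sup>n v|\<close> by \<open>ln |g v|\<close> plus a bounded term, which has
  exponential moments of order \<open>p\<close>. Induction on \<open>n\<close> bounds the mean of
  \<open>exp (t (ln |A\<^sup>n v| - \<phi>\<^sub>n v))\<close> by \<open>exp (B t\<^sup>2 n)\<close> for small \<open>t\<close> (\<open>cocycle_exponential_moment\<close>). Chernoff's
  inequality gives deviations with a rate of order \<open>\<epsilon>\<^sup>2\<close>, which is better than \<open>\<epsilon>\<^sup>2 / ln (1/\<epsilon>)\<close>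
  (\<open>cocycle_concentration\<close>), and the Borel-Cantelli lemma identifies \<open>l\<close> with the first Lyapunov
  exponent of \<open>\<nu>\<close> (\<open>lyapunov1_of_concentration\<close>).

  The bound on the oscillation of \<open>\<phi>\<^sub>n\<close> comes from a contraction of the projective space. A matrix \<open>g\<close>
  multiplies the sine of the angle of unit vectors \<open>v\<close> and \<open>w\<close> by at most \<open>|\<Lambda>\<^sup>2 g| / (|g v| |g w|)\<close>. If
  for some \<open>N\<close> the logarithm of this factor for \<open>g = A\<^sup>N\<close> has a mean below a negative constant, for all \<open>v\<close>
  and \<open>w\<close>, then a small power of the factor has mean less than one (\<open>sine_contraction\<close>). Since \<open>\<phi>\<^sub>n\<close> is
  Hoelder continuous for \<open>n \<le> N\<close>, iteration in steps of \<open>N\<close> bounds the oscillation for all \<open>n\<close>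
  (\<open>mean_log_oscillation\<close>). The condition on the mean logarithm involves only \<open>N\<close> factors and is stable
  under small changes in the Wasserstein distance (\<open>coupling_law\<close>, \<open>contraction_in_mean_stable\<close>), so it has
  to be verified for \<open>\<mu>\<close> only.

  For \<open>\<mu>\<close> it says that \<open>ln |\<Lambda>\<^sup>2 A\<^sup>N|\<close> has mean close to \<open>N (L\<^sub>1 + L\<^sub>2)\<close> or less, while \<open>\<phi>\<^sub>N v\<close> is at least about
  \<open>N L\<^sub>1\<close> uniformly in \<open>v\<close>. The first part is the subadditive ergodic theorem, applied to \<open>|A\<^sup>n|\<close> and
  \<open>|\<Lambda>\<^sup>2 A\<^sup>n|\<close> truncated below at \<open>exp (- b n)\<close>, which allows \<open>L\<^sub>2 = -\<infinity>\<close>. For the second part, the gap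
  between the exponents makes \<open>|A\<^sup>n v| / |A\<^sup>n|\<close> converge, with its square approaching its limit exponentially
  fast (\<open>AE_alignment\<close>). The vectors with limit zero form a random subspace. The probability that \<open>v\<close>
  belongs to it attains its maximum on the unit sphere, and at a maximising \<open>v\<close> the event is independent
  of any finite number of factors; hence the maximum is zero or one. The vectors that belong to the random
  subspace almost surely form a proper invariant subspace on which \<open>A\<^sup>n\<close> grows more slowly than \<open>exp (n L\<^sub>1)\<close>,
  so quasi-irreducibility leaves only the zero vector (\<open>AE_not_decays\<close>). Thus every vector grows at rate
  \<open>L\<^sub>1\<close>, and compactness of the sphere makes this uniform (\<open>uniform_growth\<close>).
\<close>

section \<open>The operator norm\<close>

lemma norm_mult_le_opnorm: "norm (A *v x) \<le> opnorm A * norm x" for A :: "real^'m^'m"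
  by (simp add: onorm)

lemma opnorm_nonneg: "0 \<le> opnorm A" for A :: "real^'m^'m"
  by (simp add: onorm_pos_le)

lemma opnorm_mult: "opnorm (A ** B) \<le> opnorm A * opnorm B" for A B :: "real^'m^'m"
  using onorm_compose[of "(*v) A" "(*v) B"] by (simp add: o_def matrix_vector_mul_assoc)

lemma opnorm_add: "opnorm (A + B) \<le> opnorm A + opnorm B" for A B :: "real^'m^'m"
proof -
  have "(*v) (A + B) = (\<lambda>x. A *v x + B *v x)" by (rule ext) (rule matrix_vector_mult_add_rdistrib)
  then show ?thesis using onorm_triangle[of "(*v) A" "(*v) B"] by simp
qed

lemma opnorm_minus_commute: "opnorm (A - B) = opnorm (B - A)" for A B :: "real^'m^'m"
proof -
  have "(*v) (B - A) = (\<lambda>x. - ((A - B) *v x))"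
    by (rule ext) (simp add: matrix_vector_mult_diff_rdistrib)
  then show ?thesis by (simp add: onorm_neg)
qed

lemma opnorm_diff: "\<bar>opnorm A - opnorm B\<bar> \<le> opnorm (A - B)" for A B :: "real^'m^'m"
  using opnorm_add[of "A - B" B] opnorm_add[of "B - A" A] opnorm_minus_commute[of A B] by simp

lemma opnorm_zero: "opnorm (0::real^'m^'m) = 0"
proof -
  have "(*v) (0::real^'m^'m) = (\<lambda>x. 0)" by (rule ext) simp
  then show ?thesis by (simp add: onorm_zero)
qed

lemma opnorm_mat_1: "opnorm (mat 1 :: real^'m^'m) = 1"
proof -
  have "(*v) (mat 1 :: real^'m^'m) = (\<lambda>x. x)" by (rule ext) simp
  then show ?thesis using onorm_id[where 'a = "real^'m"] by simp
qed

lemma opnorm_le_norm: "opnorm A \<le> real (CARD('m) * CARD('m)) * norm A" for A :: "real^'m^'m"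
proof -
  have "\<bar>A $ i $ j\<bar> \<le> norm A" for i j
    using component_le_norm_cart[of "A $ i" j] Finite_Cartesian_Product.norm_nth_le[of A i] by linarith
  then show ?thesis using onorm_le_matrix_component[of A "norm A"] by simp
qed

lemma isCont_opnorm: "isCont opnorm (A::real^'m^'m)"
proof -
  let ?c = "real (CARD('m) * CARD('m))"
  have "((\<lambda>B. ?c * norm (B - A)) \<longlongrightarrow> ?c * norm (A - A)) (at A)"
    by (intro tendsto_intros)
  then have lim: "((\<lambda>B. ?c * norm (B - A)) \<longlongrightarrow> 0) (at A)" by simp
  have "norm (opnorm B - opnorm A) \<le> ?c * norm (B - A)" for B
    using opnorm_diff[of B A] opnorm_le_norm[of "B - A"] by simp
  then have "((\<lambda>B. opnorm B - opnorm A) \<longlongrightarrow> 0) (at A)"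
    by (intro Lim_null_comparison[OF _ lim] always_eventually) blast
  then have "(opnorm \<longlongrightarrow> opnorm A) (at A)"
    using LIM_zero_cancel[of opnorm "opnorm A" "at A"] by simp
  then show ?thesis by (simp add: isCont_def)
qed

lemma continuous_on_opnorm: "continuous_on UNIV (\<lambda>A::real^'m^'m. opnorm A)"
  by (intro continuous_at_imp_continuous_on ballI isCont_opnorm)

lemma borel_measurable_opnorm [measurable (raw)]:
  fixes f :: "'a \<Rightarrow> real^'m^'m"
  assumes "f \<in> borel_measurable M"
  shows "(\<lambda>x. opnorm (f x)) \<in> borel_measurable M"
  using borel_measurable_continuous_on[OF continuous_on_opnorm assms] .

lemma continuous_on_matrix_mult:
  "continuous_on UNIV (\<lambda>(A::real^'m^'m, B::real^'m^'m). A ** B)"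
  unfolding matrix_matrix_mult_def case_prod_beta
  by (intro continuous_intros)

lemma continuous_on_matrix_vector:
  "continuous_on UNIV (\<lambda>(A::real^'m^'m, v::real^'m). A *v v)"
  unfolding matrix_vector_mult_def case_prod_beta
  by (intro continuous_intros)

lemma borel_measurable_matrix_mult [measurable (raw)]:
  fixes f g :: "'a \<Rightarrow> real^'m^'m"
  assumes "f \<in> borel_measurable M" "g \<in> borel_measurable M"
  shows "(\<lambda>x. f x ** g x) \<in> borel_measurable M"
proof -
  have "(\<lambda>x. case (f x, g x) of (A, B) \<Rightarrow> A ** B) \<in> borel_measurable M"
    by (intro borel_measurable_continuous_on[OF continuous_on_matrix_mult] borel_measurable_Pair assms)
  then show ?thesis by simp
qed

lemma borel_measurable_matrix_vector [measurable (raw)]: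
  fixes f :: "'a \<Rightarrow> real^'m^'m"
  assumes "f \<in> borel_measurable M" "g \<in> borel_measurable M"
  shows "(\<lambda>x. f x *v g x) \<in> borel_measurable M"
proof -
  have "(\<lambda>x. case (f x, g x) of (A, B) \<Rightarrow> A *v B) \<in> borel_measurable M"
    by (intro borel_measurable_continuous_on[OF continuous_on_matrix_vector] borel_measurable_Pair assms)
  then show ?thesis by simp
qed

text \<open>
  The unit sphere of a subspace is compact.
\<close>

lemma norm_maximizer_on_subspace:
  fixes A :: "real^'m^'m"
  assumes "subspace S" "S \<noteq> {0}"
  obtains e where "e \<in> S" "norm e = 1" "\<And>x. x \<in> S \<Longrightarrow> norm (A *v x) \<le> norm (A *v e) * norm x"
proof -
  obtain z where z: "z \<in> S" "z \<noteq> 0" using assms subspace_0 by blast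
  have "compact (sphere 0 1 \<inter> S)"
    by (intro compact_Int_closed compact_sphere closed_subspace assms)
  moreover have "z /\<^sub>R norm z \<in> sphere 0 1 \<inter> S"
    using z by (auto simp: subspace_scale assms)
  moreover have "continuous_on (sphere 0 1 \<inter> S) (\<lambda>x. norm (A *v x))"
    by (intro continuous_on_norm linear_continuous_on matrix_vector_mul_bounded_linear)
  ultimately obtain e where e: "e \<in> sphere 0 1 \<inter> S"
    "\<And>x. x \<in> sphere 0 1 \<inter> S \<Longrightarrow> norm (A *v x) \<le> norm (A *v e)"
    using continuous_attains_sup[of "sphere 0 1 \<inter> S" "\<lambda>x. norm (A *v x)"] by blast
  show thesis
  proof
    fix x assume x: "x \<in> S"
    show "norm (A *v x) \<le> norm (A *v e) * norm x"
    proof (cases "x = 0")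
      case False
      have "norm (A *v (x /\<^sub>R norm x)) \<le> norm (A *v e)"
        using False x by (intro e) (auto simp: subspace_scale assms)
      then show ?thesis using False
        by (simp add: matrix_vector_mult_scaleR field_simps)
    qed simp
  qed (use e in auto)
qed

lemma opnorm_attained:
  fixes A :: "real^'m^'m"
  obtains e where "norm e = 1" "norm (A *v e) = opnorm A"
proof -
  have "axis undefined 1 \<noteq> (0 :: real^'m)" by (simp add: axis_eq_0_iff)
  then have "(UNIV :: (real^'m) set) \<noteq> {0}" by blast
  then obtain e where e: "norm e = 1" "\<And>x. norm (A *v x) \<le> norm (A *v e) * norm x"
    using norm_maximizer_on_subspace[of UNIV A] by auto
  have "opnorm A \<le> norm (A *v e)" by (rule onorm_le) (rule e)
  moreover have "norm (A *v e) \<le> opnorm A" using norm_mult_le_opnorm[of A e] e by simp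
  ultimately have "norm (A *v e) = opnorm A" by (rule antisym[rotated])
  with e(1) show thesis by (rule that)
qed

section \<open>Areas of parallelograms\<close>

text \<open>
  The norm of the bivector \<open>x \<and> y\<close>, written through the Gram determinant so that no exterior power
  has to be constructed.
\<close>

definition area :: "'a::real_inner \<Rightarrow> 'a \<Rightarrow> real" where
  "area x y = sqrt ((norm x)\<^sup>2 * (norm y)\<^sup>2 - (x \<bullet> y)\<^sup>2)"

lemma area_squared: "(area x y)\<^sup>2 = (norm x)\<^sup>2 * (norm y)\<^sup>2 - (x \<bullet> y)\<^sup>2"
  unfolding area_def
  by (rule real_sqrt_pow2) (use Cauchy_Schwarz_ineq[of x y] in \<open>simp add: power2_norm_eq_inner\<close>)

lemma area_nonneg: "0 \<le> area x y"
  unfolding area_def using Cauchy_Schwarz_ineq[of x y] by (simp add: power2_norm_eq_inner)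

lemma area_eqI: "(area x y)\<^sup>2 = (area x' y')\<^sup>2 \<Longrightarrow> area x y = area x' y'"
  by (rule power2_eq_imp_eq[OF _ area_nonneg area_nonneg])

lemma area_le: "area x y \<le> norm x * norm y"
  by (rule power2_le_imp_le) (auto simp: area_squared power_mult_distrib)

lemma area_commute: "area x y = area y x"
  by (simp add: area_def inner_commute mult.commute)

lemma area_orthogonal: "x \<bullet> y = 0 \<Longrightarrow> area x y = norm x * norm y"
  by (simp add: area_def real_sqrt_mult)

lemma area_shear: "area (x + c *\<^sub>R y) y = area x y"
proof (rule area_eqI)
  show "(area (x + c *\<^sub>R y) y)\<^sup>2 = (area x y)\<^sup>2"
    unfolding area_squared power2_norm_eq_inner
    by (simp add: inner_add_left inner_add_right inner_commute algebra_simps power2_eq_square)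
qed

lemma area_rotate:
  assumes "a\<^sup>2 + b\<^sup>2 = 1"
  shows "area (a *\<^sub>R u + b *\<^sub>R w) (b *\<^sub>R u - a *\<^sub>R w) = area u w"
proof (rule area_eqI)
  have "(area (a *\<^sub>R u + b *\<^sub>R w) (b *\<^sub>R u - a *\<^sub>R w))\<^sup>2 = (a\<^sup>2 + b\<^sup>2)\<^sup>2 * (area u w)\<^sup>2"
    unfolding area_squared power2_norm_eq_inner
    by (simp add: inner_add_left inner_add_right inner_diff_left inner_diff_right inner_commute[of w u]
        algebra_simps power2_eq_square)
  also have "\<dots> = (area u w)\<^sup>2" unfolding assms by simp
  finally show "(area (a *\<^sub>R u + b *\<^sub>R w) (b *\<^sub>R u - a *\<^sub>R w))\<^sup>2 = (area u w)\<^sup>2" .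
qed

text \<open>
  This form is linear in \<open>x\<close> inside a norm, so the area inherits the triangle inequality.
\<close>

lemma area_projection: "y \<noteq> 0 \<Longrightarrow> area x y = norm y * norm (x - (x \<bullet> y / (y \<bullet> y)) *\<^sub>R y)"
proof -
  assume "y \<noteq> 0"
  then have "(x - (x \<bullet> y / (y \<bullet> y)) *\<^sub>R y) \<bullet> y = 0"
    by (simp add: inner_diff_left)
  then have "area (x - (x \<bullet> y / (y \<bullet> y)) *\<^sub>R y) y = norm y * norm (x - (x \<bullet> y / (y \<bullet> y)) *\<^sub>R y)"
    by (simp add: area_orthogonal)
  then show ?thesis using area_shear[of x "- (x \<bullet> y / (y \<bullet> y))" y] by simp
qed

lemma area_add_left: "area (x + x') y \<le> area x y + area x' y"
proof (cases "y = 0")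
  case False
  let ?P = "\<lambda>x. x - (x \<bullet> y / (y \<bullet> y)) *\<^sub>R y"
  have "?P (x + x') = ?P x + ?P x'"
    by (simp add: inner_add_left add_divide_distrib scaleR_add_left)
  then have "norm (?P (x + x')) \<le> norm (?P x) + norm (?P x')" by (metis norm_triangle_ineq)
  then show ?thesis using False
    by (simp add: area_projection distrib_left[symmetric])
qed (simp add: area_def)

lemma area_perturb:
  "area x y \<le> area x' y' + norm (x - x') * norm y + norm x' * norm (y - y')"
proof -
  have "area x y \<le> area (x - x') y + area x' y" using area_add_left[of "x - x'" x' y] by simp
  moreover have "area x' y \<le> area x' (y - y') + area x' y'"
    using area_add_left[of "y - y'" y' x'] by (simp add: area_commute)
  ultimately show ?thesis using area_le[of "x - x'" y] area_le[of x' "y - y'"] by linarith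
qed

text \<open>
  Two lines at a small angle have close unit vectors, for a suitable choice of the sign.
\<close>

lemma area_controls_distance:
  assumes "norm v = 1" "norm w = 1"
  shows "\<exists>s\<in>{1, -1::real}. norm (v - s *\<^sub>R w) \<le> 2 * area v w"
proof -
  define s where "s = (if v \<bullet> w \<ge> 0 then 1 else -1::real)"
  have s: "s * (v \<bullet> w) = \<bar>v \<bullet> w\<bar>" "s * s = 1" by (auto simp: s_def)
  have b: "\<bar>v \<bullet> w\<bar> \<le> 1" using Cauchy_Schwarz_ineq2[of v w] assms by simp
  have vv: "v \<bullet> v = 1" "w \<bullet> w = 1" using assms by (simp_all add: norm_eq_1)
  have "(norm (v - s *\<^sub>R w))\<^sup>2 = 2 - 2 * \<bar>v \<bullet> w\<bar>"
    using s by (simp add: power2_norm_eq_inner inner_diff_left inner_diff_right vv inner_commute[of w v] algebra_simps)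
  also have "\<dots> \<le> 2 * (1 - \<bar>v \<bullet> w\<bar>\<^sup>2)"
    using mult_right_mono[OF b abs_ge_zero[of "v \<bullet> w"]] by (simp add: power2_eq_square)
  also have "\<dots> \<le> (2 * area v w)\<^sup>2"
    using b by (simp add: power_mult_distrib area_squared assms abs_square_le_1)
  finally have "norm (v - s *\<^sub>R w) \<le> 2 * area v w"
    by (rule power2_le_imp_le) (simp add: area_nonneg)
  then show ?thesis by (auto simp: s_def split: if_splits)
qed

section \<open>The second singular value\<close>

lemma inner_gram: "((transpose A ** A) *v x) \<bullet> y = (A *v x) \<bullet> (A *v y)" for A :: "real^'m^'m"
  by (metis dot_lmul_matrix inner_commute matrix_vector_mul_assoc vector_transpose_matrix)

text \<open>
  First-order optimality: for \<open>y\<close> in \<open>S\<close> the polynomial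
  \<open>t \<mapsto> |A e|\<^sup>2 |e + t y|\<^sup>2 - |A (e + t y)|\<^sup>2\<close> is nonnegative and vanishes at \<open>t = 0\<close>, so its linear
  coefficient is zero. This produces the two largest singular values directly, without diagonalising.
\<close>

lemma gram_maximizer_eigenvector:
  fixes A :: "real^'m^'m"
  assumes S: "subspace S" "\<And>x. x \<in> S \<Longrightarrow> (transpose A ** A) *v x \<in> S"
    and e: "e \<in> S" "norm e = 1" "\<And>x. x \<in> S \<Longrightarrow> norm (A *v x) \<le> norm (A *v e) * norm x"
  shows "(transpose A ** A) *v e = (norm (A *v e))\<^sup>2 *\<^sub>R e"
proof -
  define l where "l = (norm (A *v e))\<^sup>2"
  have key: "l * (e \<bullet> y) = (A *v e) \<bullet> (A *v y)" if y: "y \<in> S" for y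
  proof -
    define b where "b = l * (e \<bullet> y) - (A *v e) \<bullet> (A *v y)"
    define c where "c = l * (y \<bullet> y) - (A *v y) \<bullet> (A *v y)"
    have f: "0 \<le> 2 * t * b + t\<^sup>2 * c" for t
    proof -
      have "e + t *\<^sub>R y \<in> S" using S e y by (simp add: subspace_add subspace_scale)
      from e(3)[OF this] have "(norm (A *v (e + t *\<^sub>R y)))\<^sup>2 \<le> l * (norm (e + t *\<^sub>R y))\<^sup>2"
        unfolding l_def by (metis norm_ge_zero power_mono power_mult_distrib)
      moreover have "l * (norm (e + t *\<^sub>R y))\<^sup>2 - (norm (A *v (e + t *\<^sub>R y)))\<^sup>2 = 2 * t * b + t\<^sup>2 * c"
        using e(2) unfolding power2_norm_eq_inner b_def c_def l_def
        by (simp add: matrix_vector_right_distrib matrix_vector_mult_scaleR inner_add_left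
            inner_add_right inner_commute norm_eq_1 algebra_simps power2_eq_square)
      ultimately show ?thesis by linarith
    qed
    have "b = 0"
    proof (rule ccontr)
      assume "b \<noteq> 0"
      define t where "t = - b / (\<bar>c\<bar> + 1)"
      have tb: "t * b = - (t\<^sup>2 * (\<bar>c\<bar> + 1))"
        unfolding t_def by (simp add: power2_eq_square)
      have "t \<noteq> 0" using \<open>b \<noteq> 0\<close> by (auto simp: t_def)
      then have t2: "t\<^sup>2 > 0" by simp
      have "2 * t * b + t\<^sup>2 * c = t\<^sup>2 * (c - 2 * (\<bar>c\<bar> + 1))"
        using tb by (simp add: algebra_simps)
      moreover have "c - 2 * (\<bar>c\<bar> + 1) < 0" by (cases "0 \<le> c") auto
      ultimately show False using f[of t] t2 mult_pos_neg by (metis not_le)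
    qed
    then show ?thesis by (simp add: b_def)
  qed
  define z where "z = l *\<^sub>R e - (transpose A ** A) *v e"
  have zS: "z \<in> S" unfolding z_def using S e by (simp add: subspace_diff subspace_scale)
  have "z \<bullet> z = 0"
    using key[OF zS] unfolding z_def by (simp add: inner_diff_left inner_gram)
  then show ?thesis by (simp add: z_def l_def)
qed

lemma singular_eigenspace_iff:
  "x \<in> singular_eigenspace A s \<longleftrightarrow> (transpose A ** A) *v x = s\<^sup>2 *\<^sub>R x"
  by (simp add: singular_eigenspace_def)

lemma subspace_singular_eigenspace: "subspace (singular_eigenspace A s)"
  unfolding singular_eigenspace_def subspace_def
  by (auto simp: matrix_vector_right_distrib matrix_vector_mult_scaleR scaleR_add_right)

lemma norm_singular_eigenspace:
  fixes A :: "real^'m^'m"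
  assumes "x \<in> singular_eigenspace A s" "0 \<le> s"
  shows "norm (A *v x) = s * norm x"
proof -
  have "(norm (A *v x))\<^sup>2 = (s * norm x)\<^sup>2"
    using assms inner_gram[of A x x]
    by (simp add: singular_eigenspace_def power2_norm_eq_inner power_mult_distrib)
  then show ?thesis using assms by (simp add: power2_eq_iff_nonneg)
qed

lemma orthogonal_singular_eigenspaces:
  fixes A :: "real^'m^'m"
  assumes "x \<in> singular_eigenspace A s" "y \<in> singular_eigenspace A t" "0 \<le> s" "0 \<le> t" "s \<noteq> t"
  shows "x \<bullet> y = 0"
proof -
  have "s\<^sup>2 * (x \<bullet> y) = t\<^sup>2 * (x \<bullet> y)"
    using assms inner_gram[of A x y] inner_gram[of A y x]
    by (simp add: singular_eigenspace_def inner_commute)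
  moreover have "s\<^sup>2 \<noteq> t\<^sup>2" using assms by (simp add: power2_eq_iff_nonneg)
  ultimately show ?thesis by simp
qed

text \<open>
  Eigenvectors for different eigenvalues are orthogonal, hence independent. Finiteness matters
  because the multiset of singular values is a sum over this set.
\<close>

lemma finite_singular_value_set:
  "finite {s. 0 \<le> s \<and> singular_eigenspace A s \<noteq> {0}}" (is "finite ?S") for A :: "real^'m^'m"
proof -
  define x where "x s = (SOME x. x \<in> singular_eigenspace A s \<and> x \<noteq> 0)" for s
  have x: "x s \<in> singular_eigenspace A s" "x s \<noteq> 0" if "s \<in> ?S" for s
  proof -
    have "\<exists>x. x \<in> singular_eigenspace A s \<and> x \<noteq> 0"
      using that subspace_0[OF subspace_singular_eigenspace, of A s] by blast
    from someI_ex[OF this] show "x s \<in> singular_eigenspace A s" "x s \<noteq> 0"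
      by (auto simp: x_def)
  qed
  have ort: "x s \<bullet> x t = 0" if "s \<in> ?S" "t \<in> ?S" "s \<noteq> t" for s t
    using orthogonal_singular_eigenspaces[of "x s" A s "x t" t] x that by auto
  have "inj_on x ?S"
  proof (rule inj_onI)
    fix s t assume st: "s \<in> ?S" "t \<in> ?S" "x s = x t"
    show "s = t"
    proof (rule ccontr)
      assume "s \<noteq> t"
      then have "x s \<bullet> x s = 0" using ort[OF st(1,2)] st(3) by simp
      then show False using x(2)[OF st(1)] by simp
    qed
  qed
  moreover have "independent (x ` ?S)"
  proof (rule pairwise_orthogonal_independent)
    show "pairwise orthogonal (x ` ?S)"
      unfolding pairwise_def orthogonal_def using ort by blast
    show "0 \<notin> x ` ?S" using x(2) by fastforce
  qed
  then have "finite (x ` ?S)" by (rule independent_imp_finite)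
  ultimately show ?thesis using finite_imageD[of x ?S] by blast
qed

lemma count_singular_values:
  "count (singular_values A) s =
     (if 0 \<le> s \<and> singular_eigenspace A s \<noteq> {0} then dim (singular_eigenspace A s) else 0)"
  for A :: "real^'m^'m"
proof -
  let ?S = "{s. 0 \<le> s \<and> singular_eigenspace A s \<noteq> {0}}"
  have "count (singular_values A) s = (\<Sum>t\<in>?S. if t = s then dim (singular_eigenspace A t) else 0)"
    unfolding singular_values_def count_sum by (rule sum.cong) (simp_all add: eq_commute)
  also have "\<dots> = (if s \<in> ?S then dim (singular_eigenspace A s) else 0)"
    by (rule sum.delta[OF finite_singular_value_set])
  finally show ?thesis by simp
qed

lemma singular_value_2_of_few: "size (singular_values A) \<le> 1 \<Longrightarrow> singular_value 2 A = 0"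
  using size_mset[of "sorted_list_of_multiset (singular_values A)"]
  by (simp add: singular_value_def Let_def)

lemma singular_value_2_eqI:
  assumes "s1 \<in># singular_values A" "s2 \<in># singular_values A - {#s1#}" "s2 \<le> s1"
    "\<And>x. x \<in># singular_values A - {#s1, s2#} \<Longrightarrow> x \<le> s2"
  shows "singular_value 2 A = s2"
proof -
  define N where "N = singular_values A - {#s1, s2#}"
  have M: "singular_values A = N + {#s2, s1#}"
  proof -
    obtain K where K: "singular_values A = add_mset s1 K" using assms(1) by (metis insert_DiffM)
    with assms(2) obtain K' where "K = add_mset s2 K'" by (metis insert_DiffM add_mset_remove_trivial)
    with K show ?thesis by (simp add: N_def)
  qed
  define ys where "ys = sorted_list_of_multiset N @ [s2, s1]"
  have le: "x \<le> s2" if "x \<in># N" for x using assms(4) that N_def by simp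
  have "sorted ys" unfolding ys_def
    using le assms(3) by (fastforce simp: sorted_append)
  moreover have "mset ys = singular_values A" by (simp add: ys_def M)
  ultimately have "sorted_list_of_multiset (singular_values A) = ys"
    using sorted_list_of_multiset_mset[of ys] sorted_sort_id[of ys] by simp
  then show ?thesis by (simp add: singular_value_def ys_def Let_def)
qed

lemma mem_singular_values_iff:
  fixes A :: "real^'m^'m"
  shows "s \<in># singular_values A \<longleftrightarrow> 0 \<le> s \<and> (\<exists>x\<in>singular_eigenspace A s. x \<noteq> 0)"
proof -
  have "s \<in># singular_values A \<longleftrightarrow> 0 \<le> s \<and> \<not> singular_eigenspace A s \<subseteq> {0}"
    unfolding count_greater_zero_iff[symmetric] count_singular_values
    using dim_eq_0[of "singular_eigenspace A s"] subspace_0[OF subspace_singular_eigenspace, of A s]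
    by (auto split: if_splits)
  then show ?thesis by blast
qed

lemma top_singular_vector:
  fixes A :: "real^'m^'m"
  assumes "norm e = 1" "norm (A *v e) = opnorm A"
  shows "e \<in> singular_eigenspace A (opnorm A)"
  using gram_maximizer_eigenvector[of UNIV A e] norm_mult_le_opnorm[of A] assms
  by (simp add: singular_eigenspace_iff)

lemma inner_image_top_singular_vector:
  fixes A :: "real^'m^'m"
  assumes "norm e = 1" "norm (A *v e) = opnorm A"
  shows "(A *v x) \<bullet> (A *v e) = (opnorm A)\<^sup>2 * (x \<bullet> e)"
proof -
  have "(A *v x) \<bullet> (A *v e) = ((transpose A ** A) *v e) \<bullet> x"
    unfolding inner_gram by (rule inner_commute)
  also have "\<dots> = (opnorm A)\<^sup>2 * (x \<bullet> e)"
    using top_singular_vector[OF assms] by (simp add: singular_eigenspace_iff inner_commute)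
  finally show ?thesis .
qed

lemma singular_value_le_opnorm:
  fixes A :: "real^'m^'m"
  assumes "s \<in># singular_values A"
  shows "s \<le> opnorm A"
proof -
  obtain x where x: "0 \<le> s" "x \<in> singular_eigenspace A s" "x \<noteq> 0"
    using assms mem_singular_values_iff by blast
  then have "s * norm x \<le> opnorm A * norm x"
    using norm_mult_le_opnorm[of A x] norm_singular_eigenspace[of x A s] by simp
  then show ?thesis using x(3) by simp
qed

text \<open>
  If the second maximum is strictly smaller, the top eigenspace is a line and every other eigenvector
  is orthogonal to \<open>e1\<close>; if the two maxima agree, the top eigenspace has dimension at least two and
  the top value is listed twice.
\<close>

lemma singular_value_2_maximizer:
  fixes A :: "real^'m^'m"
  assumes e1: "norm e1 = 1" "norm (A *v e1) = opnorm A"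
    and e2: "norm e2 = 1" "e2 \<bullet> e1 = 0" "\<And>x. x \<bullet> e1 = 0 \<Longrightarrow> norm (A *v x) \<le> norm (A *v e2) * norm x"
  shows "singular_value 2 A = norm (A *v e2)"
proof -
  define s1 where "s1 = opnorm A"
  define s2 where "s2 = norm (A *v e2)"
  have s0: "0 \<le> s1" "0 \<le> s2" by (simp_all add: s1_def s2_def opnorm_nonneg)
  have s21: "s2 \<le> s1" using norm_mult_le_opnorm[of A e2] e2(1) by (simp add: s1_def s2_def)
  have E1: "e1 \<in> singular_eigenspace A s1" unfolding s1_def by (rule top_singular_vector[OF e1])
  have sub: "subspace {x. x \<bullet> e1 = 0}"
    by (auto simp: subspace_def inner_add_left)
  have "(transpose A ** A) *v e2 = (norm (A *v e2))\<^sup>2 *\<^sub>R e2"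
  proof (rule gram_maximizer_eigenvector[OF sub])
    fix x assume "x \<in> {x. x \<bullet> e1 = 0}"
    then show "(transpose A ** A) *v x \<in> {x. x \<bullet> e1 = 0}"
      using inner_image_top_singular_vector[OF e1, of x] by (simp add: inner_gram)
  qed (use e2 in auto)
  then have E2: "e2 \<in> singular_eigenspace A s2" by (simp add: singular_eigenspace_iff s2_def)
  have nz: "e1 \<noteq> 0" "e2 \<noteq> 0" using e1(1) e2(1) by auto
  have m1: "s1 \<in># singular_values A" and m2: "s2 \<in># singular_values A"
    unfolding mem_singular_values_iff using E1 E2 s0 nz by blast+
  have cnt: "count (singular_values A) s1 = dim (singular_eigenspace A s1)"
    using m1 unfolding count_greater_zero_iff[symmetric] count_singular_values by (simp split: if_splits)
  have "singular_value 2 A = s2"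
  proof (cases "s2 = s1")
    case True
    have ne: "e1 \<noteq> e2" using e2(2) nz by auto
    have "independent {e1, e2}"
      by (rule pairwise_orthogonal_independent)
        (use nz e2(2) in \<open>auto simp: pairwise_def orthogonal_def inner_commute\<close>)
    moreover have "{e1, e2} \<subseteq> singular_eigenspace A s1" using E1 E2 True by simp
    ultimately have "card {e1, e2} \<le> dim (singular_eigenspace A s1)"
      by (rule independent_card_le_dim[rotated])
    then have c2: "2 \<le> count (singular_values A) s1" using ne cnt by simp
    show ?thesis
    proof (rule singular_value_2_eqI[OF m1 _ s21])
      have "0 < count (singular_values A - {#s1#}) s2" using c2 True by simp
      then show "s2 \<in># singular_values A - {#s1#}" by (simp only: count_greater_zero_iff)
      fix x assume "x \<in># singular_values A - {#s1, s2#}"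
      then have "x \<in># singular_values A" by (rule in_diffD)
      then show "x \<le> s2" using singular_value_le_opnorm[of x A] True by (simp add: s1_def)
    qed
  next
    case False
    then have lt: "s2 < s1" using s21 by simp
    have "singular_eigenspace A s1 \<subseteq> span {e1}"
    proof
      fix y assume y: "y \<in> singular_eigenspace A s1"
      define z where "z = y - (y \<bullet> e1) *\<^sub>R e1"
      have "z \<in> singular_eigenspace A s1" unfolding z_def
        by (intro subspace_diff subspace_scale subspace_singular_eigenspace y E1)
      then have "norm (A *v z) = s1 * norm z" using s0 by (intro norm_singular_eigenspace)
      moreover have "z \<bullet> e1 = 0" using e1(1) by (simp add: z_def inner_diff_left norm_eq_1)
      then have "norm (A *v z) \<le> s2 * norm z" unfolding s2_def by (rule e2(3))
      ultimately have "(s1 - s2) * norm z \<le> 0" by (simp add: algebra_simps)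
      then have "z = 0" using lt by (simp add: mult_le_0_iff)
      then have "y = (y \<bullet> e1) *\<^sub>R e1" by (simp add: z_def)
      then show "y \<in> span {e1}" by (metis span_base span_scale singletonI)
    qed
    then have "dim (singular_eigenspace A s1) \<le> card {e1}" by (rule dim_le_card) simp
    then have c1: "count (singular_values A) s1 \<le> 1" using cnt by simp
    show ?thesis
    proof (rule singular_value_2_eqI[OF m1 _ s21])
      have "0 < count (singular_values A - {#s1#}) s2" using m2 False by simp
      then show "s2 \<in># singular_values A - {#s1#}" by (simp only: count_greater_zero_iff)
      fix x assume x: "x \<in># singular_values A - {#s1, s2#}"
      then have "x \<in># singular_values A" by (rule in_diffD)
      then obtain y where y: "0 \<le> x" "y \<in> singular_eigenspace A x" "y \<noteq> 0"
        using mem_singular_values_iff by blast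
      have "x \<noteq> s1"
      proof
        assume "x = s1"
        then have "0 < count (singular_values A - {#s1, s2#}) s1"
          using x by (simp only: count_greater_zero_iff)
        then show False using c1 by simp
      qed
      then have "y \<bullet> e1 = 0" using orthogonal_singular_eigenspaces[OF y(2) E1 y(1) s0(1)] by simp
      then have "norm (A *v y) \<le> s2 * norm y" unfolding s2_def by (rule e2(3))
      then show "x \<le> s2" using norm_singular_eigenspace[OF y(2,1)] y(3) by simp
    qed
  qed
  then show ?thesis by (simp add: s2_def)
qed

lemma singular_value_2_one_dim:
  fixes A :: "real^'m^'m"
  assumes e: "norm e = 1" "norm (A *v e) = opnorm A" and one: "\<And>x. x \<bullet> e = 0 \<Longrightarrow> x = 0"
  shows "singular_value 2 A = 0"
proof (rule singular_value_2_of_few)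
  let ?M = "singular_values A"
  have E: "e \<in> singular_eigenspace A (opnorm A)" by (rule top_singular_vector[OF e])
  have "set_mset ?M \<subseteq> {opnorm A}"
  proof
    fix s assume "s \<in># ?M"
    then obtain y where y: "0 \<le> s" "y \<in> singular_eigenspace A s" "y \<noteq> 0"
      using mem_singular_values_iff by blast
    then show "s \<in> {opnorm A}"
      using orthogonal_singular_eigenspaces[OF y(2) E y(1) opnorm_nonneg] one[of y] by blast
  qed
  then have M: "?M = replicate_mset (size ?M) (opnorm A)" by (rule set_mset_subset_singletonD)
  have "y \<in> span {e}" for y
  proof -
    have "(y - (y \<bullet> e) *\<^sub>R e) \<bullet> e = 0" using e(1) by (simp add: inner_diff_left norm_eq_1)
    then have "y = (y \<bullet> e) *\<^sub>R e" using one by fastforce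
    then show "y \<in> span {e}" by (metis span_base span_scale singletonI)
  qed
  then have "dim (singular_eigenspace A (opnorm A)) \<le> card {e}" by (intro dim_le_card) auto
  then have "count ?M (opnorm A) \<le> 1" unfolding count_singular_values by simp
  moreover have "count ?M (opnorm A) = size ?M" by (subst M) simp
  ultimately show "size ?M \<le> 1" by simp
qed

section \<open>The norm of the second exterior power\<close>

text \<open>
  The norm of \<open>A\<close> acting on bivectors, that is the product of the two largest singular values.
\<close>

definition exterior_norm :: "real^'m^'m \<Rightarrow> real" where
  "exterior_norm A = opnorm A * singular_value 2 A"

text \<open>
  In the plane spanned by \<open>u\<close> and \<open>w\<close> there is a direction orthogonal to the top singular vector
  \<open>e1\<close>; areas are invariant under rotations and shears, so \<open>w\<close> may be taken to be that direction and
  \<open>u\<close> orthogonal to \<open>w\<close>. Then one factor is stretched by at most the first and the other by at most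
  the second singular value. Equality holds for the two top singular vectors.
\<close>

lemma exterior_norm_is_area_norm:
  fixes A :: "real^'m^'m"
  shows "(\<exists>u w. norm u \<le> 1 \<and> norm w \<le> 1 \<and> exterior_norm A = area (A *v u) (A *v w)) \<and>
    (\<forall>u w. area (A *v u) (A *v w) \<le> exterior_norm A * area u w)"
proof -
  obtain e1 where e1: "norm e1 = 1" "norm (A *v e1) = opnorm A" by (rule opnorm_attained)
  define s2 where "s2 = singular_value 2 A"
  have ex: "0 \<le> s2 \<and> (\<forall>x. x \<bullet> e1 = 0 \<longrightarrow> norm (A *v x) \<le> s2 * norm x) \<and>
    (\<exists>u w. norm u \<le> 1 \<and> norm w \<le> 1 \<and> exterior_norm A = area (A *v u) (A *v w))"
  proof (cases "\<forall>x. x \<bullet> e1 = 0 \<longrightarrow> x = 0")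
    case True
    then have "s2 = 0" unfolding s2_def by (intro singular_value_2_one_dim[OF e1]) auto
    moreover have "norm (0::real^'m) \<le> 1 \<and> exterior_norm A = area (A *v 0) (A *v 0)"
      using \<open>s2 = 0\<close> by (simp add: exterior_norm_def s2_def area_def)
    then have "\<exists>u w. norm u \<le> 1 \<and> norm w \<le> 1 \<and> exterior_norm A = area (A *v u) (A *v w)"
      using norm_zero zero_le_one by metis
    ultimately show ?thesis using True by (metis mult_zero_left matrix_vector_mult_0_right norm_zero order_refl)
  next
    case False
    have "subspace {x. x \<bullet> e1 = 0}" by (auto simp: subspace_def inner_add_left)
    moreover have "{x. x \<bullet> e1 = 0} \<noteq> {0}" using False by auto
    ultimately obtain e2 where e2: "e2 \<in> {x. x \<bullet> e1 = 0}" "norm e2 = 1"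
      "\<And>x. x \<in> {x. x \<bullet> e1 = 0} \<Longrightarrow> norm (A *v x) \<le> norm (A *v e2) * norm x"
      by (rule norm_maximizer_on_subspace[where A = A]) (rule that)
    then have s2: "s2 = norm (A *v e2)" unfolding s2_def
      by (intro singular_value_2_maximizer[OF e1]) auto
    have "(A *v e2) \<bullet> (A *v e1) = 0"
      using inner_image_top_singular_vector[OF e1, of e2] e2(1) by simp
    then have "area (A *v e2) (A *v e1) = exterior_norm A"
      by (simp add: area_orthogonal exterior_norm_def e1 s2 s2_def[symmetric])
    then have "\<exists>u w. norm u \<le> 1 \<and> norm w \<le> 1 \<and> exterior_norm A = area (A *v u) (A *v w)"
      using e1(1) e2(2) by (intro exI[of _ e2] exI[of _ e1]) simp
    then show ?thesis using e2 s2 by simp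
  qed
  \<comment> \<open>The case of one vector orthogonal to the top singular vector.\<close>
  have perp: "area (A *v u) (A *v w) \<le> exterior_norm A * area u w" if w: "w \<bullet> e1 = 0" for u w
  proof (cases "w = 0")
    case False
    define u' where "u' = u + (- (u \<bullet> w / (w \<bullet> w))) *\<^sub>R w"
    have "u' \<bullet> w = 0" using False by (simp add: u'_def inner_diff_left)
    then have a: "area u w = norm u' * norm w"
      unfolding u'_def by (metis area_orthogonal area_shear)
    have "area (A *v u) (A *v w) = area (A *v u') (A *v w)"
      unfolding u'_def matrix_vector_right_distrib matrix_vector_mult_scaleR by (rule area_shear[symmetric])
    also have "\<dots> \<le> norm (A *v u') * norm (A *v w)" by (rule area_le)
    also have "\<dots> \<le> (opnorm A * norm u') * (s2 * norm w)"
      using ex w norm_mult_le_opnorm[of A u'] by (intro mult_mono) (auto simp: opnorm_nonneg)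
    also have "\<dots> = exterior_norm A * area u w"
      by (simp add: a exterior_norm_def s2_def)
    finally show ?thesis .
  qed (simp add: area_def)
  have "area (A *v u) (A *v w) \<le> exterior_norm A * area u w" for u w
  proof (cases "w \<bullet> e1 = 0")
    case False
    \<comment> \<open>Rotate the pair so that the second vector becomes orthogonal to \<open>e1\<close>.\<close>
    define r where "r = sqrt ((u \<bullet> e1)\<^sup>2 + (w \<bullet> e1)\<^sup>2)"
    have r2: "r\<^sup>2 = (u \<bullet> e1)\<^sup>2 + (w \<bullet> e1)\<^sup>2" by (simp add: r_def)
    have "(w \<bullet> e1)\<^sup>2 > 0" using False by simp
    then have r: "r > 0" unfolding r_def real_sqrt_gt_0_iff using zero_le_power2[of "u \<bullet> e1"] by linarith
    define a where "a = (u \<bullet> e1) / r"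
    define b where "b = (w \<bullet> e1) / r"
    have ab: "a\<^sup>2 + b\<^sup>2 = 1"
      using r by (simp add: a_def b_def power_divide add_divide_distrib[symmetric] r2[symmetric])
    define x where "x = a *\<^sub>R u + b *\<^sub>R w"
    define y where "y = b *\<^sub>R u - a *\<^sub>R w"
    have "y \<bullet> e1 = 0" by (simp add: y_def inner_diff_left a_def b_def)
    then have "area (A *v x) (A *v y) \<le> exterior_norm A * area x y" by (rule perp)
    moreover have "area x y = area u w" unfolding x_def y_def by (rule area_rotate[OF ab])
    moreover have "area (A *v x) (A *v y) = area (A *v u) (A *v w)"
      unfolding x_def y_def matrix_vector_right_distrib matrix_vector_mult_scaleR
        matrix_vector_mult_diff_distrib by (rule area_rotate[OF ab])
    ultimately show ?thesis by simp
  qed (rule perp)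
  with ex show ?thesis by blast
qed

lemma area_image_le: "area (A *v u) (A *v w) \<le> exterior_norm A * area u w" for A :: "real^'m^'m"
  using exterior_norm_is_area_norm[of A] by blast

lemma exterior_norm_attained:
  fixes A :: "real^'m^'m"
  obtains u w where "norm u \<le> 1" "norm w \<le> 1" "exterior_norm A = area (A *v u) (A *v w)"
  using exterior_norm_is_area_norm[of A] by blast

lemma exterior_norm_nonneg: "0 \<le> exterior_norm A" for A :: "real^'m^'m"
  by (metis exterior_norm_attained area_nonneg)

lemma area_image_le_unit:
  fixes A :: "real^'m^'m"
  assumes "norm u \<le> 1" "norm w \<le> 1"
  shows "area (A *v u) (A *v w) \<le> exterior_norm A"
proof -
  have "area u w \<le> 1" using area_le[of u w] mult_mono[of "norm u" 1 "norm w" 1] assms by simp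
  then have "exterior_norm A * area u w \<le> exterior_norm A"
    using mult_left_mono[of "area u w" 1 "exterior_norm A"] exterior_norm_nonneg[of A] by simp
  then show ?thesis using area_image_le[of A u w] by linarith
qed

lemma exterior_norm_mult: "exterior_norm (A ** B) \<le> exterior_norm A * exterior_norm B"
  for A B :: "real^'m^'m"
proof -
  obtain u w where uw: "norm u \<le> 1" "norm w \<le> 1" "exterior_norm (A ** B) = area ((A ** B) *v u) ((A ** B) *v w)"
    by (rule exterior_norm_attained)
  have "area (A *v (B *v u)) (A *v (B *v w)) \<le> exterior_norm A * area (B *v u) (B *v w)"
    by (rule area_image_le)
  also have "\<dots> \<le> exterior_norm A * exterior_norm B"
    by (intro mult_left_mono area_image_le_unit uw exterior_norm_nonneg)
  finally show ?thesis using uw(3) by (simp add: matrix_vector_mul_assoc)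
qed

lemma norm_image_le_unit: "norm u \<le> 1 \<Longrightarrow> norm (A *v u) \<le> opnorm A" for A :: "real^'m^'m"
  using norm_mult_le_opnorm[of A u] mult_left_mono[of "norm u" 1 "opnorm A"] opnorm_nonneg[of A] by simp

lemma exterior_norm_le: "exterior_norm A \<le> (opnorm A)\<^sup>2" for A :: "real^'m^'m"
proof -
  obtain u w where uw: "norm u \<le> 1" "norm w \<le> 1" "exterior_norm A = area (A *v u) (A *v w)"
    by (rule exterior_norm_attained)
  have "norm (A *v u) * norm (A *v w) \<le> opnorm A * opnorm A"
    by (intro mult_mono norm_image_le_unit uw) (auto simp: opnorm_nonneg)
  then show ?thesis using area_le[of "A *v u" "A *v w"] uw(3) by (simp add: power2_eq_square)
qed

text \<open>
  The area is bilinear up to norms, so it can be compared at a maximising pair for \<open>A\<close>.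
\<close>

lemma exterior_norm_le_perturbed:
  "exterior_norm A \<le> exterior_norm B + opnorm (A - B) * (opnorm A + opnorm B)" for A B :: "real^'m^'m"
proof -
  obtain u w where uw: "norm u \<le> 1" "norm w \<le> 1" "exterior_norm A = area (A *v u) (A *v w)"
    by (rule exterior_norm_attained)
  have 1: "norm (A *v u - B *v u) \<le> opnorm (A - B)" "norm (A *v w - B *v w) \<le> opnorm (A - B)"
    using norm_image_le_unit[OF uw(1), of "A - B"] norm_image_le_unit[OF uw(2), of "A - B"]
    by (simp_all add: matrix_vector_mult_diff_rdistrib)
  have "norm (A *v u - B *v u) * norm (A *v w) \<le> opnorm (A - B) * opnorm A"
    "norm (B *v u) * norm (A *v w - B *v w) \<le> opnorm B * opnorm (A - B)"
    by (intro mult_mono 1 norm_image_le_unit uw; simp add: opnorm_nonneg)+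
  moreover have "area (B *v u) (B *v w) \<le> exterior_norm B" by (rule area_image_le_unit[OF uw(1,2)])
  ultimately show ?thesis using area_perturb[of "A *v u" "A *v w" "B *v u" "B *v w"] uw(3)
    by (simp add: algebra_simps)
qed

lemma exterior_norm_diff:
  "\<bar>exterior_norm A - exterior_norm B\<bar> \<le> opnorm (A - B) * (opnorm A + opnorm B)" for A B :: "real^'m^'m"
  using exterior_norm_le_perturbed[of A B] exterior_norm_le_perturbed[of B A]
  by (simp add: opnorm_minus_commute[of B A] algebra_simps abs_le_iff)

lemma isCont_exterior_norm: "isCont exterior_norm A" for A :: "real^'m^'m"
proof -
  have o: "(opnorm \<longlongrightarrow> opnorm A) (at A)" using isCont_opnorm by (simp add: isCont_def)
  have "((\<lambda>B. opnorm (B - A)) \<longlongrightarrow> opnorm (A - A)) (at A)"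
    by (rule isCont_tendsto_compose[OF isCont_opnorm]) (intro tendsto_intros)
  then have "((\<lambda>B. opnorm (B - A) * (opnorm B + opnorm A)) \<longlongrightarrow> opnorm (A - A) * (opnorm A + opnorm A)) (at A)"
    by (intro tendsto_intros o)
  then have lim: "((\<lambda>B. opnorm (B - A) * (opnorm B + opnorm A)) \<longlongrightarrow> 0) (at A)"
    by (simp add: opnorm_zero)
  have "norm (exterior_norm B - exterior_norm A) \<le> opnorm (B - A) * (opnorm B + opnorm A)" for B
    using exterior_norm_diff[of B A] by simp
  then have "((\<lambda>B. exterior_norm B - exterior_norm A) \<longlongrightarrow> 0) (at A)"
    by (intro Lim_null_comparison[OF _ lim] always_eventually) blast
  then have "(exterior_norm \<longlongrightarrow> exterior_norm A) (at A)"
    using LIM_zero_cancel[of exterior_norm "exterior_norm A" "at A"] by simp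
  then show ?thesis by (simp add: isCont_def)
qed

lemma borel_measurable_exterior_norm [measurable (raw)]:
  fixes f :: "'a \<Rightarrow> real^'m^'m"
  assumes "f \<in> borel_measurable M"
  shows "(\<lambda>x. exterior_norm (f x)) \<in> borel_measurable M"
proof -
  have "continuous_on UNIV (\<lambda>A::real^'m^'m. exterior_norm A)"
    by (intro continuous_at_imp_continuous_on ballI isCont_exterior_norm)
  from borel_measurable_continuous_on[OF this assms] show ?thesis .
qed

section \<open>Relative growth of a vector\<close>

text \<open>
  A seminorm in \<open>v\<close> that is at most the norm. For \<open>A = 0\<close> it is \<open>0\<close>.
\<close>

definition growth_ratio :: "real^'m^'m \<Rightarrow> real^'m \<Rightarrow> real" where
  "growth_ratio A v = norm (A *v v) / opnorm A"

lemma growth_ratio_nonneg: "0 \<le> growth_ratio A v" for A :: "real^'m^'m"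
  by (simp add: growth_ratio_def opnorm_nonneg)

lemma growth_ratio_le_norm: "growth_ratio A v \<le> norm v" for A :: "real^'m^'m"
  using norm_mult_le_opnorm[of A v] opnorm_nonneg[of A]
  by (cases "opnorm A = 0") (auto simp: growth_ratio_def divide_le_eq mult.commute)

lemma growth_ratio_add: "growth_ratio A (v + w) \<le> growth_ratio A v + growth_ratio A w" for A :: "real^'m^'m"
  unfolding growth_ratio_def add_divide_distrib[symmetric] matrix_vector_right_distrib
  by (intro divide_right_mono norm_triangle_ineq opnorm_nonneg)

lemma growth_ratio_scale: "growth_ratio A (c *\<^sub>R v) = \<bar>c\<bar> * growth_ratio A v" for A :: "real^'m^'m"
  by (simp add: growth_ratio_def matrix_vector_mult_scaleR)

text \<open>
  When the second singular value is small compared with the first, the growth ratio of \<open>v\<close> is nearly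
  the cosine of its angle with the top singular vector.
\<close>

lemma growth_ratio_top_singular_vector:
  fixes A :: "real^'m^'m"
  assumes "0 < opnorm A" "norm e = 1" "norm (A *v e) = opnorm A" "norm v = 1"
  shows "(v \<bullet> e)\<^sup>2 \<le> (growth_ratio A v)\<^sup>2"
    and "(growth_ratio A v)\<^sup>2 \<le> (v \<bullet> e)\<^sup>2 + (exterior_norm A / (opnorm A)\<^sup>2)\<^sup>2"
proof -
  define a where "a = opnorm A"
  define u where "u = v - (v \<bullet> e) *\<^sub>R e"
  have a: "a > 0" using assms by (simp add: a_def)
  have ee: "e \<bullet> e = 1" "v \<bullet> v = 1" using assms by (simp_all add: norm_eq_1)
  have ue: "u \<bullet> e = 0" by (simp add: u_def inner_diff_left ee)
  have ort: "(A *v u) \<bullet> (A *v e) = 0"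
    using inner_image_top_singular_vector[OF assms(2,3), of u] ue by simp
  have v: "v = (v \<bullet> e) *\<^sub>R e + u" by (simp add: u_def)
  have Av: "A *v v = (v \<bullet> e) *\<^sub>R (A *v e) + A *v u"
    by (subst v) (simp only: matrix_vector_right_distrib matrix_vector_mult_scaleR)
  have "(norm (A *v v))\<^sup>2 = (v \<bullet> e)\<^sup>2 * a\<^sup>2 + (norm (A *v u))\<^sup>2"
    unfolding Av a_def assms(3)[symmetric] power2_norm_eq_inner
    by (simp add: inner_add_left inner_add_right ort inner_commute[of "A *v e" "A *v u"] power2_eq_square)
  then have eq: "(growth_ratio A v)\<^sup>2 = (v \<bullet> e)\<^sup>2 + (norm (A *v u) / a)\<^sup>2"
    using a by (simp add: growth_ratio_def a_def[symmetric] power_divide add_divide_distrib)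
  then show "(v \<bullet> e)\<^sup>2 \<le> (growth_ratio A v)\<^sup>2" by simp
  have "(norm u)\<^sup>2 = 1 - (v \<bullet> e)\<^sup>2"
    unfolding u_def power2_norm_eq_inner
    by (simp add: inner_diff_left inner_diff_right ee inner_commute power2_eq_square)
  then have "(norm u)\<^sup>2 \<le> 1" by simp
  then have u1: "norm u \<le> 1" by (simp add: abs_square_le_1)
  have "norm (A *v u) * a = area (A *v u) (A *v e)"
    using ort by (simp add: area_orthogonal a_def assms(3))
  also have "\<dots> \<le> exterior_norm A" by (rule area_image_le_unit) (simp_all add: u1 assms)
  finally have "norm (A *v u) / a \<le> exterior_norm A / a\<^sup>2"
    using a by (simp add: field_simps power2_eq_square)
  then have "(norm (A *v u) / a)\<^sup>2 \<le> (exterior_norm A / a\<^sup>2)\<^sup>2"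
    using a by (intro power_mono) auto
  then show "(growth_ratio A v)\<^sup>2 \<le> (v \<bullet> e)\<^sup>2 + (exterior_norm A / (opnorm A)\<^sup>2)\<^sup>2"
    using eq by (simp add: a_def)
qed

text \<open>
  The top singular vectors \<open>e\<close> of \<open>A\<close> and \<open>f\<close> of \<open>g A\<close> are close: the component \<open>u\<close> of \<open>f\<close>
  orthogonal to \<open>e\<close> satisfies \<open>|g A|\<^sup>2 |u|\<^sup>2 = \<langle>g A u, g A f\<rangle>\<close>, while \<open>A\<close> stretches \<open>u\<close> by at most its
  second singular value. By the previous lemma the two growth ratios differ little.
\<close>

lemma growth_ratio_step:
  fixes A g :: "real^'m^'m"
  assumes pos: "0 < opnorm (g ** A)" and v: "norm v = 1"
  shows "\<bar>(growth_ratio (g ** A) v)\<^sup>2 - (growth_ratio A v)\<^sup>2\<bar>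
    \<le> 5 * ((opnorm g)\<^sup>2 * exterior_norm A / (opnorm (g ** A))\<^sup>2)"
proof -
  define B where "B = g ** A"
  define a where "a = opnorm A"
  define b where "b = opnorm B"
  define W where "W = exterior_norm A"
  define t where "t = (opnorm g)\<^sup>2 * W / b\<^sup>2"
  have b: "b > 0" using pos by (simp add: b_def B_def)
  have bga: "b \<le> opnorm g * a" unfolding b_def B_def a_def by (rule opnorm_mult)
  have W0: "0 \<le> W" by (simp add: W_def exterior_norm_nonneg)
  have g0: "0 \<le> opnorm g" by (rule opnorm_nonneg)
  have "a \<noteq> 0" using bga b by auto
  then have a: "a > 0" using opnorm_nonneg[of A] by (simp add: a_def)
  have t0: "0 \<le> t" using W0 by (simp add: t_def)
  have ratio: "1 / a \<le> opnorm g / b" using a b bga by (simp add: field_simps)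
  have tA: "W / a\<^sup>2 \<le> t"
  proof -
    have "(1 / a)\<^sup>2 \<le> (opnorm g / b)\<^sup>2" using ratio a by (intro power_mono) auto
    from mult_left_mono[OF this W0] show ?thesis by (simp add: t_def power_divide mult.commute)
  qed
  have tB: "exterior_norm B / b\<^sup>2 \<le> t"
  proof -
    have "exterior_norm B \<le> exterior_norm g * W" unfolding B_def W_def by (rule exterior_norm_mult)
    also have "\<dots> \<le> (opnorm g)\<^sup>2 * W" by (intro mult_right_mono exterior_norm_le W0)
    finally show ?thesis unfolding t_def by (intro divide_right_mono) auto
  qed
  obtain e where e: "norm e = 1" "norm (A *v e) = opnorm A" by (rule opnorm_attained)
  obtain f where f: "norm f = 1" "norm (B *v f) = opnorm B" by (rule opnorm_attained)
  have ef: "area e f \<le> t"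
  proof -
    define u where "u = f - (f \<bullet> e) *\<^sub>R e"
    have ee: "e \<bullet> e = 1" "f \<bullet> f = 1" using e f by (simp_all add: norm_eq_1)
    have ue: "u \<bullet> e = 0" by (simp add: u_def inner_diff_left ee)
    have "e \<noteq> 0" using e(1) by auto
    then have nu: "norm u = area e f"
      using area_projection[of e f] e(1) ee by (simp add: u_def area_commute)
    have uf: "u \<bullet> f = (norm u)\<^sup>2"
      unfolding u_def power2_norm_eq_inner
      by (simp add: inner_diff_left inner_diff_right ee inner_commute power2_eq_square)
    have "b\<^sup>2 * (norm u)\<^sup>2 = (B *v u) \<bullet> (B *v f)"
      using inner_image_top_singular_vector[OF f, of u] uf by (simp add: b_def)
    also have "\<dots> \<le> norm (B *v u) * b" using norm_cauchy_schwarz[of "B *v u" "B *v f"] f by (simp add: b_def)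
    finally have 1: "b * (norm u)\<^sup>2 \<le> norm (B *v u)" using b by (simp add: power2_eq_square)
    have ort: "(A *v u) \<bullet> (A *v e) = 0"
      using inner_image_top_singular_vector[OF e, of u] ue by simp
    have "norm (A *v u) * a = area (A *v u) (A *v e)"
      using ort by (simp add: area_orthogonal a_def e)
    also have "\<dots> \<le> W * area u e" unfolding W_def by (rule area_image_le)
    also have "\<dots> = W * norm u" using ue e by (simp add: area_orthogonal)
    finally have "norm (A *v u) \<le> W * norm u / a" using a by (simp add: field_simps)
    then have "norm (B *v u) \<le> opnorm g * (W * norm u / a)"
      using norm_mult_le_opnorm[of g "A *v u"] mult_left_mono[OF _ g0] order_trans
      unfolding B_def matrix_vector_mul_assoc[symmetric] by blast
    also have "\<dots> \<le> opnorm g * (W * norm u * (opnorm g / b))"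
      using mult_left_mono[OF ratio, of "opnorm g * (W * norm u)"] W0 g0 by (simp add: algebra_simps)
    finally have "b * (norm u)\<^sup>2 \<le> opnorm g * (W * norm u * (opnorm g / b))" using 1 by linarith
    then have "norm u * (norm u) \<le> norm u * t" using b
      by (simp add: t_def field_simps power2_eq_square)
    then show ?thesis unfolding nu[symmetric] using t0 norm_ge_zero[of u] mult_le_cancel_left_pos[of "norm u" "norm u" t]
      by (cases "norm u = 0") auto
  qed
  have angle: "\<bar>(v \<bullet> e)\<^sup>2 - (v \<bullet> f)\<^sup>2\<bar> \<le> 4 * t"
  proof -
    obtain s where s: "s \<in> {1, -1::real}" "norm (e - s *\<^sub>R f) \<le> 2 * area e f"
      using area_controls_distance[OF e(1) f(1)] by blast
    have "(v \<bullet> e)\<^sup>2 - (v \<bullet> f)\<^sup>2 = (v \<bullet> (e - s *\<^sub>R f)) * (v \<bullet> (e + s *\<^sub>R f))"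
      using s(1) by (auto simp: inner_diff_right inner_add_right algebra_simps power2_eq_square)
    moreover have "\<bar>v \<bullet> (e - s *\<^sub>R f)\<bar> \<le> 2 * area e f"
      using Cauchy_Schwarz_ineq2[of v "e - s *\<^sub>R f"] s(2) v by simp
    moreover have "norm (e + s *\<^sub>R f) \<le> 2"
      using norm_triangle_ineq[of e "s *\<^sub>R f"] e(1) f(1) s(1) by auto
    then have "\<bar>v \<bullet> (e + s *\<^sub>R f)\<bar> \<le> 2"
      using Cauchy_Schwarz_ineq2[of v "e + s *\<^sub>R f"] v by simp
    ultimately have "\<bar>(v \<bullet> e)\<^sup>2 - (v \<bullet> f)\<^sup>2\<bar> \<le> (2 * area e f) * 2"
      by (simp only: abs_mult) (intro mult_mono, auto simp: area_nonneg)
    then show ?thesis using ef by simp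
  qed
  show ?thesis
  proof (cases "t \<le> 1")
    case True
    have sq: "x\<^sup>2 \<le> t" if "0 \<le> x" "x \<le> t" for x
      using mult_mono[of x t x 1] that True t0 by (simp add: power2_eq_square)
    have "(W / a\<^sup>2)\<^sup>2 \<le> t" "(exterior_norm B / b\<^sup>2)\<^sup>2 \<le> t"
      by (intro sq tA tB; simp add: W0 exterior_norm_nonneg)+
    moreover note growth_ratio_top_singular_vector[OF _ e v] growth_ratio_top_singular_vector[OF _ f v]
    ultimately have "\<bar>(growth_ratio B v)\<^sup>2 - (growth_ratio A v)\<^sup>2\<bar> \<le> 5 * t"
      using angle a b unfolding a_def b_def W_def by (simp add: abs_le_iff)
    then show ?thesis by (simp add: t_def B_def b_def W_def)
  next
    case False
    have "0 \<le> (growth_ratio M v)\<^sup>2" "(growth_ratio M v)\<^sup>2 \<le> 1" for M :: "real^'m^'m"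
      using growth_ratio_le_norm[of M v] growth_ratio_nonneg[of M v] v by (auto simp: abs_square_le_1)
    from this[of B] this[of A] have "\<bar>(growth_ratio B v)\<^sup>2 - (growth_ratio A v)\<^sup>2\<bar> \<le> 1"
      unfolding abs_le_iff by linarith
    then have "\<bar>(growth_ratio B v)\<^sup>2 - (growth_ratio A v)\<^sup>2\<bar> \<le> 5 * t" using False by linarith
    then show ?thesis by (simp add: t_def B_def b_def W_def)
  qed
qed

section \<open>Elementary inequalities\<close>

lemma powr_subadditive:
  fixes a b r :: real
  assumes "0 \<le> a" "0 \<le> b" "0 < r" "r \<le> 1"
  shows "(a + b) powr r \<le> a powr r + b powr r"
proof (cases "a + b = 0")
  case False
  then have s: "a + b > 0" using assms by simp
  have "x / (a + b) \<le> (x / (a + b)) powr r" if "0 \<le> x" "x \<le> a + b" for x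
  proof (cases "x = 0")
    case False
    with that s have "0 < x / (a + b)" "x / (a + b) \<le> 1" by auto
    then show ?thesis using powr_mono'[of r 1 "x / (a + b)"] assms that by (simp add: abs_of_nonneg)
  qed simp
  from this[of a] this[of b] have "a / (a + b) + b / (a + b) \<le> (a / (a + b)) powr r + (b / (a + b)) powr r"
    using assms by linarith
  moreover have "a / (a + b) + b / (a + b) = 1" using s by (simp add: add_divide_distrib[symmetric])
  ultimately show ?thesis using assms s by (simp add: powr_divide field_simps)
qed (use assms in simp)

lemma powr_sum_mono: "0 \<le> x \<Longrightarrow> 0 \<le> r \<Longrightarrow> r \<le> p \<Longrightarrow> x powr r \<le> 1 + x powr p" for x r p :: real
proof (cases "x \<le> 1")
  case True
  assume "0 \<le> x" "0 \<le> r"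
  then have "x powr r \<le> 1" using True powr_mono2[of r x 1] by simp
  then show ?thesis by (simp add: add_increasing2)
next
  case False
  assume "r \<le> p"
  then have "x powr r \<le> x powr p" using False by (intro powr_mono) auto
  then show ?thesis by simp
qed

text \<open>
  A Hoelder estimate for the logarithm whose price is paid in negative moments, from
  \<open>ln x - ln y \<le> ((x / y)\<^sup>r - 1) / r\<close> and subadditivity of \<open>x\<^sup>r\<close>.
\<close>

lemma ln_diff_le:
  fixes x y r :: real
  assumes "0 < x" "0 < y" "0 < r" "r \<le> 1"
  shows "\<bar>ln x - ln y\<bar> \<le> \<bar>x - y\<bar> powr r * (x powr -r + y powr -r) / r"
proof -
  have *: "ln x - ln y \<le> \<bar>x - y\<bar> powr r * (x powr -r + y powr -r) / r \<and>
      ln y - ln x \<le> \<bar>x - y\<bar> powr r * (x powr -r + y powr -r) / r"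
    if xy: "0 < y" "y \<le> x" for x y
  proof -
    have x: "0 < x" using xy by simp
    have "r * (ln x - ln y) = ln ((x / y) powr r)" using x xy by (simp add: ln_powr ln_div)
    also have "\<dots> \<le> (x / y) powr r - 1" using x xy by (intro ln_le_minus_one) simp
    also have "\<dots> = (x powr r - y powr r) * y powr -r"
      using x xy by (simp add: powr_divide powr_minus field_simps)
    also have "x powr r \<le> (x - y) powr r + y powr r"
      using powr_subadditive[of "x - y" y r] xy assms by simp
    then have "(x powr r - y powr r) * y powr -r \<le> \<bar>x - y\<bar> powr r * y powr -r"
      using xy by (intro mult_right_mono) auto
    also have "\<dots> \<le> \<bar>x - y\<bar> powr r * (x powr -r + y powr -r)" by (intro mult_left_mono) auto
    finally have "ln x - ln y \<le> \<bar>x - y\<bar> powr r * (x powr -r + y powr -r) / r"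
      using assms by (simp add: field_simps)
    moreover have "ln y \<le> ln x" using xy by simp
    moreover have "0 \<le> \<bar>x - y\<bar> powr r * (x powr -r + y powr -r) / r" using assms by simp
    ultimately show ?thesis by linarith
  qed
  show ?thesis
  proof (cases "y \<le> x")
    case True
    then show ?thesis using *[of y x] assms by (simp add: abs_le_iff)
  next
    case False
    then show ?thesis using *[of x y] assms by (simp add: abs_le_iff abs_minus_commute add.commute)
  qed
qed

lemma abs_ln_le:
  fixes x r :: real
  assumes "0 < x" "0 < r"
  shows "\<bar>ln x\<bar> \<le> (x powr r + x powr -r) / r"
proof -
  have "ln z \<le> z powr r / r" if "0 < z" for z
    using ln_le_minus_one[of "z powr r"] that assms by (simp add: ln_powr field_simps)
  from this[of x] this[of "1 / x"] have "ln x \<le> x powr r / r" "- ln x \<le> x powr -r / r"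
    using assms by (auto simp: ln_div powr_divide powr_minus_divide)
  moreover have "0 \<le> x powr r / r" "0 \<le> x powr -r / r" using assms by auto
  ultimately show ?thesis by (simp add: abs_le_iff add_divide_distrib)
qed

text \<open>
  Taylor's formula; with the weight \<open>exp |z|\<close> the bound holds for every \<open>z\<close>, so that a centred variable
  with exponential moments is subgaussian near the origin.
\<close>

lemma exp_le_quadratic: "exp z \<le> 1 + z + z\<^sup>2 * exp \<bar>z\<bar>" for z :: real
proof -
  obtain t where t: "\<bar>t\<bar> \<le> \<bar>z\<bar>" "exp z = (\<Sum>m<2. z ^ m / fact m) + exp t / fact 2 * z ^ 2"
    using Maclaurin_exp_le[of z 2] by blast
  have "exp t / 2 * z\<^sup>2 \<le> exp \<bar>z\<bar> * z\<^sup>2"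
  proof (intro mult_right_mono)
    have "exp t \<le> exp \<bar>z\<bar>" using t(1) by simp
    then show "exp t / 2 \<le> exp \<bar>z\<bar>" using exp_gt_zero[of t] by linarith
  qed simp
  then show ?thesis using t(2) by (simp add: numeral_2_eq_2 mult.commute)
qed

lemma square_le_exp:
  fixes s z :: real
  assumes "0 < s"
  shows "z\<^sup>2 \<le> 2 / s\<^sup>2 * exp (s * \<bar>z\<bar>)"
proof -
  have "(s * \<bar>z\<bar>)\<^sup>2 / 2 \<le> exp (s * \<bar>z\<bar>)"
    using exp_lower_Taylor_quadratic[of "s * \<bar>z\<bar>"] assms
    by (smt (verit) mult_nonneg_nonneg abs_ge_zero)
  then show ?thesis using assms by (simp add: field_simps power_mult_distrib)
qed

lemma exp_abs_ln_le:
  fixes x r :: real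
  assumes "0 < x" "0 \<le> r"
  shows "exp (r * \<bar>ln x\<bar>) \<le> x powr r + x powr -r"
  using assms by (cases "0 \<le> ln x") (auto simp: powr_def add_increasing add_increasing2)

text \<open>
  The free scale \<open>t\<close> replaces the Cauchy-Schwarz inequality for integrals.
\<close>

lemma scaled_amgm:
  fixes x y t :: real
  assumes "0 < t"
  shows "x * y \<le> x\<^sup>2 / t + t * y\<^sup>2"
proof -
  have "0 \<le> (x - t * y)\<^sup>2 / t" "0 \<le> x\<^sup>2 / t + t * y\<^sup>2" using assms by auto
  moreover have "(x - t * y)\<^sup>2 / t = x\<^sup>2 / t + t * y\<^sup>2 - 2 * (x * y)"
    using assms by (simp add: power2_eq_square field_simps)
  ultimately show ?thesis by linarith
qed

section \<open>Moment bounds\<close>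

lemma integrable_of_nn_integral_le:
  fixes f :: "'a \<Rightarrow> real"
  assumes [measurable]: "f \<in> borel_measurable M" and nn: "\<And>x. 0 \<le> f x"
    and le: "(\<integral>\<^sup>+ x. ennreal (f x) \<partial>M) \<le> ennreal D" and D: "0 \<le> D"
  shows "integrable M f" and "(\<integral>x. f x \<partial>M) \<le> D"
proof -
  have "(\<integral>\<^sup>+ x. ennreal (f x) \<partial>M) < \<infinity>" using le by (rule order.strict_trans1) simp
  then show int: "integrable M f" by (intro integrableI_nonneg) (auto simp: nn)
  have "ennreal (\<integral>x. f x \<partial>M) = (\<integral>\<^sup>+ x. ennreal (f x) \<partial>M)"
    by (rule nn_integral_eq_integral[symmetric, OF int]) (simp add: nn)
  then have "ennreal (\<integral>x. f x \<partial>M) \<le> ennreal D" using le by simp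
  then show "(\<integral>x. f x \<partial>M) \<le> D" unfolding ennreal_le_iff[OF D] .
qed

lemma moment_classD:
  assumes "\<kappa> \<in> moment_class p D"
  shows "prob_space \<kappa>" "sets \<kappa> = sets borel" "space \<kappa> = UNIV"
proof -
  show 1: "prob_space \<kappa>" "sets \<kappa> = sets borel" using assms by (auto simp: moment_class_def)
  show "space \<kappa> = UNIV" using sets_eq_imp_space_eq[OF 1(2)] by simp
qed

lemma opnorm_moment:
  assumes k: "\<kappa> \<in> moment_class p D" and D: "0 \<le> D"
  shows "integrable \<kappa> (\<lambda>g. opnorm g powr p)" "(\<integral>g. opnorm g powr p \<partial>\<kappa>) \<le> D"
proof -
  note [measurable_cong] = moment_classD(2)[OF k]
  have "(\<lambda>g. opnorm g powr p) \<in> borel_measurable \<kappa>" by measurable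
  moreover have "(\<integral>\<^sup>+ g. ennreal (opnorm g powr p) \<partial>\<kappa>) \<le> ennreal D"
    using k by (simp add: moment_class_def Theta_upper_def)
  ultimately show "integrable \<kappa> (\<lambda>g. opnorm g powr p)" "(\<integral>g. opnorm g powr p \<partial>\<kappa>) \<le> D"
    using D by (intro integrable_of_nn_integral_le; simp)+
qed

text \<open>
  At \<open>v = 0\<close> the right-hand side is infinite, which lets the bound be iterated along a product of
  matrices, where \<open>g v\<close> may vanish on a null set.
\<close>

lemma lower_moment_scaled:
  assumes k: "\<kappa> \<in> moment_class p D" and D: "0 < D"
  shows "(\<integral>\<^sup>+ g. inverse (ennreal (norm (g *v v) powr p)) \<partial>\<kappa>)
    \<le> ennreal D * inverse (ennreal (norm v powr p))"
proof (cases "v = 0")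
  case True
  then show ?thesis using D by (simp add: ennreal_mult_top)
next
  case False
  note [measurable_cong] = moment_classD(2)[OF k]
  define u where "u = v /\<^sub>R norm v"
  have u: "norm u = 1" using False by (simp add: u_def)
  have v: "v = norm v *\<^sub>R u" using False by (simp add: u_def)
  have "(\<integral>\<^sup>+ g. inverse (ennreal (norm (g *v u) powr p)) \<partial>\<kappa>) \<le> Theta_lower p \<kappa>"
    unfolding Theta_lower_def by (rule SUP_upper) (simp add: u)
  also have "\<dots> \<le> ennreal D" using k by (simp add: moment_class_def)
  finally have le: "(\<integral>\<^sup>+ g. inverse (ennreal (norm (g *v u) powr p)) \<partial>\<kappa>) \<le> ennreal D" .
  have eq: "inverse (ennreal (norm (g *v v) powr p)) =
      inverse (ennreal (norm (g *v u) powr p)) * inverse (ennreal (norm v powr p))" for g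
  proof -
    have "norm (g *v v) = norm v * norm (g *v u)"
      by (subst v) (simp add: matrix_vector_mult_scaleR)
    then have "ennreal (norm (g *v v) powr p) = ennreal (norm (g *v u) powr p) * ennreal (norm v powr p)"
      by (simp add: powr_mult ennreal_mult mult.commute)
    then show ?thesis
      using False by (simp add: ennreal_inverse_mult)
  qed
  have "(\<integral>\<^sup>+ g. inverse (ennreal (norm (g *v v) powr p)) \<partial>\<kappa>) =
      (\<integral>\<^sup>+ g. inverse (ennreal (norm (g *v u) powr p)) \<partial>\<kappa>) * inverse (ennreal (norm v powr p))"
    unfolding eq by (rule nn_integral_multc) measurable
  also have "\<dots> \<le> ennreal D * inverse (ennreal (norm v powr p))" by (intro mult_right_mono le) simp
  finally show ?thesis .
qed

lemma vector_moment:
  assumes k: "\<kappa> \<in> moment_class p D" and D: "0 < D" and p: "0 < p" and v: "v \<noteq> 0"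
  shows "AE g in \<kappa>. g *v v \<noteq> 0"
    and "integrable \<kappa> (\<lambda>g. norm (g *v v) powr -p)"
    and "(\<integral>g. norm (g *v v) powr -p \<partial>\<kappa>) \<le> D * norm v powr -p"
proof -
  note [measurable_cong] = moment_classD(2)[OF k]
  have inv: "inverse (ennreal (x powr p)) = ennreal (x powr -p)" if "x > 0" for x
    using that by (simp add: inverse_ennreal powr_minus)
  have le: "(\<integral>\<^sup>+ g. inverse (ennreal (norm (g *v v) powr p)) \<partial>\<kappa>) \<le> ennreal (D * norm v powr -p)"
    using lower_moment_scaled[OF k D, of v] v D by (simp add: inv ennreal_mult)
  then have "(\<integral>\<^sup>+ g. inverse (ennreal (norm (g *v v) powr p)) \<partial>\<kappa>) \<noteq> \<infinity>"
    by (auto simp: top_unique)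
  then have "AE g in \<kappa>. inverse (ennreal (norm (g *v v) powr p)) \<noteq> \<infinity>"
    by (intro nn_integral_PInf_AE) measurable
  then show nz: "AE g in \<kappa>. g *v v \<noteq> 0"
    by eventually_elim auto
  have "(\<integral>\<^sup>+ g. ennreal (norm (g *v v) powr -p) \<partial>\<kappa>) =
      (\<integral>\<^sup>+ g. inverse (ennreal (norm (g *v v) powr p)) \<partial>\<kappa>)"
    using nz by (intro nn_integral_cong_AE) (auto simp: inv elim!: eventually_mono)
  with le have le': "(\<integral>\<^sup>+ g. ennreal (norm (g *v v) powr -p) \<partial>\<kappa>) \<le> ennreal (D * norm v powr -p)" by simp
  show "integrable \<kappa> (\<lambda>g. norm (g *v v) powr -p)"
    "(\<integral>g. norm (g *v v) powr -p \<partial>\<kappa>) \<le> D * norm v powr -p"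
    using D by (intro integrable_of_nn_integral_le[OF _ _ le']; simp; measurable)+
qed

lemma integrable_ln_norm:
  assumes k: "\<kappa> \<in> moment_class p D" and D: "0 < D" and p: "0 < p" and v: "v \<noteq> 0"
  shows "integrable \<kappa> (\<lambda>g. ln (norm (g *v v)))"
proof (rule Bochner_Integration.integrable_bound)
  note [measurable_cong] = moment_classD(2)[OF k]
  show "integrable \<kappa> (\<lambda>g. (opnorm g powr p * norm v powr p + norm (g *v v) powr -p) / p)"
    using D by (intro Bochner_Integration.integrable_divide Bochner_Integration.integrable_add
      integrable_mult_left opnorm_moment[OF k] vector_moment[OF k D p v]) simp
  show "(\<lambda>g. ln (norm (g *v v))) \<in> borel_measurable \<kappa>" by measurable
  show "AE g in \<kappa>. norm (ln (norm (g *v v)))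
      \<le> norm ((opnorm g powr p * norm v powr p + norm (g *v v) powr -p) / p)"
    using vector_moment(1)[OF k D p v]
  proof eventually_elim
    case (elim g)
    have "norm (g *v v) powr p \<le> (opnorm g * norm v) powr p"
      using norm_mult_le_opnorm[of g v] p by (intro powr_mono2) auto
    then have "norm (g *v v) powr p \<le> opnorm g powr p * norm v powr p"
      by (simp add: powr_mult opnorm_nonneg)
    moreover have "\<bar>ln (norm (g *v v))\<bar> \<le> (norm (g *v v) powr p + norm (g *v v) powr -p) / p"
      using elim p by (intro abs_ln_le) auto
    ultimately have "\<bar>ln (norm (g *v v))\<bar> \<le> (opnorm g powr p * norm v powr p + norm (g *v v) powr -p) / p"
      using p by (simp add: field_simps)
    moreover have "0 \<le> (opnorm g powr p * norm v powr p + norm (g *v v) powr -p) / p" using p by simp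
    ultimately show ?case by (simp only: real_norm_def abs_of_nonneg)
  qed
qed

text \<open>
  The logarithm is the real one with \<open>ln 0 = 0\<close>; in a moment class \<open>g v = 0\<close> has probability zero for
  each \<open>v \<noteq> 0\<close>.
\<close>

definition mean_log :: "(real^'m^'m) measure \<Rightarrow> real^'m \<Rightarrow> real" where
  "mean_log \<kappa> v = (\<integral>g. ln (norm (g *v v)) \<partial>\<kappa>)"

lemma mean_log_scale:
  assumes k: "\<kappa> \<in> moment_class p D" and D: "0 < D" and p: "0 < p" and v: "v \<noteq> 0" and c: "c \<noteq> 0"
  shows "mean_log \<kappa> (c *\<^sub>R v) = ln \<bar>c\<bar> + mean_log \<kappa> v"
proof -
  interpret prob_space \<kappa> by (rule moment_classD[OF k])
  note [measurable_cong] = moment_classD(2)[OF k]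
  have "mean_log \<kappa> (c *\<^sub>R v) = (\<integral>g. ln \<bar>c\<bar> + ln (norm (g *v v)) \<partial>\<kappa>)"
    unfolding mean_log_def
  proof (rule integral_cong_AE)
    show "AE g in \<kappa>. ln (norm (g *v (c *\<^sub>R v))) = ln \<bar>c\<bar> + ln (norm (g *v v))"
      using vector_moment(1)[OF k D p v]
      by eventually_elim (simp add: matrix_vector_mult_scaleR ln_mult c)
  qed measurable
  also have "\<dots> = ln \<bar>c\<bar> + mean_log \<kappa> v"
    unfolding mean_log_def using integrable_ln_norm[OF k D p v]
    by (subst Bochner_Integration.integral_add) (auto simp: prob_space)
  finally show ?thesis .
qed

lemma mean_log_direction:
  assumes k: "\<kappa> \<in> moment_class p D" and D: "0 < D" and p: "0 < p" and v: "v \<noteq> 0"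
  shows "mean_log \<kappa> v = ln (norm v) + mean_log \<kappa> (v /\<^sub>R norm v)"
  using mean_log_scale[OF k D p, of "v /\<^sub>R norm v" "norm v"] v by simp

section \<open>Laws of products\<close>

lemma measurable_cocycle [measurable]:
  assumes [measurable_cong]: "sets \<nu> = sets borel"
  shows "cocycle n \<in> borel_measurable (iid \<nu>)"
proof (induction n)
  case (Suc n)
  note [measurable] = Suc
  have "(\<lambda>\<omega>. \<omega> n ** cocycle n \<omega>) \<in> borel_measurable (iid \<nu>)" by measurable
  then show ?case by simp
qed simp

lemma cocycle_cong: "(\<And>i. i < n \<Longrightarrow> \<omega> i = \<omega>' i) \<Longrightarrow> cocycle n \<omega> = cocycle n \<omega>'"
  by (induction n) auto

lemma cocycle_add: "cocycle (m + n) \<omega> = cocycle n (\<lambda>i. \<omega> (m + i)) ** cocycle m \<omega>"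
  by (induction n) (simp_all add: matrix_mul_assoc)

lemma cocycle_comb_seq: "cocycle (m + n) (comb_seq m \<omega> \<omega>') = cocycle n \<omega>' ** cocycle m \<omega>"
proof -
  have "cocycle n (\<lambda>i. comb_seq m \<omega> \<omega>' (m + i)) = cocycle n \<omega>'"
    by (rule cocycle_cong) (simp add: comb_seq_def)
  moreover have "cocycle m (comb_seq m \<omega> \<omega>') = cocycle m \<omega>"
    by (rule cocycle_cong) (simp add: comb_seq_def)
  ultimately show ?thesis by (simp add: cocycle_add)
qed

text \<open>
  The distribution of the product of the first \<open>n\<close> factors, the \<open>n\<close>-fold convolution power of \<open>\<nu>\<close>.
\<close>

definition law :: "(real^'m^'m) measure \<Rightarrow> nat \<Rightarrow> (real^'m^'m) measure" where
  "law \<nu> n = distr (iid \<nu>) borel (cocycle n)"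

lemma sets_law [measurable_cong, simp]: "sets (law \<nu> n) = sets borel"
  by (simp add: law_def)

lemma space_law [simp]: "space (law \<nu> n) = UNIV"
  by (simp add: law_def)

lemma sequence_space_prob: "prob_space \<nu> \<Longrightarrow> sequence_space \<nu>"
  unfolding sequence_space_def product_prob_space_def product_prob_space_axioms_def
    product_sigma_finite_def by (simp add: prob_space_imp_sigma_finite)

lemma prob_space_iid: "prob_space \<nu> \<Longrightarrow> prob_space (iid \<nu>)"
  by (rule prob_space_PiM)

lemma prob_space_law:
  assumes "prob_space \<nu>" "sets \<nu> = sets borel"
  shows "prob_space (law \<nu> n)"
  unfolding law_def using assms
  by (intro prob_space.prob_space_distr prob_space_iid measurable_cocycle)

text \<open>
  A sequence is an initial segment followed by an independent copy of the whole sequence.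
\<close>

lemma law_add:
  assumes p: "prob_space \<nu>" and s: "sets \<nu> = sets borel"
  shows "law \<nu> (m + n) = distr (law \<nu> m \<Otimes>\<^sub>M law \<nu> n) borel (\<lambda>(g, h). h ** g)"
proof -
  interpret sequence_space \<nu> by (rule sequence_space_prob[OF p])
  note [measurable] = measurable_cocycle[OF s]
  have ps: "prob_space (law \<nu> n)" by (rule prob_space_law[OF p s])
  have "law \<nu> (m + n) = distr (distr (iid \<nu> \<Otimes>\<^sub>M iid \<nu>) (iid \<nu>) (\<lambda>(\<omega>, \<omega>'). comb_seq m \<omega> \<omega>')) borel (cocycle (m + n))"
    unfolding PiM_comb_seq law_def ..
  also have "\<dots> = distr (iid \<nu> \<Otimes>\<^sub>M iid \<nu>) borel (\<lambda>(\<omega>, \<omega>'). cocycle n \<omega>' ** cocycle m \<omega>)"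
    by (subst distr_distr) (auto simp: comp_def cocycle_comb_seq split_beta' intro!: measurable_comb_seq)
  also have "\<dots> = distr (distr (iid \<nu> \<Otimes>\<^sub>M iid \<nu>) (borel \<Otimes>\<^sub>M borel) (\<lambda>(\<omega>, \<omega>'). (cocycle m \<omega>, cocycle n \<omega>')))
      borel (\<lambda>(g, h). h ** g)"
    by (subst distr_distr) (auto simp: comp_def split_beta')
  also have "distr (iid \<nu> \<Otimes>\<^sub>M iid \<nu>) (borel \<Otimes>\<^sub>M borel) (\<lambda>(\<omega>, \<omega>'). (cocycle m \<omega>, cocycle n \<omega>')) =
      law \<nu> m \<Otimes>\<^sub>M law \<nu> n"
    unfolding law_def
    by (rule pair_measure_distr[symmetric])
      (use ps in \<open>auto simp: law_def[symmetric] prob_space_imp_sigma_finite\<close>)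
  finally show ?thesis .
qed

lemma nn_integral_law_add:
  assumes p: "prob_space \<nu>" and s: "sets \<nu> = sets borel" and [measurable]: "f \<in> borel_measurable borel"
  shows "(\<integral>\<^sup>+ g. f g \<partial>law \<nu> (m + n)) = (\<integral>\<^sup>+ g. \<integral>\<^sup>+ h. f (h ** g) \<partial>law \<nu> n \<partial>law \<nu> m)"
proof -
  interpret N: prob_space "law \<nu> n" by (rule prob_space_law[OF p s])
  have "(\<integral>\<^sup>+ g. f g \<partial>law \<nu> (m + n)) = (\<integral>\<^sup>+ x. f (snd x ** fst x) \<partial>(law \<nu> m \<Otimes>\<^sub>M law \<nu> n))"
    unfolding law_add[OF p s] by (subst nn_integral_distr) (auto simp: split_beta')
  also have "\<dots> = (\<integral>\<^sup>+ g. \<integral>\<^sup>+ h. f (h ** g) \<partial>law \<nu> n \<partial>law \<nu> m)"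
    by (subst N.nn_integral_fst[symmetric]) auto
  finally show ?thesis .
qed

lemma integral_law_add:
  fixes f :: "real^'m^'m \<Rightarrow> real"
  assumes p: "prob_space \<nu>" and s: "sets \<nu> = sets borel" and f: "integrable (law \<nu> (m + n)) f"
  shows "(\<integral>g. f g \<partial>law \<nu> (m + n)) = (\<integral>g. \<integral>h. f (h ** g) \<partial>law \<nu> n \<partial>law \<nu> m)"
    and "integrable (law \<nu> m) (\<lambda>g. \<integral>h. f (h ** g) \<partial>law \<nu> n)"
proof -
  interpret N: prob_space "law \<nu> n" by (rule prob_space_law[OF p s])
  interpret M: prob_space "law \<nu> m" by (rule prob_space_law[OF p s])
  interpret P: pair_sigma_finite "law \<nu> m" "law \<nu> n" ..
  have [measurable]: "f \<in> borel_measurable borel" using borel_measurable_integrable[OF f] by simp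
  have int: "integrable (law \<nu> m \<Otimes>\<^sub>M law \<nu> n) (\<lambda>(g, h). f (h ** g))"
    using f unfolding law_add[OF p s] by (subst (asm) integrable_distr_eq) (auto simp: split_beta')
  have "(\<integral>g. f g \<partial>law \<nu> (m + n)) = (\<integral>x. f (snd x ** fst x) \<partial>(law \<nu> m \<Otimes>\<^sub>M law \<nu> n))"
    unfolding law_add[OF p s] by (subst integral_distr) (auto simp: split_beta')
  also have "\<dots> = (\<integral>g. \<integral>h. f (h ** g) \<partial>law \<nu> n \<partial>law \<nu> m)"
    using P.integral_fst'[OF int] by (simp add: split_beta')
  finally show "(\<integral>g. f g \<partial>law \<nu> (m + n)) = (\<integral>g. \<integral>h. f (h ** g) \<partial>law \<nu> n \<partial>law \<nu> m)" .
  show "integrable (law \<nu> m) (\<lambda>g. \<integral>h. f (h ** g) \<partial>law \<nu> n)"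
    using P.integrable_fst'[OF int] by simp
qed

lemma law_0: "prob_space \<nu> \<Longrightarrow> law \<nu> 0 = return borel (mat 1)" for \<nu> :: "(real^'a^'a) measure"
proof -
  assume "prob_space \<nu>"
  then interpret I: prob_space "iid \<nu>" by (rule prob_space_iid)
  have "cocycle 0 = (\<lambda>\<omega>::nat \<Rightarrow> real^'a^'a. mat 1)" by (rule ext) simp
  then show ?thesis unfolding law_def by (simp add: I.distr_const)
qed

lemma law_1:
  assumes p: "prob_space \<nu>" and s: "sets \<nu> = sets borel"
  shows "law \<nu> 1 = \<nu>"
proof -
  interpret sequence_space \<nu> by (rule sequence_space_prob[OF p])
  have "law \<nu> 1 = distr (iid \<nu>) \<nu> (\<lambda>\<omega>. \<omega> 0)"
    unfolding law_def by (intro distr_cong) (simp_all add: s)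
  also have "\<dots> = \<nu>" by (rule PiM_component) simp
  finally show ?thesis .
qed

text \<open>
  This lets every estimate for a single matrix be applied to a product of \<open>n\<close> matrices.
\<close>

lemma law_moment_class:
  assumes nu: "\<nu> \<in> moment_class p C" and p: "0 < p" and C: "1 \<le> C"
  shows "law \<nu> n \<in> moment_class p (C ^ n)"
proof (induction n)
  case 0
  note P = moment_classD[OF nu]
  have "Theta_lower p (law \<nu> 0) \<le> 1"
    unfolding Theta_lower_def law_0[OF P(1)]
    by (intro SUP_least, subst nn_integral_return) auto
  moreover have "Theta_upper p (law \<nu> 0) \<le> 1"
    unfolding Theta_upper_def law_0[OF P(1)] by (subst nn_integral_return) (auto simp: opnorm_mat_1)
  ultimately show ?case using prob_space_law[OF P(1,2)] by (simp add: moment_class_def)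
next
  case (Suc n)
  note P = moment_classD[OF nu]
  note [measurable_cong] = P(2)
  have l: "law \<nu> (Suc 0) = \<nu>" using law_1[OF P(1,2)] by simp
  have L: "(\<integral>\<^sup>+ g. f g \<partial>law \<nu> (Suc n)) = (\<integral>\<^sup>+ g. \<integral>\<^sup>+ h. f (h ** g) \<partial>\<nu> \<partial>law \<nu> n)"
    if "f \<in> borel_measurable borel" for f
    using nn_integral_law_add[OF P(1,2) that, of n "Suc 0"] by (simp add: l)
  have "Theta_upper p (law \<nu> (Suc n)) = (\<integral>\<^sup>+ g. \<integral>\<^sup>+ h. ennreal (opnorm (h ** g) powr p) \<partial>\<nu> \<partial>law \<nu> n)"
    unfolding Theta_upper_def by (rule L) measurable
  also have "\<dots> \<le> (\<integral>\<^sup>+ g. \<integral>\<^sup>+ h. ennreal (opnorm h powr p) * ennreal (opnorm g powr p) \<partial>\<nu> \<partial>law \<nu> n)"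
  proof (intro nn_integral_mono)
    fix g h :: "real^'a^'a"
    have "opnorm (h ** g) powr p \<le> (opnorm h * opnorm g) powr p"
      using p by (intro powr_mono2 opnorm_mult) (auto simp: opnorm_nonneg)
    then show "ennreal (opnorm (h ** g) powr p) \<le> ennreal (opnorm h powr p) * ennreal (opnorm g powr p)"
      by (simp add: ennreal_mult[symmetric] powr_mult opnorm_nonneg)
  qed
  also have "\<dots> = Theta_upper p \<nu> * Theta_upper p (law \<nu> n)"
    unfolding Theta_upper_def by (simp add: nn_integral_multc nn_integral_cmult)
  also have "\<dots> \<le> ennreal C * ennreal (C ^ n)"
    using nu Suc by (intro mult_mono) (auto simp: moment_class_def)
  finally have up: "Theta_upper p (law \<nu> (Suc n)) \<le> ennreal (C ^ Suc n)"
    using C by (simp add: ennreal_mult)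
  have "(\<integral>\<^sup>+ g. inverse (ennreal (norm (g *v v) powr p)) \<partial>law \<nu> (Suc n)) \<le> ennreal (C ^ Suc n)"
    if v: "norm v = 1" for v
  proof -
    have "(\<integral>\<^sup>+ g. inverse (ennreal (norm (g *v v) powr p)) \<partial>law \<nu> (Suc n)) =
      (\<integral>\<^sup>+ g. \<integral>\<^sup>+ h. inverse (ennreal (norm ((h ** g) *v v) powr p)) \<partial>\<nu> \<partial>law \<nu> n)"
      by (rule L) measurable
    also have "\<dots> \<le> (\<integral>\<^sup>+ g. ennreal C * inverse (ennreal (norm (g *v v) powr p)) \<partial>law \<nu> n)"
      using C by (intro nn_integral_mono)
        (auto simp: matrix_vector_mul_assoc[symmetric] intro!: lower_moment_scaled[OF nu])
    also have "\<dots> = ennreal C * (\<integral>\<^sup>+ g. inverse (ennreal (norm (g *v v) powr p)) \<partial>law \<nu> n)"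
      by (rule nn_integral_cmult) measurable
    also have "\<dots> \<le> ennreal C * (ennreal (C ^ n) * inverse (ennreal (norm v powr p)))"
      using C by (intro mult_left_mono lower_moment_scaled[OF Suc]) auto
    also have "\<dots> = ennreal (C ^ Suc n)" using v C by (simp add: ennreal_mult)
    finally show ?thesis .
  qed
  then have "Theta_lower p (law \<nu> (Suc n)) \<le> ennreal (C ^ Suc n)"
    unfolding Theta_lower_def by (intro SUP_least) auto
  with up show ?case using prob_space_law[OF P(1,2)] by (simp add: moment_class_def)
qed

lemma mean_log_law_add:
  assumes nu: "\<nu> \<in> moment_class p C" and p: "0 < p" and C: "1 \<le> C" and v: "v \<noteq> 0"
  shows "mean_log (law \<nu> (m + n)) v = (\<integral>g. mean_log (law \<nu> n) (g *v v) \<partial>law \<nu> m)"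
    and "integrable (law \<nu> m) (\<lambda>g. mean_log (law \<nu> n) (g *v v))"
proof -
  have C0: "0 < C ^ k" for k using C by simp
  have "integrable (law \<nu> (m + n)) (\<lambda>g. ln (norm (g *v v)))"
    by (rule integrable_ln_norm[OF law_moment_class[OF nu p C] C0 p v])
  note I = integral_law_add[OF moment_classD(1,2)[OF nu] this]
  show "mean_log (law \<nu> (m + n)) v = (\<integral>g. mean_log (law \<nu> n) (g *v v) \<partial>law \<nu> m)"
    using I(1) by (simp add: mean_log_def matrix_vector_mul_assoc)
  show "integrable (law \<nu> m) (\<lambda>g. mean_log (law \<nu> n) (g *v v))"
    using I(2) by (simp add: mean_log_def matrix_vector_mul_assoc)
qed

lemma mean_log_borel:
  "mean_log (law \<nu> n) \<in> borel_measurable borel" if p: "prob_space \<nu>" "sets \<nu> = sets borel"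
proof -
  interpret N: prob_space "law \<nu> n" by (rule prob_space_law[OF that])
  have "(\<lambda>v. \<integral>g. ln (norm (g *v v)) \<partial>law \<nu> n) \<in> borel_measurable borel"
    by (rule N.borel_measurable_lebesgue_integral) measurable
  then show ?thesis by (simp add: mean_log_def[abs_def])
qed

section \<open>Couplings of products\<close>

definition coupling_cost :: "real \<Rightarrow> ((real^'m^'m) \<times> (real^'m^'m)) measure \<Rightarrow> ennreal" where
  "coupling_cost p \<pi> = (\<integral>\<^sup>+ x. ennreal (opnorm (fst x - snd x) powr p) \<partial>\<pi>)"

lemma couplingsD:
  assumes "\<pi> \<in> couplings \<nu> \<mu>"
  shows "prob_space \<pi>" "sets \<pi> = sets (borel \<Otimes>\<^sub>M borel)" "distr \<pi> borel fst = \<nu>" "distr \<pi> borel snd = \<mu>"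
  using assms by (auto simp: couplings_def)

text \<open>
  Multiply independent coupled pairs and use \<open>h g - h' g' = (h - h') g + h' (g - g')\<close>; for \<open>p \<le> 1\<close> the
  \<open>p\<close>-th power is subadditive.
\<close>

lemma coupling_law_Suc:
  fixes \<nu> \<mu> :: "(real^'m^'m) measure"
  assumes nu: "\<nu> \<in> moment_class p C" and mu: "\<mu> \<in> moment_class p C" and p: "0 < p" "p \<le> 1" and C: "1 \<le> C"
    and pi: "\<pi> \<in> couplings \<nu> \<mu>" and rho: "\<rho> \<in> couplings (law \<nu> n) (law \<mu> n)"
  shows "\<exists>\<rho>'\<in>couplings (law \<nu> (Suc n)) (law \<mu> (Suc n)).
    coupling_cost p \<rho>' \<le> ennreal (C ^ n) * coupling_cost p \<pi> + ennreal C * coupling_cost p \<rho>"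
proof
  note P = couplingsD[OF pi] and R = couplingsD[OF rho]
  interpret P: prob_space \<pi> by (rule P)
  interpret R: prob_space \<rho> by (rule R)
  interpret PR: pair_prob_space \<rho> \<pi> ..
  note [measurable_cong] = P(2) R(2)
  define F :: "((real^'m^'m) \<times> (real^'m^'m)) \<times> ((real^'m^'m) \<times> (real^'m^'m)) \<Rightarrow> _"
    where "F = (\<lambda>x. (fst (snd x) ** fst (fst x), snd (snd x) ** snd (fst x)))"
  have F [measurable]: "F \<in> measurable (\<rho> \<Otimes>\<^sub>M \<pi>) (borel \<Otimes>\<^sub>M borel)" unfolding F_def by measurable
  define \<rho>' where "\<rho>' = distr (\<rho> \<Otimes>\<^sub>M \<pi>) (borel \<Otimes>\<^sub>M borel) F"
  have marg: "law \<kappa> (Suc n) = distr (\<rho> \<Otimes>\<^sub>M \<pi>) borel (\<lambda>x. f (snd x) ** f (fst x))"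
    if k: "\<kappa> \<in> moment_class p C" and f: "f = fst \<or> f = snd"
      and d: "distr \<pi> borel f = \<kappa>" "distr \<rho> borel f = law \<kappa> n"
    for \<kappa> f
  proof -
    have [measurable]: "f \<in> measurable \<pi> borel" "f \<in> measurable \<rho> borel" using f by auto
    note K = moment_classD[OF k]
    have "law \<kappa> (Suc n) = distr (law \<kappa> n \<Otimes>\<^sub>M \<kappa>) borel (\<lambda>(g, h). h ** g)"
      using law_add[OF K(1,2), of n 1] law_1[OF K(1,2)] by simp
    also have "law \<kappa> n \<Otimes>\<^sub>M \<kappa> = distr \<rho> borel f \<Otimes>\<^sub>M distr \<pi> borel f" using d by simp
    also have "\<dots> = distr (\<rho> \<Otimes>\<^sub>M \<pi>) (borel \<Otimes>\<^sub>M borel) (\<lambda>(x, y). (f x, f y))"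
      by (rule pair_measure_distr) (use d K(1) in \<open>simp_all add: prob_space_imp_sigma_finite\<close>)
    also have "distr \<dots> borel (\<lambda>(g, h). h ** g) = distr (\<rho> \<Otimes>\<^sub>M \<pi>) borel (\<lambda>x. f (snd x) ** f (fst x))"
      by (subst distr_distr) (auto simp: comp_def case_prod_beta)
    finally show ?thesis .
  qed
  show "\<rho>' \<in> couplings (law \<nu> (Suc n)) (law \<mu> (Suc n))"
    unfolding couplings_def
  proof (intro CollectI conjI)
    show "prob_space \<rho>'" unfolding \<rho>'_def by (rule PR.prob_space_distr) measurable
    show "sets \<rho>' = sets (borel \<Otimes>\<^sub>M borel)" by (simp add: \<rho>'_def)
    show "distr \<rho>' borel fst = law \<nu> (Suc n)"
      unfolding \<rho>'_def using marg[OF nu _ P(3) R(3)]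
      by (subst distr_distr) (auto simp: comp_def F_def)
    show "distr \<rho>' borel snd = law \<mu> (Suc n)"
      unfolding \<rho>'_def using marg[OF mu _ P(4) R(4)]
      by (subst distr_distr) (auto simp: comp_def F_def)
  qed
  let ?D = "\<lambda>x::(real^'m^'m) \<times> (real^'m^'m). ennreal (opnorm (fst x - snd x) powr p)"
  have pt: "?D (F (x, y)) \<le> ?D y * ennreal (opnorm (fst x) powr p) + ennreal (opnorm (snd y) powr p) * ?D x" for x y
  proof -
    let ?a = "opnorm (fst y - snd y) * opnorm (fst x)" and ?b = "opnorm (snd y) * opnorm (fst x - snd x)"
    have e: "fst y ** fst x - snd y ** snd x = (fst y - snd y) ** fst x + snd y ** (fst x - snd x)"
      by (simp add: matrix_eq matrix_vector_mult_diff_rdistrib matrix_vector_mult_add_rdistrib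
         matrix_vector_mul_assoc[symmetric] matrix_vector_mult_diff_distrib)
    have "opnorm (fst y ** fst x - snd y ** snd x) \<le> ?a + ?b"
      unfolding e using opnorm_add opnorm_mult by (meson add_mono order_trans)
    then have "opnorm (fst y ** fst x - snd y ** snd x) powr p \<le> (?a + ?b) powr p"
      using p by (intro powr_mono2) (auto simp: opnorm_nonneg)
    also have "\<dots> \<le> ?a powr p + ?b powr p"
      using p by (intro powr_subadditive) (auto simp: opnorm_nonneg)
    finally show ?thesis
      by (simp add: F_def powr_mult opnorm_nonneg ennreal_mult[symmetric] ennreal_plus[symmetric] del: ennreal_plus)
  qed
  have up: "(\<integral>\<^sup>+ x. ennreal (opnorm (f x) powr p) \<partial>\<rho>'') = Theta_upper p \<kappa>"
    if "distr \<rho>'' borel f = \<kappa>" "f \<in> measurable \<rho>'' borel" for \<rho>'' \<kappa> and f :: "(real^'m^'m) \<times> (real^'m^'m) \<Rightarrow> real^'m^'m"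
    unfolding Theta_upper_def that(1)[symmetric] using that(2) by (subst nn_integral_distr) auto
  have "coupling_cost p \<rho>' = (\<integral>\<^sup>+ x. \<integral>\<^sup>+ y. ?D (F (x, y)) \<partial>\<pi> \<partial>\<rho>)"
    unfolding coupling_cost_def \<rho>'_def
    by (subst nn_integral_distr, measurable) (subst P.nn_integral_fst[symmetric], simp_all)
  also have "\<dots> \<le> (\<integral>\<^sup>+ x. \<integral>\<^sup>+ y. ?D y * ennreal (opnorm (fst x) powr p) + ennreal (opnorm (snd y) powr p) * ?D x \<partial>\<pi> \<partial>\<rho>)"
    by (intro nn_integral_mono pt)
  also have "\<dots> = (\<integral>\<^sup>+ x. coupling_cost p \<pi> * ennreal (opnorm (fst x) powr p) + Theta_upper p \<mu> * ?D x \<partial>\<rho>)"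
  proof (intro nn_integral_cong)
    fix x :: "(real^'m^'m) \<times> (real^'m^'m)"
    have "(\<integral>\<^sup>+ y. ?D y * ennreal (opnorm (fst x) powr p) + ennreal (opnorm (snd y) powr p) * ?D x \<partial>\<pi>) =
      (\<integral>\<^sup>+ y. ?D y \<partial>\<pi>) * ennreal (opnorm (fst x) powr p) + (\<integral>\<^sup>+ y. ennreal (opnorm (snd y) powr p) \<partial>\<pi>) * ?D x"
      by (subst nn_integral_add, measurable) (subst (1 2) nn_integral_multc, measurable)
    also have "(\<integral>\<^sup>+ y. ennreal (opnorm (snd y) powr p) \<partial>\<pi>) = Theta_upper p \<mu>"
      by (rule up[OF P(4)]) measurable
    finally show "(\<integral>\<^sup>+ y. ?D y * ennreal (opnorm (fst x) powr p) + ennreal (opnorm (snd y) powr p) * ?D x \<partial>\<pi>) =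
      coupling_cost p \<pi> * ennreal (opnorm (fst x) powr p) + Theta_upper p \<mu> * ?D x"
      by (simp add: coupling_cost_def)
  qed
  also have "\<dots> = coupling_cost p \<pi> * Theta_upper p (law \<nu> n) + Theta_upper p \<mu> * coupling_cost p \<rho>"
  proof -
    have u: "(\<integral>\<^sup>+ x. ennreal (opnorm (fst x) powr p) \<partial>\<rho>) = Theta_upper p (law \<nu> n)"
      by (rule up[OF R(3)]) measurable
    show ?thesis unfolding u[symmetric] coupling_cost_def[of p \<rho>]
      by (subst nn_integral_add, measurable) (subst (1 2) nn_integral_cmult, measurable)
  qed
  also have "\<dots> \<le> coupling_cost p \<pi> * ennreal (C ^ n) + ennreal C * coupling_cost p \<rho>"
    using mu law_moment_class[OF nu p(1) C, of n]
    by (intro add_mono mult_mono) (auto simp: moment_class_def)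
  finally show "coupling_cost p \<rho>' \<le> ennreal (C ^ n) * coupling_cost p \<pi> + ennreal C * coupling_cost p \<rho>"
    by (simp add: mult.commute)
qed

lemma coupling_law:
  fixes \<nu> \<mu> :: "(real^'m^'m) measure"
  assumes nu: "\<nu> \<in> moment_class p C" and mu: "\<mu> \<in> moment_class p C" and p: "0 < p" "p \<le> 1" and C: "1 \<le> C"
    and pi: "\<pi> \<in> couplings \<nu> \<mu>"
  shows "\<exists>\<rho>\<in>couplings (law \<nu> n) (law \<mu> n). coupling_cost p \<rho> \<le> ennreal (real n * C ^ n) * coupling_cost p \<pi>"
proof (induction n)
  case 0
  have l: "law \<nu> 0 = return borel (mat 1)" "law \<mu> 0 = return borel (mat 1)"
    using law_0 moment_classD nu mu by blast+
  define \<rho> where "\<rho> = return (borel \<Otimes>\<^sub>M borel) (mat 1 :: real^'m^'m, mat 1 :: real^'m^'m)"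
  have "\<rho> \<in> couplings (law \<nu> 0) (law \<mu> 0)"
    unfolding couplings_def l \<rho>_def
    by (auto simp: space_pair_measure distr_return[of _ "borel \<Otimes>\<^sub>M borel"] intro!: prob_space_return)
  moreover have "coupling_cost p \<rho> = 0"
    unfolding coupling_cost_def \<rho>_def
    by (subst nn_integral_return) (auto simp: space_pair_measure opnorm_zero)
  ultimately show ?case by (intro bexI[of _ \<rho>]) auto
next
  case (Suc n)
  then obtain \<rho> where r: "\<rho> \<in> couplings (law \<nu> n) (law \<mu> n)"
    "coupling_cost p \<rho> \<le> ennreal (real n * C ^ n) * coupling_cost p \<pi>" by blast
  obtain \<rho>' where r': "\<rho>'\<in>couplings (law \<nu> (Suc n)) (law \<mu> (Suc n))"
    "coupling_cost p \<rho>' \<le> ennreal (C ^ n) * coupling_cost p \<pi> + ennreal C * coupling_cost p \<rho>"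
    using coupling_law_Suc[OF nu mu p C pi r(1)] by blast
  note r'(2)
  also have "ennreal (C ^ n) * coupling_cost p \<pi> + ennreal C * coupling_cost p \<rho>
      \<le> ennreal (C ^ Suc n) * coupling_cost p \<pi> + ennreal C * (ennreal (real n * C ^ n) * coupling_cost p \<pi>)"
    using C by (intro add_mono mult_right_mono mult_left_mono r(2)) (auto intro!: ennreal_leI simp: mult_le_cancel_right1)
  also have "\<dots> = ennreal (real (Suc n) * C ^ Suc n) * coupling_cost p \<pi>"
  proof -
    have "ennreal C * (ennreal (real n * C ^ n) * coupling_cost p \<pi>) = ennreal (C * (real n * C ^ n)) * coupling_cost p \<pi>"
      using C by (subst ennreal_mult) (auto simp: mult.assoc)
    moreover have "ennreal (C ^ Suc n) + ennreal (C * (real n * C ^ n)) = ennreal (real (Suc n) * C ^ Suc n)"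
      using C by (subst ennreal_plus[symmetric]) (auto simp: algebra_simps)
    ultimately show ?thesis by (simp only: distrib_right[symmetric])
  qed
  finally show ?case using r'(1) by blast
qed

section \<open>The subadditive ergodic theorem\<close>

text \<open>
  Ergodicity enters through its one-sided form: an event containing its own preimage under \<open>T\<close> is
  trivial. The events to which it is applied are of this kind, and it spares the passage to exactly
  invariant events.
\<close>

locale ergodic_map = prob_space M for M :: "'a measure" +
  fixes T :: "'a \<Rightarrow> 'a"
  assumes measurable_T [measurable]: "T \<in> measurable M M"
    and distr_T: "distr M M T = M"
    and zero_one: "\<And>B. B \<in> sets M \<Longrightarrow> (\<And>\<omega>. \<omega> \<in> space M \<Longrightarrow> T \<omega> \<in> B \<Longrightarrow> \<omega> \<in> B) \<Longrightarrow> prob B = 0 \<or> prob B = 1"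
begin

lemma measurable_iterate [measurable]: "(T ^^ n) \<in> measurable M M"
  by (induction n) auto

lemma iterate_space: "\<omega> \<in> space M \<Longrightarrow> (T ^^ n) \<omega> \<in> space M"
  using measurable_space[OF measurable_iterate] .

lemma distr_iterate: "distr M M (T ^^ n) = M"
proof (induction n)
  case 0
  show ?case by (simp add: distr_id2)
next
  case (Suc n)
  have "distr M M (T ^^ Suc n) = distr (distr M M (T ^^ n)) M T"
    by (subst distr_distr) auto
  then show ?case by (simp only: Suc distr_T)
qed

lemma integrable_iterate:
  fixes f :: "'a \<Rightarrow> real"
  assumes "integrable M f"
  shows "integrable M (\<lambda>\<omega>. f ((T ^^ n) \<omega>))" "(\<integral>\<omega>. f ((T ^^ n) \<omega>) \<partial>M) = (\<integral>\<omega>. f \<omega> \<partial>M)"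
proof -
  have [measurable]: "f \<in> borel_measurable M" using assms by simp
  show "integrable M (\<lambda>\<omega>. f ((T ^^ n) \<omega>))"
    using integrable_distr_eq[of "T ^^ n" M M f] assms distr_iterate[of n] by simp
  show "(\<integral>\<omega>. f ((T ^^ n) \<omega>) \<partial>M) = (\<integral>\<omega>. f \<omega> \<partial>M)"
    using integral_distr[of "T ^^ n" M M f] distr_iterate[of n] by simp
qed

text \<open>
  Cut \<open>[0, n)\<close> into blocks from the left. If some block of length \<open>k \<le> K\<close> starting at the current point
  has \<open>X k < c k\<close>, use it; otherwise advance by one step and pay \<open>h\<close>. A good block that does not fit into the
  remaining stretch only occurs among the last \<open>K\<close> points, where \<open>h\<close> is paid as well.
\<close>

lemma subadditive_le_greedy_sum:
  fixes X :: "nat \<Rightarrow> 'a \<Rightarrow> real" and c :: real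
  assumes sub: "\<And>m n \<omega>. \<omega> \<in> space M \<Longrightarrow> X (m + n) \<omega> \<le> X m \<omega> + X n ((T ^^ m) \<omega>)"
    and X0: "\<And>\<omega>. X 0 \<omega> \<le> 0"
    and F: "\<And>\<omega>. F \<omega> = c + (if \<exists>k\<in>{1..K}. X k \<omega> < c * real k then 0 else h \<omega>)"
    and h: "\<And>\<omega>. h \<omega> = \<bar>X 1 \<omega>\<bar> + \<bar>c\<bar>"
    and w: "\<omega> \<in> space M"
  shows "X n \<omega> \<le> (\<Sum>i<n. F ((T ^^ i) \<omega>)) + (\<Sum>i\<in>{n-K..<n}. h ((T ^^ i) \<omega>))"
  using w
proof (induction n arbitrary: \<omega> rule: less_induct)
  case (less n)
  have hpos: "0 \<le> h \<omega>" for \<omega> by (simp add: h)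
  have Fc: "c \<le> F \<omega>" for \<omega> using hpos by (simp add: F)
  have step: "X n \<omega> \<le> (\<Sum>i<n. F ((T ^^ i) \<omega>)) + (\<Sum>i\<in>{n-K..<n}. h ((T ^^ i) \<omega>))"
    if k: "1 \<le> k" "k \<le> n" and Xk: "X k \<omega> \<le> (\<Sum>i<k. F ((T ^^ i) \<omega>))" for k
  proof -
    let ?w = "(T ^^ k) \<omega>"
    have it: "(T ^^ i) ?w = (T ^^ (i + k)) \<omega>" for i by (simp add: funpow_add)
    have "X (k + (n - k)) \<omega> \<le> X k \<omega> + X (n - k) ?w" by (rule sub[OF less.prems])
    then have "X n \<omega> \<le> X k \<omega> + X (n - k) ?w" using k by simp
    also have "X (n - k) ?w \<le> (\<Sum>i<n-k. F ((T ^^ i) ?w)) + (\<Sum>i\<in>{n-k-K..<n-k}. h ((T ^^ i) ?w))"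
      using k less.prems by (intro less.IH iterate_space) auto
    also have "(\<Sum>i<n-k. F ((T ^^ i) ?w)) = (\<Sum>i\<in>{k..<n}. F ((T ^^ i) \<omega>))"
      unfolding it by (rule sum.reindex_bij_witness[of _ "\<lambda>i. i - k" "\<lambda>i. i + k"]) (use k in auto)
    also have "(\<Sum>i\<in>{n-k-K..<n-k}. h ((T ^^ i) ?w)) = (\<Sum>i\<in>{n-k-K+k..<n}. h ((T ^^ i) \<omega>))"
      unfolding it by (rule sum.reindex_bij_witness[of _ "\<lambda>i. i - k" "\<lambda>i. i + k"]) (use k in auto)
    also have "\<dots> \<le> (\<Sum>i\<in>{n-K..<n}. h ((T ^^ i) \<omega>))"
      by (rule sum_mono2) (auto simp: hpos)
    finally have "X n \<omega> \<le> (\<Sum>i<k. F ((T ^^ i) \<omega>)) + (\<Sum>i\<in>{k..<n}. F ((T ^^ i) \<omega>)) + (\<Sum>i\<in>{n-K..<n}. h ((T ^^ i) \<omega>))"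
      using Xk by linarith
    also have "(\<Sum>i<k. F ((T ^^ i) \<omega>)) + (\<Sum>i\<in>{k..<n}. F ((T ^^ i) \<omega>)) = (\<Sum>i<n. F ((T ^^ i) \<omega>))"
      using sum.atLeastLessThan_concat[of 0 k n "\<lambda>i. F ((T ^^ i) \<omega>)"] k by (simp add: atLeast0LessThan)
    finally show ?thesis .
  qed
  show ?case
  proof (cases "n = 0")
    case True
    then show ?thesis using X0[of \<omega>] by simp
  next
    case n: False
    show ?thesis
    proof (cases "\<exists>k\<in>{1..K}. X k \<omega> < c * real k")
      case True
      then obtain k where k: "1 \<le> k" "k \<le> K" "X k \<omega> < c * real k" by auto
      show ?thesis
      proof (cases "k \<le> n")
        case True
        have "c * real k \<le> (\<Sum>i<k. F ((T ^^ i) \<omega>))"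
          using sum_mono[of "{..<k}" "\<lambda>_. c" "\<lambda>i. F ((T ^^ i) \<omega>)"] Fc by (simp add: mult.commute)
        then show ?thesis using k True by (intro step[of k]) auto
      next
        case False
        have X1: "X j \<omega> \<le> (\<Sum>i<j. \<bar>X 1 ((T ^^ i) \<omega>)\<bar>)" for j
        proof (induction j)
          case (Suc j)
          then show ?case using sub[OF less.prems, of j 1] abs_ge_self[of "X 1 ((T ^^ j) \<omega>)"] by simp
        qed (use X0 in simp)
        have "\<bar>X 1 z\<bar> \<le> F z + h z" for z using Fc[of z] h[of z] abs_ge_minus_self[of c] by linarith
        then have "(\<Sum>i<n. \<bar>X 1 ((T ^^ i) \<omega>)\<bar>) \<le> (\<Sum>i<n. F ((T ^^ i) \<omega>) + h ((T ^^ i) \<omega>))"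
          by (intro sum_mono) simp
        moreover have "{n-K..<n} = {..<n}" using False k by auto
        ultimately show ?thesis using X1[of n] by (simp add: sum.distrib)
      qed
    next
      case False
      then have "F \<omega> = c + h \<omega>" unfolding F by (simp only: if_False)
      then have "X 1 \<omega> \<le> F \<omega>" using h[of \<omega>] abs_ge_minus_self[of c] abs_ge_self[of "X 1 \<omega>"] by linarith
      then show ?thesis using n by (intro step[of 1]) auto
    qed
  qed
qed

text \<open>
  Otherwise, by ergodicity, almost every orbit has infinitely many \<open>n\<close> with \<open>X n < c1 n\<close> for some \<open>c1 < L\<close>.
  The greedy decomposition then bounds the mean of \<open>X n\<close> by \<open>n\<close> times a number close to \<open>c1\<close>, which
  contradicts \<open>n L \<le> E (X n)\<close>.
\<close>

lemma subadditive_liminf: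
  fixes X :: "nat \<Rightarrow> 'a \<Rightarrow> real"
  assumes sub: "\<And>m n \<omega>. \<omega> \<in> space M \<Longrightarrow> X (m + n) \<omega> \<le> X m \<omega> + X n ((T ^^ m) \<omega>)"
    and X0: "\<And>\<omega>. X 0 \<omega> \<le> 0"
    and int: "\<And>n. integrable M (X n)"
    and L: "\<And>n. real n * L \<le> (\<integral>\<omega>. X n \<omega> \<partial>M)"
    and c: "c < L"
  shows "AE \<omega> in M. eventually (\<lambda>n. c * real n \<le> X n \<omega>) sequentially"
proof -
  have [measurable]: "X n \<in> borel_measurable M" for n using int by (rule borel_measurable_integrable)
  obtain c1 where c1: "c < c1" "c1 < L" using c dense by blast
  \<comment> \<open>Levels increasing from \<open>c\<close> to \<open>c1\<close>: the slack between them absorbs \<open>X 1\<close> when passing from \<open>T \<omega>\<close> to \<open>\<omega>\<close>.\<close>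
  define a where "a k = c1 - (c1 - c) / real (Suc k)" for k
  have a_mono: "a k < a (Suc k)" for k
    unfolding a_def using c1 by (simp add: frac_less2)
  have a_less: "a k < c1" for k unfolding a_def using c1 by simp
  define B where "B = {\<omega>\<in>space M. \<exists>k. \<forall>N. \<exists>n\<ge>N. X n \<omega> < a k * real n}"
  have [measurable]: "B \<in> sets M" unfolding B_def by measurable
  have pulls_back: "\<omega> \<in> B" if w: "\<omega> \<in> space M" and TB: "T \<omega> \<in> B" for \<omega>
  proof -
    from TB obtain k where k: "\<forall>N. \<exists>n\<ge>N. X n (T \<omega>) < a k * real n" by (auto simp: B_def)
    have "\<exists>n\<ge>N. X n \<omega> < a (Suc k) * real n" for N
    proof -
      define d where "d = a (Suc k) - a k"
      have d: "d > 0" using a_mono by (simp add: d_def)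
      obtain n0 :: nat where n0: "(\<bar>X 1 \<omega>\<bar> + \<bar>a (Suc k)\<bar>) / d < real n0" using reals_Archimedean2 by blast
      obtain n where n: "n \<ge> max N n0" "X n (T \<omega>) < a k * real n" using k by blast
      have "real n0 * d \<le> real n * d" using n d by (intro mult_right_mono) auto
      moreover have "\<bar>X 1 \<omega>\<bar> + \<bar>a (Suc k)\<bar> < real n0 * d"
        using n0 d by (simp only: pos_divide_less_eq)
      ultimately have big: "\<bar>X 1 \<omega>\<bar> + \<bar>a (Suc k)\<bar> < real n * d" by linarith
      have "X (1 + n) \<omega> \<le> X 1 \<omega> + X n (T \<omega>)" using sub[OF w, of 1 n] by simp
      also have "\<dots> < a (Suc k) * real (1 + n)"
        using n(2) big unfolding d_def by (simp add: algebra_simps)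
      finally show ?thesis using n(1) by (intro exI[of _ "1 + n"]) auto
    qed
    then show ?thesis using w by (auto simp: B_def)
  qed
  have "prob B = 0 \<or> prob B = 1" by (rule zero_one) (auto intro: pulls_back)
  moreover have "prob B \<noteq> 1"
  proof
    assume "prob B = 1"
    then have AEB: "AE \<omega> in M. \<omega> \<in> B" by (simp add: prob_eq_1)
    define h where "h \<omega> = \<bar>X 1 \<omega>\<bar> + \<bar>c1\<bar>" for \<omega>
    define F where "F K \<omega> = c1 + (if \<exists>k\<in>{1..K}. X k \<omega> < c1 * real k then 0 else h \<omega>)" for K \<omega>
    have inth: "integrable M h" unfolding h_def using int by auto
    have [measurable]: "h \<in> borel_measurable M" "F K \<in> borel_measurable M" for K
      unfolding h_def F_def by measurable
    have h0: "0 \<le> h \<omega>" for \<omega> by (simp add: h_def)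
    have intF: "integrable M (F K)" for K
    proof (rule Bochner_Integration.integrable_bound[of M "\<lambda>\<omega>. \<bar>c1\<bar> + h \<omega>"])
      show "AE \<omega> in M. norm (F K \<omega>) \<le> norm (\<bar>c1\<bar> + h \<omega>)"
        using h0 by (intro AE_I2) (auto simp: F_def intro: order_trans[OF abs_triangle_ineq])
    qed (use inth in auto)
    have "(\<lambda>K. \<integral>\<omega>. F K \<omega> \<partial>M) \<longlonglongrightarrow> (\<integral>\<omega>. c1 \<partial>M)"
    proof (rule integral_dominated_convergence[of _ M _ "\<lambda>\<omega>. \<bar>c1\<bar> + h \<omega>"])
      show "AE \<omega> in M. (\<lambda>K. F K \<omega>) \<longlonglongrightarrow> c1"
        using AEB
      proof eventually_elim
        case (elim \<omega>)
        then obtain k where "\<forall>N. \<exists>n\<ge>N. X n \<omega> < a k * real n" by (auto simp: B_def)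
        then obtain n where n: "n \<ge> (1::nat)" "X n \<omega> < a k * real n" by blast
        have "a k * real n < c1 * real n" using n(1) a_less by simp
        then have n': "X n \<omega> < c1 * real n" using n by linarith
        have "F K \<omega> = c1" if "n \<le> K" for K
        proof -
          have "\<exists>k\<in>{1..K}. X k \<omega> < c1 * real k" using n(1) n' that by (intro bexI[of _ n]) auto
          then show ?thesis by (simp only: F_def if_True)
        qed
        then show ?case
          by (intro tendsto_eventually eventually_sequentiallyI[of n]) auto
      qed
      show "AE \<omega> in M. norm (F K \<omega>) \<le> \<bar>c1\<bar> + h \<omega>" for K
        using h0 by (intro AE_I2) (auto simp: F_def intro: order_trans[OF abs_triangle_ineq])
    qed (use inth in auto)
    then have "(\<lambda>K. \<integral>\<omega>. F K \<omega> \<partial>M) \<longlonglongrightarrow> c1" by (simp add: prob_space)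
    from order_tendstoD(2)[OF this c1(2)] obtain K where K: "(\<integral>\<omega>. F K \<omega> \<partial>M) < L"
      by (meson eventually_sequentially order_refl)
    have bound: "real n * L \<le> real n * (\<integral>\<omega>. F K \<omega> \<partial>M) + real K * (\<integral>\<omega>. h \<omega> \<partial>M)" for n
    proof -
      have "real n * L \<le> (\<integral>\<omega>. X n \<omega> \<partial>M)" by (rule L)
      also have "\<dots> \<le> (\<integral>\<omega>. (\<Sum>i<n. F K ((T ^^ i) \<omega>)) + (\<Sum>i\<in>{n-K..<n}. h ((T ^^ i) \<omega>)) \<partial>M)"
        by (intro integral_mono int Bochner_Integration.integrable_add Bochner_Integration.integrable_sum
            integrable_iterate intF inth subadditive_le_greedy_sum[OF sub X0, where c = c1 and K = K])
          (simp_all add: F_def h_def)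
      also have "\<dots> = (\<Sum>i<n. \<integral>\<omega>. F K ((T ^^ i) \<omega>) \<partial>M) + (\<Sum>i\<in>{n-K..<n}. \<integral>\<omega>. h ((T ^^ i) \<omega>) \<partial>M)"
        by (subst Bochner_Integration.integral_add)
          (auto intro!: Bochner_Integration.integrable_sum integrable_iterate intF inth
            simp: Bochner_Integration.integral_sum integrable_iterate intF inth)
      also have "\<dots> = real n * (\<integral>\<omega>. F K \<omega> \<partial>M) + real (n - (n - K)) * (\<integral>\<omega>. h \<omega> \<partial>M)"
        by (simp add: integrable_iterate(2) intF inth)
      also have "\<dots> \<le> real n * (\<integral>\<omega>. F K \<omega> \<partial>M) + real K * (\<integral>\<omega>. h \<omega> \<partial>M)"
        by (intro add_left_mono mult_right_mono) (auto intro: integral_nonneg_AE simp: h0)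
      finally show ?thesis .
    qed
    obtain n :: nat where "real K * (\<integral>\<omega>. h \<omega> \<partial>M) / (L - (\<integral>\<omega>. F K \<omega> \<partial>M)) < real n"
      using reals_Archimedean2 by blast
    then have "real K * (\<integral>\<omega>. h \<omega> \<partial>M) < real n * (L - (\<integral>\<omega>. F K \<omega> \<partial>M))"
      using K by (simp add: pos_divide_less_eq)
    then show False using bound[of n] by (simp add: algebra_simps)
  qed
  ultimately have "prob B = 0" by blast
  then have "AE \<omega> in M. \<omega> \<notin> B" by (simp add: prob_eq_0)
  with AE_space show ?thesis
  proof eventually_elim
    case (elim \<omega>)
    have "a 0 = c" by (simp add: a_def)
    then have "\<not> (\<forall>N. \<exists>n\<ge>N. X n \<omega> < c * real n)" using elim by (auto simp: B_def)
    then show ?case by (auto simp: eventually_sequentially not_less)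
  qed
qed

text \<open>
  Birkhoff sums are additive, so the lower bound applies to \<open>f\<close> and to \<open>- f\<close>.
\<close>

lemma birkhoff:
  fixes f :: "'a \<Rightarrow> real"
  assumes f: "integrable M f"
  shows "AE \<omega> in M. (\<lambda>n. (\<Sum>i<n. f ((T ^^ i) \<omega>)) / real n) \<longlonglongrightarrow> (\<integral>\<omega>. f \<omega> \<partial>M)"
proof -
  define L where "L = (\<integral>\<omega>. f \<omega> \<partial>M)"
  have low: "AE \<omega> in M. eventually (\<lambda>n. c * real n \<le> (\<Sum>i<n. g ((T ^^ i) \<omega>))) sequentially"
    if g: "integrable M g" and c: "c < (\<integral>\<omega>. g \<omega> \<partial>M)" for g c
  proof (rule subadditive_liminf[where X = "\<lambda>n \<omega>. \<Sum>i<n. g ((T ^^ i) \<omega>)", OF _ _ _ _ c])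
    fix m n \<omega>
    have "(\<Sum>i<m + n. g ((T ^^ i) \<omega>)) = (\<Sum>i<m. g ((T ^^ i) \<omega>)) + (\<Sum>i<n. g ((T ^^ i) ((T ^^ m) \<omega>)))"
    proof (induction n)
      case (Suc n)
      have "(T ^^ (m + n)) \<omega> = (T ^^ n) ((T ^^ m) \<omega>)"
        by (subst add.commute) (simp add: funpow_add)
      then show ?case using Suc by simp
    qed simp
    then show "(\<Sum>i<m + n. g ((T ^^ i) \<omega>)) \<le> (\<Sum>i<m. g ((T ^^ i) \<omega>)) + (\<Sum>i<n. g ((T ^^ i) ((T ^^ m) \<omega>)))"
      by simp
    show "integrable M (\<lambda>\<omega>. \<Sum>i<n. g ((T ^^ i) \<omega>))"
      by (intro Bochner_Integration.integrable_sum integrable_iterate g)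
    show "real n * (\<integral>\<omega>. g \<omega> \<partial>M) \<le> (\<integral>\<omega>. (\<Sum>i<n. g ((T ^^ i) \<omega>)) \<partial>M)"
      by (subst Bochner_Integration.integral_sum) (auto simp: integrable_iterate g)
  qed simp
  have "AE \<omega> in M. \<forall>k::nat. eventually (\<lambda>n. (L - 1 / Suc k) * real n \<le> (\<Sum>i<n. f ((T ^^ i) \<omega>))) sequentially"
    unfolding AE_all_countable by (intro allI low f) (simp add: L_def)
  moreover have "AE \<omega> in M. \<forall>k::nat. eventually (\<lambda>n. (- L - 1 / Suc k) * real n \<le> (\<Sum>i<n. - f ((T ^^ i) \<omega>))) sequentially"
    unfolding AE_all_countable by (intro allI low) (use f in \<open>simp_all add: L_def\<close>)
  ultimately show ?thesis unfolding L_def[symmetric]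
  proof eventually_elim
    case (elim \<omega>)
    show ?case
    proof (rule LIMSEQ_I)
      fix r :: real assume "0 < r"
      then obtain k where k: "1 / real (Suc k) < r" using nat_approx_posE by blast
      from elim(1)[rule_format, of k] elim(2)[rule_format, of k] eventually_gt_at_top[of 0]
      have "eventually (\<lambda>n. norm ((\<Sum>i<n. f ((T ^^ i) \<omega>)) / real n - L) < r) sequentially"
      proof eventually_elim
        case (elim n)
        define S where "S = (\<Sum>i<n. f ((T ^^ i) \<omega>))"
        have "(L - 1 / Suc k) * real n \<le> S" and up: "(- L - 1 / Suc k) * real n \<le> - S"
          using elim by (simp_all add: S_def sum_negf)
        then have "L - 1 / Suc k \<le> S / real n"
          using elim(3) by (simp only: pos_le_divide_eq of_nat_0_less_iff)
        moreover have "(- L - 1 / Suc k) * real n = - ((L + 1 / Suc k) * real n)" by (simp add: algebra_simps)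
        then have "S / real n \<le> L + 1 / Suc k"
          using up elim(3) by (simp only: pos_divide_le_eq of_nat_0_less_iff neg_le_iff_le)
        ultimately have "L - 1 / Suc k \<le> S / real n" "S / real n \<le> L + 1 / Suc k" by simp_all
        then show ?case using k by (simp add: S_def[symmetric] abs_less_iff)
      qed
      then show "\<exists>no. \<forall>n\<ge>no. norm ((\<Sum>i<n. f ((T ^^ i) \<omega>)) / real n - L) < r"
        by (simp add: eventually_sequentially)
    qed
  qed
qed

text \<open>
  The value is the difference of two consecutive Birkhoff sums.
\<close>

lemma orbit_value_sublinear:
  fixes f :: "'a \<Rightarrow> real"
  assumes f: "integrable M f"
  shows "AE \<omega> in M. (\<lambda>n. f ((T ^^ n) \<omega>) / real n) \<longlonglongrightarrow> 0"
  using birkhoff[OF f]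
proof eventually_elim
  case (elim \<omega>)
  define S where "S n = (\<Sum>i<n. f ((T ^^ i) \<omega>))" for n
  define L where "L = (\<integral>\<omega>. f \<omega> \<partial>M)"
  have S: "(\<lambda>n. S n / real n) \<longlonglongrightarrow> L" using elim by (simp add: S_def L_def)
  have "(\<lambda>n. S (Suc n) / real (Suc n)) \<longlonglongrightarrow> L" using S by (rule LIMSEQ_Suc)
  moreover have "(\<lambda>n. 1 + 1 / real n) \<longlonglongrightarrow> 1 + 0" by (intro tendsto_intros lim_1_over_n)
  ultimately have "(\<lambda>n. S (Suc n) / real (Suc n) * (1 + 1 / real n) - S n / real n) \<longlonglongrightarrow> L * (1 + 0) - L"
    using S by (intro tendsto_intros)
  then have "(\<lambda>n. S (Suc n) / real (Suc n) * (1 + 1 / real n) - S n / real n) \<longlonglongrightarrow> 0" by simp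
  then show ?case
  proof (rule Lim_transform_eventually)
    show "eventually (\<lambda>n. S (Suc n) / real (Suc n) * (1 + 1 / real n) - S n / real n = f ((T ^^ n) \<omega>) / real n) sequentially"
      using eventually_gt_at_top[of 0]
    proof eventually_elim
      case (elim n)
      then have "1 + 1 / real n = real (Suc n) / real n" by (simp add: field_simps)
      then have "S (Suc n) / real (Suc n) * (1 + 1 / real n) = S (Suc n) / real n" by simp
      then show ?case by (simp add: S_def diff_divide_distrib[symmetric])
    qed
  qed
qed

end

section \<open>The shift on independent sequences\<close>

definition seq_shift :: "nat \<Rightarrow> (nat \<Rightarrow> 'a) \<Rightarrow> nat \<Rightarrow> 'a" where
  "seq_shift n \<omega> = (\<lambda>i. \<omega> (n + i))"

lemma shift_shift: "seq_shift m (seq_shift n \<omega>) = seq_shift (n + m) \<omega>"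
  by (simp add: seq_shift_def add.assoc)

lemma shift_funpow: "(seq_shift k ^^ n) \<omega> = seq_shift (n * k) \<omega>"
proof (induction n)
  case (Suc n)
  then show ?case by (simp add: shift_shift add.commute)
qed (simp add: seq_shift_def)

lemma shift_comb_seq: "seq_shift n (comb_seq n \<omega> \<omega>') = \<omega>'"
  by (simp add: seq_shift_def comb_seq_def)

context sequence_space
begin

lemma measurable_shift [measurable]: "seq_shift n \<in> measurable S S"
  unfolding seq_shift_def by (rule measurable_PiM_single') (auto simp: space_PiM)

text \<open>
  Independence of the past and the future: an event involving the first \<open>n\<close> coordinates and the shifted
  sequence has the probability it would have if the shifted sequence were replaced by an independent
  copy.
\<close>

lemma prob_shift_split:
  assumes Q: "{x \<in> space (S \<Otimes>\<^sub>M S). Q (fst x) (snd x)} \<in> sets (S \<Otimes>\<^sub>M S)"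
    and dep: "\<And>\<omega> \<omega>' \<eta>. Q (comb_seq n \<omega> \<omega>') \<eta> \<longleftrightarrow> Q \<omega> \<eta>"
  shows "emeasure S {\<omega> \<in> space S. Q \<omega> (seq_shift n \<omega>)} = (\<integral>\<^sup>+ \<omega>. emeasure S {\<eta> \<in> space S. Q \<omega> \<eta>} \<partial>S)"
proof -
  have meas: "{\<omega> \<in> space S. Q \<omega> (seq_shift n \<omega>)} \<in> sets S"
  proof -
    have "(\<lambda>\<omega>. (\<omega>, seq_shift n \<omega>)) \<in> measurable S (S \<Otimes>\<^sub>M S)" by measurable
    from measurable_sets[OF this Q] show ?thesis
      by (rule back_subst[of "\<lambda>A. A \<in> sets S"])
        (auto simp: space_pair_measure measurable_space[OF measurable_shift])
  qed
  have "emeasure S {\<omega> \<in> space S. Q \<omega> (seq_shift n \<omega>)} =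
      emeasure (distr (S \<Otimes>\<^sub>M S) S (\<lambda>(\<omega>, \<omega>'). comb_seq n \<omega> \<omega>')) {\<omega> \<in> space S. Q \<omega> (seq_shift n \<omega>)}"
    unfolding PiM_comb_seq ..
  also have "\<dots> = emeasure (S \<Otimes>\<^sub>M S) ((\<lambda>(\<omega>, \<omega>'). comb_seq n \<omega> \<omega>') -` {\<omega> \<in> space S. Q \<omega> (seq_shift n \<omega>)} \<inter> space (S \<Otimes>\<^sub>M S))"
    by (rule emeasure_distr[OF measurable_comb_seq meas])
  also have "(\<lambda>(\<omega>, \<omega>'). comb_seq n \<omega> \<omega>') -` {\<omega> \<in> space S. Q \<omega> (seq_shift n \<omega>)} \<inter> space (S \<Otimes>\<^sub>M S)
      = {x \<in> space (S \<Otimes>\<^sub>M S). Q (fst x) (snd x)}"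
    using measurable_space[OF measurable_comb_seq[of n M]]
    by (auto simp: dep shift_comb_seq space_pair_measure)
  also have "emeasure (S \<Otimes>\<^sub>M S) \<dots> = (\<integral>\<^sup>+ \<omega>. emeasure S (Pair \<omega> -` {x \<in> space (S \<Otimes>\<^sub>M S). Q (fst x) (snd x)}) \<partial>S)"
    by (rule P.emeasure_pair_measure_alt[OF Q])
  also have "\<dots> = (\<integral>\<^sup>+ \<omega>. emeasure S {\<eta> \<in> space S. Q \<omega> \<eta>} \<partial>S)"
    by (intro nn_integral_cong arg_cong[where f = "emeasure S"]) (auto simp: space_pair_measure)
  finally show ?thesis .
qed

lemma distr_shift: "distr S S (seq_shift n) = S"
proof (rule measure_eqI)
  fix A assume A: "A \<in> sets (distr S S (seq_shift n))"
  then have [measurable]: "A \<in> sets S" by simp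
  have "emeasure (distr S S (seq_shift n)) A = emeasure S {\<omega> \<in> space S. seq_shift n \<omega> \<in> A}"
    by (subst emeasure_distr) (auto intro!: arg_cong[where f = "emeasure S"])
  also have "\<dots> = (\<integral>\<^sup>+ \<omega>. emeasure S {\<eta> \<in> space S. \<eta> \<in> A} \<partial>S)"
    by (rule prob_shift_split[where Q = "\<lambda>_ \<eta>. \<eta> \<in> A"]) auto
  also have "\<dots> = emeasure S A"
  proof -
    have "{\<eta> \<in> space S. \<eta> \<in> A} = A" using sets.sets_into_space[OF \<open>A \<in> sets S\<close>] by auto
    then show ?thesis by (simp add: P.emeasure_space_1)
  qed
  finally show "emeasure (distr S S (seq_shift n)) A = emeasure S A" .
qed simp

text \<open>
  Such an event is independent of itself, because cylinders generate the product \<open>\<sigma>\<close>-algebra.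
\<close>

lemma independent_of_cylinders_zero_one:
  assumes B [measurable]: "B \<in> sets S"
    and ind: "\<And>n A. (\<And>i. A i \<in> sets M) \<Longrightarrow>
      emeasure S (B \<inter> {\<omega> \<in> space S. \<forall>i<n. \<omega> i \<in> A i}) = emeasure S B * emeasure S {\<omega> \<in> space S. \<forall>i<n. \<omega> i \<in> A i}"
  shows "emeasure S B = 0 \<or> emeasure S B = 1"
proof -
  have "density S (indicator B) = scale_measure (emeasure S B) S"
  proof (rule measure_eqI_PiM_infinite[where I = UNIV and M = "\<lambda>_. M"])
    show "finite_measure (density S (indicator B))"
      by (rule finite_measureI) (simp add: emeasure_restricted[OF B sets.top] P.emeasure_finite)
    fix A :: "nat \<Rightarrow> 'a set" and J :: "nat set"
    assume J: "finite J" and A: "\<And>i. i \<in> J \<Longrightarrow> A i \<in> sets M"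
    define A' where "A' i = (if i \<in> J then A i else space M)" for i
    obtain n where n: "\<forall>i\<in>J. i < n" using J finite_nat_bounded[of J] by auto
    have A': "A' i \<in> sets M" for i using A by (simp add: A'_def)
    have "prod_emb UNIV (\<lambda>_. M) J (Pi\<^sub>E J A) = {\<omega> \<in> space S. \<forall>i<n. \<omega> i \<in> A' i}"
      unfolding prod_emb_def A'_def using n by (auto simp: space_PiM PiE_iff Pi_iff split: if_splits)
    then have P: "prod_emb UNIV (\<lambda>_. M) J (Pi\<^sub>E J A) = {\<omega> \<in> space S. \<forall>i<n. \<omega> i \<in> A' i}" .
    have "prod_emb UNIV (\<lambda>_. M) J (Pi\<^sub>E J A) \<in> sets S"
      by (rule sets_PiM_I) (use J A in auto)
    then have "{\<omega> \<in> space S. \<forall>i<n. \<omega> i \<in> A' i} \<in> sets S" unfolding P .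
    from emeasure_restricted[OF B this] ind[OF A', of n]
    show "emeasure (density S (indicator B)) (prod_emb UNIV (\<lambda>_. M) J (Pi\<^sub>E J A)) =
        emeasure (scale_measure (emeasure S B) S) (prod_emb UNIV (\<lambda>_. M) J (Pi\<^sub>E J A))"
      unfolding P emeasure_scale_measure by (rule trans)
  qed simp_all
  then have "emeasure (density S (indicator B)) B = emeasure (scale_measure (emeasure S B) S) B" by simp
  then have "emeasure S B = emeasure S B * emeasure S B"
    by (simp add: emeasure_restricted[OF B])
  then have "prob B = prob B * prob B"
    unfolding P.emeasure_eq_measure by (simp flip: ennreal_mult)
  then have "prob B = 0 \<or> prob B = 1" by auto
  then show ?thesis by (auto simp: P.emeasure_eq_measure)
qed

text \<open>
  If \<open>B\<close> contains its preimage, then it coincides up to null sets with all its iterated preimages, and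
  these are independent of any given cylinder. Shifts by \<open>k > 1\<close> are included because the upper bound
  in the subadditive theorem needs Birkhoff averages along blocks.
\<close>

lemma ergodic_shift:
  assumes k: "1 \<le> k"
  shows "ergodic_map S (seq_shift k)"
proof (unfold_locales)
  show "seq_shift k \<in> measurable S S" by (rule measurable_shift)
  show "distr S S (seq_shift k) = S" by (rule distr_shift)
  fix B assume B [measurable]: "B \<in> sets S" and pulls_back: "\<And>\<omega>. \<omega> \<in> space S \<Longrightarrow> seq_shift k \<omega> \<in> B \<Longrightarrow> \<omega> \<in> B"
  have pulls_back_iterate: "\<omega> \<in> B" if "\<omega> \<in> space S" "seq_shift (j * k) \<omega> \<in> B" for \<omega> j
    using that
  proof (induction j arbitrary: \<omega>)
    case (Suc j)
    then have "seq_shift (j * k) (seq_shift k \<omega>) \<in> B" by (simp add: shift_shift)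
    then have "seq_shift k \<omega> \<in> B" using Suc measurable_space[OF measurable_shift, of \<omega> k] by blast
    then show ?case using pulls_back Suc by blast
  qed (simp add: seq_shift_def)
  have "emeasure S B = 0 \<or> emeasure S B = 1"
  proof (rule independent_of_cylinders_zero_one[OF B])
    fix n and A :: "nat \<Rightarrow> 'a set" assume A [measurable]: "\<And>i. A i \<in> sets M"
    let ?C = "{\<omega> \<in> space S. \<forall>i<n. \<omega> i \<in> A i}"
    \<comment> \<open>Iterate the shift until it moves past the \<open>n\<close> coordinates of the cylinder.\<close>
    define m where "m = n * k"
    have mn: "n \<le> m" using k by (simp add: m_def)
    define B' where "B' = {\<omega> \<in> space S. seq_shift m \<omega> \<in> B}"
    have [measurable]: "B' \<in> sets S" "?C \<in> sets S" unfolding B'_def by measurable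
    have sub: "B' \<subseteq> B" using pulls_back_iterate[of _ n] by (auto simp: B'_def m_def)
    have "emeasure S B' = emeasure (distr S S (seq_shift m)) B"
      by (subst emeasure_distr) (auto simp: B'_def intro!: arg_cong[where f = "emeasure S"])
    then have eq: "emeasure S B' = emeasure S B" unfolding distr_shift .
    have "emeasure S (B - B') = 0"
      by (subst emeasure_Diff) (use sub eq in \<open>auto simp: P.emeasure_eq_measure\<close>)
    then have "B - B' \<in> null_sets S" by (auto intro: null_setsI)
    then have "AE \<omega> in S. \<omega> \<notin> B - B'" by (rule AE_not_in)
    then have "emeasure S (B \<inter> ?C) = emeasure S (B' \<inter> ?C)"
      by (intro emeasure_eq_AE) (use sub in \<open>auto elim!: eventually_mono\<close>)
    also have "B' \<inter> ?C = {\<omega> \<in> space S. (\<forall>i<n. \<omega> i \<in> A i) \<and> seq_shift m \<omega> \<in> B}" by (auto simp: B'_def)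
    also have "emeasure S \<dots> = (\<integral>\<^sup>+ \<omega>. emeasure S {\<eta> \<in> space S. (\<forall>i<n. \<omega> i \<in> A i) \<and> \<eta> \<in> B} \<partial>S)"
    proof (rule prob_shift_split)
      show "{x \<in> space (S \<Otimes>\<^sub>M S). (\<forall>i<n. fst x i \<in> A i) \<and> snd x \<in> B} \<in> sets (S \<Otimes>\<^sub>M S)" by measurable
    qed (use mn in \<open>auto simp: comb_seq_def\<close>)
    also have "\<dots> = (\<integral>\<^sup>+ \<omega>. emeasure S B * indicator ?C \<omega> \<partial>S)"
    proof (intro nn_integral_cong)
      fix \<omega> assume w: "\<omega> \<in> space S"
      show "emeasure S {\<eta> \<in> space S. (\<forall>i<n. \<omega> i \<in> A i) \<and> \<eta> \<in> B} = emeasure S B * indicator ?C \<omega>"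
      proof (cases "\<forall>i<n. \<omega> i \<in> A i")
        case True
        then have "{\<eta> \<in> space S. (\<forall>i<n. \<omega> i \<in> A i) \<and> \<eta> \<in> B} = B"
          using sets.sets_into_space[OF B] by blast
        then show ?thesis using True w by simp
      next
        case False
        then have z: "{\<eta> \<in> space S. (\<forall>i<n. \<omega> i \<in> A i) \<and> \<eta> \<in> B} = {}" by blast
        have "\<omega> \<notin> ?C" using False by blast
        then show ?thesis unfolding z by simp
      qed
    qed
    also have "\<dots> = emeasure S B * emeasure S ?C" by (rule nn_integral_cmult_indicator) measurable
    finally show "emeasure S (B \<inter> ?C) = emeasure S B * emeasure S ?C" .
  qed
  then show "prob B = 0 \<or> prob B = 1" by (auto simp: P.emeasure_eq_measure)
qed

text \<open>
  The limit is \<open>L = inf E (X n) / n\<close>. The lower bound is the preceding greedy argument; for the upper bound, split \<open>n\<close> into blocks of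
  a length \<open>m\<close> for which \<open>E (X m) / m\<close> is almost \<open>L\<close>, apply Birkhoff's theorem to the block sums, and
  bound the incomplete last block by an integrable function on the orbit, which grows sublinearly.
\<close>

lemma subadditive_ergodic_theorem:
  fixes X :: "nat \<Rightarrow> (nat \<Rightarrow> 'a) \<Rightarrow> real"
  assumes sub: "\<And>m n \<omega>. X (m + n) \<omega> \<le> X m \<omega> + X n (seq_shift m \<omega>)"
    and X0: "\<And>\<omega>. X 0 \<omega> \<le> 0"
    and int: "\<And>n. integrable S (X n)"
    and bnd: "\<And>n. - real n * b \<le> (\<integral>\<omega>. X n \<omega> \<partial>S)"
  obtains L where "AE \<omega> in S. (\<lambda>n. X n \<omega> / real n) \<longlonglongrightarrow> L"
    "\<And>n. real n * L \<le> (\<integral>\<omega>. X n \<omega> \<partial>S)"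
    "\<And>e. 0 < e \<Longrightarrow> \<exists>n\<ge>1. (\<integral>\<omega>. X n \<omega> \<partial>S) < real n * (L + e)"
proof -
  interpret E1: ergodic_map S "seq_shift 1" by (rule ergodic_shift) simp
  define E where "E n = (\<integral>\<omega>. X n \<omega> \<partial>S)" for n
  define L where "L = (INF n\<in>{1..}. E n / real n)"
  have bb: "bdd_below ((\<lambda>n. E n / real n) ` {1..})"
    by (rule bdd_belowI[of _ "- b"]) (use bnd in \<open>auto simp: E_def field_simps\<close>)
  have E0: "0 \<le> E 0" using bnd[of 0] by (simp add: E_def)
  have L1: "real n * L \<le> E n" for n
  proof (cases "n = 0")
    case False
    then have "L \<le> E n / real n" unfolding L_def by (intro cINF_lower[OF bb]) auto
    then show ?thesis using False by (simp add: field_simps)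
  qed (use E0 in simp)
  have L2: "\<exists>n\<ge>1. E n < real n * (L + e)" if e: "0 < e" for e
  proof -
    have "\<exists>n\<in>{1..}. E n / real n < L + e"
    proof (rule ccontr)
      assume "\<not> ?thesis"
      then have "L + e \<le> L" unfolding L_def by (intro cINF_greatest) (auto simp: not_less L_def)
      then show False using e by simp
    qed
    then show ?thesis by (auto simp: field_simps)
  qed
  have "AE \<omega> in S. \<forall>k::nat. eventually (\<lambda>n. (L - 1 / Suc k) * real n \<le> X n \<omega>) sequentially"
    unfolding AE_all_countable
  proof
    fix k :: nat
    show "AE \<omega> in S. eventually (\<lambda>n. (L - 1 / Suc k) * real n \<le> X n \<omega>) sequentially"
      by (rule E1.subadditive_liminf[where L = L])
        (use sub X0 int L1 in \<open>simp_all add: shift_funpow E_def\<close>)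
  qed
  moreover have "AE \<omega> in S. \<forall>k::nat. eventually (\<lambda>n. X n \<omega> \<le> (L + 2 / Suc k) * real n) sequentially"
    unfolding AE_all_countable
  proof
    fix k :: nat
    define e where "e = 1 / real (Suc k)"
    have e: "e > 0" by (simp add: e_def)
    obtain m where m: "m \<ge> 1" "E m < real m * (L + e)" using L2[OF e] by blast
    interpret Em: ergodic_map S "seq_shift m" by (rule ergodic_shift) fact
    \<comment> \<open>Dominates the contribution of an incomplete last block.\<close>
    define H where "H \<omega> = (\<Sum>i<m. \<bar>X 1 (seq_shift i \<omega>)\<bar>)" for \<omega>
    have intH: "integrable S H"
      unfolding H_def using E1.integrable_iterate(1)[of "\<lambda>\<omega>. \<bar>X 1 \<omega>\<bar>"] int[of 1]
      by (intro Bochner_Integration.integrable_sum) (simp add: shift_funpow)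
    from Em.birkhoff[OF int[of m]] Em.orbit_value_sublinear[OF intH]
    show "AE \<omega> in S. eventually (\<lambda>n. X n \<omega> \<le> (L + 2 / Suc k) * real n) sequentially"
    proof eventually_elim
      case (elim \<omega>)
      have X1: "X j \<eta> \<le> (\<Sum>i<j. \<bar>X 1 (seq_shift i \<eta>)\<bar>)" for j \<eta>
      proof (induction j)
        case (Suc j)
        then show ?case using sub[of j 1 \<eta>] abs_ge_self[of "X 1 (seq_shift j \<eta>)"] by simp
      qed (use X0 in simp)
      have XH: "X j \<eta> \<le> H \<eta>" if "j < m" for j \<eta>
      proof -
        have "(\<Sum>i<j. \<bar>X 1 (seq_shift i \<eta>)\<bar>) \<le> H \<eta>" unfolding H_def using that by (intro sum_mono2) auto
        then show ?thesis using X1[of j \<eta>] by linarith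
      qed
      have XS: "X (q * m) \<omega> \<le> (\<Sum>i<q. X m (seq_shift (i * m) \<omega>))" for q
      proof (induction q)
        case (Suc q)
        then show ?case using sub[of "q * m" m \<omega>] by (simp add: add.commute)
      qed (use X0 in simp)
      define G where "G q = (\<Sum>i<q. X m (seq_shift (i * m) \<omega>)) / real q + H (seq_shift (q * m) \<omega>) / real q" for q
      have "G \<longlonglongrightarrow> E m + 0"
        unfolding G_def using elim by (intro tendsto_add) (simp_all add: shift_funpow E_def)
      then have "eventually (\<lambda>q. G q < real m * (L + e)) sequentially" using m(2) by (intro order_tendstoD) auto
      then obtain q0 where q0: "\<And>q. q \<ge> q0 \<Longrightarrow> G q < real m * (L + e)" by (auto simp: eventually_sequentially)
      obtain n0 :: nat where n0: "real m * \<bar>L + e\<bar> / e < real n0" using reals_Archimedean2 by blast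
      have "X n \<omega> \<le> (L + 2 / Suc k) * real n" if n: "n \<ge> max n0 (m * Suc q0)" for n
      proof -
        define q where "q = n div m"
        define r where "r = n mod m"
        have nqr: "n = q * m + r" "r < m" using m(1) by (simp_all add: q_def r_def)
        have "Suc q0 * m \<le> n" using n by (simp add: mult.commute)
        then have "Suc q0 \<le> q" unfolding q_def using m(1) by (simp add: less_eq_div_iff_mult_less_eq)
        then have q: "q \<ge> q0" "q \<ge> 1" by auto
        have "X n \<omega> \<le> X (q * m) \<omega> + X r (seq_shift (q * m) \<omega>)" unfolding nqr(1) by (rule sub)
        also have "\<dots> \<le> (\<Sum>i<q. X m (seq_shift (i * m) \<omega>)) + H (seq_shift (q * m) \<omega>)"
          by (intro add_mono XS XH nqr)
        also have "\<dots> = G q * real q" using q by (simp add: G_def field_simps)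
        also have "\<dots> \<le> real m * (L + e) * real q"
          using q0[OF q(1)] by (intro mult_right_mono) auto
        also have "\<dots> = (L + e) * real n - (L + e) * real r" by (simp add: nqr(1) algebra_simps)
        also have "\<dots> \<le> (L + e) * real n + \<bar>L + e\<bar> * real m"
        proof -
          have "- (L + e) * real r \<le> \<bar>L + e\<bar> * real r" by (intro mult_right_mono) auto
          also have "\<dots> \<le> \<bar>L + e\<bar> * real m" using nqr(2) by (intro mult_left_mono) auto
          finally show ?thesis by (simp add: algebra_simps)
        qed
        also have "\<bar>L + e\<bar> * real m \<le> e * real n"
        proof -
          have "real m * \<bar>L + e\<bar> / e \<le> real n" using n0 n by linarith
          then show ?thesis using e by (simp add: field_simps)
        qed
        finally show ?thesis by (simp add: e_def algebra_simps)
      qed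
      then show ?case unfolding eventually_sequentially by blast
    qed
  qed
  ultimately have "AE \<omega> in S. (\<lambda>n. X n \<omega> / real n) \<longlonglongrightarrow> L"
  proof eventually_elim
    case (elim \<omega>)
    show ?case
    proof (rule LIMSEQ_I)
      fix r :: real assume "0 < r"
      then obtain k where k: "1 / real (Suc k) < r / 2" using nat_approx_posE[of "r / 2"] by auto
      from elim(1)[rule_format, of k] elim(2)[rule_format, of k] eventually_gt_at_top[of 0]
      have "eventually (\<lambda>n. norm (X n \<omega> / real n - L) < r) sequentially"
      proof eventually_elim
        case (elim n)
        then have "L - 1 / Suc k \<le> X n \<omega> / real n" "X n \<omega> / real n \<le> L + 2 / Suc k"
          by (simp_all add: pos_le_divide_eq pos_divide_le_eq)
        then show ?case using k by (simp add: abs_less_iff)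
      qed
      then show "\<exists>no. \<forall>n\<ge>no. norm (X n \<omega> / real n - L) < r"
        by (simp add: eventually_sequentially)
    qed
  qed
  then show thesis by (rule that[OF _ L1[unfolded E_def] L2[unfolded E_def]])
qed

end

section \<open>Existence of the Lyapunov exponents\<close>

lemma integral_law:
  fixes f :: "real^'m^'m \<Rightarrow> real"
  assumes s: "sets \<nu> = sets borel" and f: "f \<in> borel_measurable borel"
  shows "(\<integral>g. f g \<partial>law \<nu> n) = (\<integral>\<omega>. f (cocycle n \<omega>) \<partial>iid \<nu>)"
    and "integrable (law \<nu> n) f \<longleftrightarrow> integrable (iid \<nu>) (\<lambda>\<omega>. f (cocycle n \<omega>))"
  unfolding law_def using measurable_cocycle[OF s] f
  by (auto simp: integral_distr integrable_distr_eq)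

lemma AE_law:
  assumes s: "sets \<nu> = sets borel" and "AE g in law \<nu> n. P g"
  shows "AE \<omega> in iid \<nu>. P (cocycle n \<omega>)"
  using AE_distrD[OF measurable_cocycle[OF s]] assms(2) unfolding law_def by blast

lemma AE_cocycle_nonzero:
  assumes nu: "\<nu> \<in> moment_class p C" and p: "0 < p" and C: "1 \<le> C" and v: "v \<noteq> 0"
  shows "AE \<omega> in iid \<nu>. \<forall>n. cocycle n \<omega> *v v \<noteq> 0"
  unfolding AE_all_countable
proof
  fix n
  have "AE g in law \<nu> n. g *v v \<noteq> 0"
    using C by (intro vector_moment(1)[OF law_moment_class[OF nu p C] _ p v]) simp
  then show "AE \<omega> in iid \<nu>. cocycle n \<omega> *v v \<noteq> 0"
    by (rule AE_law[OF moment_classD(2)[OF nu]])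
qed

lemma ex_unit_vector: "\<exists>v::real^'m. norm v = 1"
  by (rule exI[of _ "axis undefined 1"]) (simp add: norm_axis_1)

lemma AE_opnorm_cocycle_pos:
  fixes \<nu> :: "(real^'m^'m) measure"
  assumes nu: "\<nu> \<in> moment_class p C" and p: "0 < p" and C: "1 \<le> C"
  shows "AE \<omega> in iid \<nu>. \<forall>n. 0 < opnorm (cocycle n \<omega>)"
proof -
  obtain v :: "real^'m" where v: "norm v = 1" using ex_unit_vector by blast
  then have "v \<noteq> 0" by auto
  from AE_cocycle_nonzero[OF nu p C this] show ?thesis
  proof eventually_elim
    case (elim \<omega>)
    then have "0 < norm (cocycle n \<omega> *v v)" for n by simp
    then show ?case using norm_mult_le_opnorm[of "cocycle n \<omega>" v for n] v by (metis mult.right_neutral order_less_le_trans)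
  qed
qed

text \<open>
  Jensen's inequality for the negative moment, through \<open>ln y \<le> y - 1\<close>.
\<close>

lemma mean_log_lower_bound:
  assumes k: "\<kappa> \<in> moment_class p D" and D: "0 < D" and p: "0 < p" and v: "norm v = 1"
  shows "- ln D / p \<le> mean_log \<kappa> v"
proof -
  interpret prob_space \<kappa> by (rule moment_classD[OF k])
  have v0: "v \<noteq> 0" using v by auto
  note I = vector_moment[OF k D p v0]
  have "(\<integral>g. - p * ln (norm (g *v v)) \<partial>\<kappa>) \<le> (\<integral>g. norm (g *v v) powr -p / D + (ln D - 1) \<partial>\<kappa>)"
  proof (rule integral_mono_AE)
    show "integrable \<kappa> (\<lambda>g. - p * ln (norm (g *v v)))"
      by (intro integrable_mult_right integrable_ln_norm[OF k D p v0])
    show "integrable \<kappa> (\<lambda>g. norm (g *v v) powr -p / D + (ln D - 1))"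
      by (intro Bochner_Integration.integrable_add integrable_divide I) simp
    show "AE g in \<kappa>. - p * ln (norm (g *v v)) \<le> norm (g *v v) powr -p / D + (ln D - 1)"
      using I(1)
    proof eventually_elim
      case (elim g)
      have "ln (norm (g *v v) powr -p / D) \<le> norm (g *v v) powr -p / D - 1"
        using elim D by (intro ln_le_minus_one) simp
      then show ?case using elim D by (simp add: ln_div ln_powr)
    qed
  qed
  also have "\<dots> = (\<integral>g. norm (g *v v) powr -p \<partial>\<kappa>) / D + (ln D - 1)"
    using I(2) by (subst Bochner_Integration.integral_add) (auto simp: prob_space)
  also have "\<dots> \<le> ln D" using I(3) v D by simp
  finally have "- p * mean_log \<kappa> v \<le> ln D" by (simp add: mean_log_def)
  then show ?thesis using p by (simp add: field_simps)
qed

lemma ln_max_mult_le: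
  fixes x y a b :: real
  assumes "0 \<le> x" "0 \<le> y" "0 < a" "0 < b" "z \<le> x * y"
  shows "ln (max z (a * b)) \<le> ln (max x a) + ln (max y b)"
proof -
  have "x * y \<le> max x a * max y b" "a * b \<le> max x a * max y b"
    using assms by (intro mult_mono; simp)+
  then have "max z (a * b) \<le> max x a * max y b" using assms by simp
  moreover have "0 < max z (a * b)" using assms by (simp add: less_max_iff_disj)
  ultimately have "ln (max z (a * b)) \<le> ln (max x a * max y b)"
    by (intro ln_mono) (auto intro: less_le_trans)
  also have "\<dots> = ln (max x a) + ln (max y b)"
    using assms by (intro ln_mult_pos) (simp_all add: less_max_iff_disj)
  finally show ?thesis .
qed

lemma abs_ln_truncated_le:
  fixes x y p a :: real
  assumes x: "x \<le> 1 + y\<^sup>2" and y: "0 \<le> y" and p: "0 < p" "p \<le> 1" and a: "0 \<le> a"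
  shows "\<bar>ln (max x (exp (- a)))\<bar> \<le> a + 2 / p * (2 + y powr p)"
proof -
  have m: "exp (- a) \<le> max x (exp (- a))" by simp
  have pos: "0 < max x (exp (- a))" using exp_gt_zero[of "- a"] m by linarith
  have "ln (exp (- a)) \<le> ln (max x (exp (- a)))" using pos by (subst ln_le_cancel_iff) auto
  then have low: "- a \<le> ln (max x (exp (- a)))" by simp
  have z: "max x (exp (- a)) \<le> 2 + y\<^sup>2" using x a by (simp add: add_increasing2 order_trans[of "exp (- a)" 1])
  have z0: "0 < 2 + y\<^sup>2" by (simp add: add_pos_nonneg)
  have "ln (max x (exp (- a))) \<le> ln (2 + y\<^sup>2)" using z pos z0 by simp
  also have "\<dots> \<le> (2 + y\<^sup>2) powr (p/2) / (p/2)"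
    using ln_le_minus_one[of "(2 + y\<^sup>2) powr (p/2)"] z0 p by (simp add: ln_powr field_simps)
  also have "(2 + y\<^sup>2) powr (p/2) \<le> 2 powr (p/2) + (y\<^sup>2) powr (p/2)"
    using p by (intro powr_subadditive) auto
  also have "(y\<^sup>2) powr (p/2) = y powr p"
    using y p by (cases "y = 0") (simp_all add: powr_powr flip: powr_numeral)
  also have "2 powr (p/2) \<le> (2::real)" using powr_mono[of "p/2" 1 "2::real"] p by simp
  finally have "ln (max x (exp (- a))) \<le> 2 / p * (2 + y powr p)" using p by (simp add: divide_right_mono mult.commute)
  moreover have "0 \<le> 2 / p * (2 + y powr p)" using p by (simp add: add_nonneg_nonneg)
  ultimately show ?thesis using low a by (simp add: abs_le_iff)
qed

text \<open>
  Truncating from below at \<open>exp (- b n)\<close> keeps the process subadditive and makes it integrable. This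
  covers exponents equal to \<open>-\<infinity>\<close> and matrices whose product vanishes.
\<close>

lemma truncated_growth_rate:
  fixes \<mu> :: "(real^'m^'m) measure" and f :: "real^'m^'m \<Rightarrow> real"
  assumes mu: "\<mu> \<in> moment_class p C" and p: "0 < p" "p \<le> 1" and C: "1 \<le> C"
    and f [measurable]: "f \<in> borel_measurable borel"
    and f_nonneg: "\<And>A. 0 \<le> f A" and f_mult: "\<And>A B. f (A ** B) \<le> f A * f B"
    and f_one: "f (mat 1) \<le> 1" and f_bound: "\<And>A. f A \<le> 1 + (opnorm A)\<^sup>2"
    and b: "0 \<le> b"
  obtains L where "AE \<omega> in iid \<mu>. (\<lambda>n. ln (max (f (cocycle n \<omega>)) (exp (- (b * real n)))) / real n) \<longlonglongrightarrow> L"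
    "\<And>n. integrable (law \<mu> n) (\<lambda>g. ln (max (f g) (exp (- (b * real n)))))"
    "\<And>e. 0 < e \<Longrightarrow> \<exists>m\<ge>1. \<forall>k. (\<integral>g. ln (max (f g) (exp (- (b * real (k * m))))) \<partial>law \<mu> (k * m)) \<le> real (k * m) * (L + e)"
proof -
  note mu_props = moment_classD[OF mu]
  note [measurable_cong] = mu_props(2)
  note [measurable] = measurable_cocycle[OF mu_props(2)]
  interpret sequence_space \<mu> by (rule sequence_space_prob[OF mu_props(1)])
  define X where "X n \<omega> = ln (max (f (cocycle n \<omega>)) (exp (- (b * real n))))" for n \<omega>
  have C0: "0 \<le> C ^ n" for n using C by simp
  have int_law: "integrable (law \<mu> n) (\<lambda>g. ln (max (f g) (exp (- (b * real n)))))" for n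
  proof (rule Bochner_Integration.integrable_bound)
    interpret N: prob_space "law \<mu> n" by (rule prob_space_law[OF mu_props(1,2)])
    show "integrable (law \<mu> n) (\<lambda>g. b * real n + 2 / p * (2 + opnorm g powr p))"
      by (intro Bochner_Integration.integrable_add integrable_mult_right
          opnorm_moment(1)[OF law_moment_class[OF mu p(1) C] C0]) simp_all
    show "AE g in law \<mu> n. norm (ln (max (f g) (exp (- (b * real n))))) \<le> norm (b * real n + 2 / p * (2 + opnorm g powr p))"
    proof (intro AE_I2)
      fix g :: "real^'m^'m"
      have "\<bar>ln (max (f g) (exp (- (b * real n))))\<bar> \<le> b * real n + 2 / p * (2 + opnorm g powr p)"
        using b p by (intro abs_ln_truncated_le f_bound opnorm_nonneg) auto
      then show "norm (ln (max (f g) (exp (- (b * real n))))) \<le> norm (b * real n + 2 / p * (2 + opnorm g powr p))"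
        by simp
    qed
  qed measurable
  have int: "integrable S (X n)" for n
    using int_law[of n] unfolding X_def by (subst (asm) integral_law(2)[OF mu_props(2)]) simp_all
  have sub: "X (m + n) \<omega> \<le> X m \<omega> + X n (seq_shift m \<omega>)" for m n \<omega>
  proof -
    have "cocycle (m + n) \<omega> = cocycle n (seq_shift m \<omega>) ** cocycle m \<omega>"
      unfolding seq_shift_def by (rule cocycle_add)
    then have "f (cocycle (m + n) \<omega>) \<le> f (cocycle m \<omega>) * f (cocycle n (seq_shift m \<omega>))"
      using f_mult[of "cocycle n (seq_shift m \<omega>)" "cocycle m \<omega>"] by (simp add: mult.commute)
    moreover have "exp (- (b * real (m + n))) = exp (- (b * real m)) * exp (- (b * real n))"
      by (simp add: exp_add[symmetric] algebra_simps)
    ultimately show ?thesis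
      unfolding X_def by (simp only:) (rule ln_max_mult_le; simp add: f_nonneg)
  qed
  have X0: "X 0 \<omega> \<le> 0" for \<omega> using f_one by (simp add: X_def)
  have "- real n * b \<le> (\<integral>\<omega>. X n \<omega> \<partial>S)" for n
  proof -
    have "ln (exp (- (b * real n))) \<le> X n \<omega>" for \<omega> unfolding X_def by (subst ln_le_cancel_iff) (auto simp: less_max_iff_disj)
    then have "(\<integral>\<omega>. - (b * real n) \<partial>S) \<le> (\<integral>\<omega>. X n \<omega> \<partial>S)" by (intro integral_mono int) simp_all
    then show ?thesis by (simp add: P.prob_space mult.commute)
  qed
  note bnd = this
  obtain L where L: "AE \<omega> in S. (\<lambda>n. X n \<omega> / real n) \<longlonglongrightarrow> L"
    "\<And>e. 0 < e \<Longrightarrow> \<exists>n\<ge>1. (\<integral>\<omega>. X n \<omega> \<partial>S) < real n * (L + e)"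
    by (rule subadditive_ergodic_theorem[of X, OF sub X0 int bnd]) (rule that)
  have EX: "(\<integral>g. ln (max (f g) (exp (- (b * real n)))) \<partial>law \<mu> n) = (\<integral>\<omega>. X n \<omega> \<partial>S)" for n
    unfolding X_def by (rule integral_law(1)[OF mu_props(2)]) measurable
  show thesis
  proof (rule that)
    show "AE \<omega> in S. (\<lambda>n. ln (max (f (cocycle n \<omega>)) (exp (- (b * real n)))) / real n) \<longlonglongrightarrow> L"
      using L(1) by (simp only: X_def)
    show "integrable (law \<mu> n) (\<lambda>g. ln (max (f g) (exp (- (b * real n)))))" for n by (rule int_law)
    fix e :: real assume e: "0 < e"
    then obtain m where m: "m \<ge> 1" "(\<integral>\<omega>. X m \<omega> \<partial>S) < real m * (L + e)" using L(2) by blast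
    have "(\<integral>\<omega>. X (k * m) \<omega> \<partial>S) \<le> real k * (\<integral>\<omega>. X m \<omega> \<partial>S)" for k
    proof (induction k)
      case 0
      have "(\<integral>\<omega>. X 0 \<omega> \<partial>S) \<le> (\<integral>\<omega>. 0 \<partial>S)" by (intro integral_mono int X0) simp
      then show ?case by simp
    next
      case (Suc k)
      have i: "integrable S (\<lambda>\<omega>. X m (seq_shift (k * m) \<omega>))" "(\<integral>\<omega>. X m (seq_shift (k * m) \<omega>) \<partial>S) = (\<integral>\<omega>. X m \<omega> \<partial>S)"
        using integrable_distr_eq[of "seq_shift (k * m)" S S "X m"] integral_distr[of "seq_shift (k * m)" S S "X m"] int[of m] borel_measurable_integrable[OF int[of m]]
        by (simp_all add: distr_shift measurable_shift)
      have "(\<integral>\<omega>. X (k * m + m) \<omega> \<partial>S) \<le> (\<integral>\<omega>. X (k * m) \<omega> + X m (seq_shift (k * m) \<omega>) \<partial>S)"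
        by (intro integral_mono int Bochner_Integration.integrable_add i sub)
      also have "\<dots> = (\<integral>\<omega>. X (k * m) \<omega> \<partial>S) + (\<integral>\<omega>. X m \<omega> \<partial>S)"
        by (simp add: int i)
      finally show ?case using Suc by (simp add: algebra_simps)
    qed
    moreover have "real k * (\<integral>\<omega>. X m \<omega> \<partial>S) \<le> real (k * m) * (L + e)" for k
      using mult_left_mono[OF less_imp_le[OF m(2)], of "real k"] by (simp add: algebra_simps)
    ultimately show "\<exists>m\<ge>1. \<forall>k. (\<integral>g. ln (max (f g) (exp (- (b * real (k * m))))) \<partial>law \<mu> (k * m)) \<le> real (k * m) * (L + e)"
      unfolding EX using m(1) order_trans by blast
  qed
qed

text \<open>
  If the truncated rate exceeds the truncation level, the truncation is eventually inactive.
\<close>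

lemma untruncated_limit:
  fixes x :: "nat \<Rightarrow> real"
  assumes lim: "(\<lambda>n. ln (max (x n) (exp (- (b * real n)))) / real n) \<longlonglongrightarrow> L" and L: "- b < L"
  shows "eventually (\<lambda>n. 0 < x n) sequentially" and "(\<lambda>n. ln (x n) / real n) \<longlonglongrightarrow> L"
proof -
  have ev: "eventually (\<lambda>n. exp (- (b * real n)) < x n) sequentially"
    using order_tendstoD(1)[OF lim L] eventually_gt_at_top[of 0]
  proof eventually_elim
    case (elim n)
    then have "- b * real n < ln (max (x n) (exp (- (b * real n))))" by (simp add: pos_less_divide_eq)
    show ?case
    proof (rule ccontr)
      assume "\<not> ?case"
      then have "max (x n) (exp (- (b * real n))) = exp (- (b * real n))" by simp
      then show False using \<open>- b * real n < _\<close> by simp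
    qed
  qed
  then show "eventually (\<lambda>n. 0 < x n) sequentially"
    by eventually_elim (rule less_trans[OF exp_gt_zero])
  from ev have "eventually (\<lambda>n. ln (max (x n) (exp (- (b * real n)))) / real n = ln (x n) / real n) sequentially"
    by eventually_elim (simp add: max_def)
  then show "(\<lambda>n. ln (x n) / real n) \<longlonglongrightarrow> L" by (rule Lim_transform_eventually[OF lim])
qed

lemma elog_limit:
  assumes "eventually (\<lambda>n. 0 < x n) sequentially" and "(\<lambda>n. ln (x n) / real n) \<longlonglongrightarrow> L"
  shows "(\<lambda>n. elog (x n) / ereal (real n)) \<longlonglongrightarrow> ereal L"
proof (rule Lim_transform_eventually)
  show "(\<lambda>n. ereal (ln (x n) / real n)) \<longlonglongrightarrow> ereal L" using assms(2) by simp
  show "eventually (\<lambda>n. ereal (ln (x n) / real n) = elog (x n) / ereal (real n)) sequentially"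
    using assms(1) eventually_gt_at_top[of 0] by eventually_elim (simp add: elog_def)
qed

lemma (in prob_space) the_AE_limit:
  fixes X :: "nat \<Rightarrow> 'a \<Rightarrow> ereal"
  assumes "AE \<omega> in M. (\<lambda>n. X n \<omega>) \<longlonglongrightarrow> L"
  shows "(THE L. AE \<omega> in M. (\<lambda>n. X n \<omega>) \<longlonglongrightarrow> L) = L"
proof (rule the_equality[where P = "\<lambda>L. AE \<omega> in M. (\<lambda>n. X n \<omega>) \<longlonglongrightarrow> L", OF assms])
  fix L' assume "AE \<omega> in M. (\<lambda>n. X n \<omega>) \<longlonglongrightarrow> L'"
  with assms have "AE \<omega> in M. L' = L" by eventually_elim (rule LIMSEQ_unique)
  then show "L' = L" by simp
qed

lemma lyapunov1_eqI:
  fixes \<mu> :: "(real^'m^'m) measure"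
  assumes mu: "\<mu> \<in> moment_class p C" and p: "0 < p" and C: "1 \<le> C"
    and "AE \<omega> in iid \<mu>. (\<lambda>n. ln (opnorm (cocycle n \<omega>)) / real n) \<longlonglongrightarrow> l"
  shows "lyapunov1 \<mu> = ereal l"
proof -
  interpret prob_space "iid \<mu>" by (rule prob_space_iid[OF moment_classD(1)[OF mu]])
  have "AE \<omega> in iid \<mu>. (\<lambda>n. elog (opnorm (cocycle n \<omega>)) / ereal (real n)) \<longlonglongrightarrow> ereal l"
    using assms(4) AE_opnorm_cocycle_pos[OF mu p C]
    by eventually_elim (rule elog_limit, simp_all)
  then show ?thesis unfolding lyapunov1_def by (rule the_AE_limit)
qed

text \<open>
  The lower moment bound keeps the rate of the operator norm above \<open>- ln C / p\<close>, so a truncation below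
  that level is inactive.
\<close>

lemma lyapunov1_limit:
  fixes \<mu> :: "(real^'m^'m) measure"
  assumes mu: "\<mu> \<in> moment_class p C" and p: "0 < p" "p \<le> 1" and C: "1 \<le> C"
  obtains l where "lyapunov1 \<mu> = ereal l" "AE \<omega> in iid \<mu>. (\<lambda>n. ln (opnorm (cocycle n \<omega>)) / real n) \<longlonglongrightarrow> l"
proof -
  note mu_props = moment_classD[OF mu]
  \<comment> \<open>One more than the guaranteed lower bound for the rate.\<close>
  define b where "b = ln C / p + 1"
  have b0: "0 \<le> b" using C p by (simp add: b_def)
  have "opnorm A \<le> 1 + (opnorm A)\<^sup>2" for A :: "real^'m^'m"
    using zero_le_power2[of "opnorm A - 1 / 2"] by (simp add: power2_eq_square algebra_simps)
  then have bd: "opnorm A \<le> 1 + (opnorm A)\<^sup>2" for A :: "real^'m^'m" .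
  have one: "opnorm (mat 1 :: real^'m^'m) \<le> 1" by (simp only: opnorm_mat_1 order_refl)
  have ms: "opnorm \<in> borel_measurable (borel :: (real^'m^'m) measure)"
    using borel_measurable_opnorm[of "\<lambda>x. x" borel] by simp
  obtain l where l: "AE \<omega> in iid \<mu>. (\<lambda>n. ln (max (opnorm (cocycle n \<omega>)) (exp (- (b * real n)))) / real n) \<longlonglongrightarrow> l"
    "\<And>n. integrable (law \<mu> n) (\<lambda>g. ln (max (opnorm g) (exp (- (b * real n)))))"
    "\<And>e. 0 < e \<Longrightarrow> \<exists>m\<ge>1. \<forall>k. (\<integral>g. ln (max (opnorm g) (exp (- (b * real (k * m))))) \<partial>law \<mu> (k * m)) \<le> real (k * m) * (l + e)"
    by (rule truncated_growth_rate[OF mu p C ms opnorm_nonneg opnorm_mult one bd b0]) (rule that)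
  have "- b < l"
  proof (rule ccontr)
    assume "\<not> - b < l"
    then obtain m where m: "m \<ge> 1" "\<And>k. (\<integral>g. ln (max (opnorm g) (exp (- (b * real (k * m))))) \<partial>law \<mu> (k * m)) \<le> real (k * m) * (l + 1 / 2)"
      using l(3)[of "1 / 2"] by auto
    obtain v :: "real^'m" where v: "norm v = 1" using ex_unit_vector by blast
    then have v0: "v \<noteq> 0" by auto
    have Cm: "0 < C ^ m" using C by simp
    note K = law_moment_class[OF mu p(1) C, of m]
    have "mean_log (law \<mu> m) v \<le> (\<integral>g. ln (max (opnorm g) (exp (- (b * real m)))) \<partial>law \<mu> m)"
      unfolding mean_log_def
    proof (rule integral_mono_AE[OF integrable_ln_norm[OF K Cm p(1) v0] l(2)])
      show "AE g in law \<mu> m. ln (norm (g *v v)) \<le> ln (max (opnorm g) (exp (- (b * real m))))"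
        using vector_moment(1)[OF K Cm p(1) v0]
      proof eventually_elim
        case (elim g)
        have "norm (g *v v) \<le> max (opnorm g) (exp (- (b * real m)))"
          using norm_mult_le_opnorm[of g v] v by simp
        then show ?case using elim by (subst ln_le_cancel_iff) (auto simp: less_max_iff_disj)
      qed
    qed
    also have "\<dots> \<le> real m * (l + 1 / 2)" using m(2)[of 1] by simp
    also have "\<dots> < real m * (- (ln C / p))"
      using m(1) \<open>\<not> - b < l\<close> by (intro mult_strict_left_mono) (auto simp: b_def)
    also have "\<dots> = - ln (C ^ m) / p" using C by (simp add: ln_realpow)
    finally show False using mean_log_lower_bound[OF K Cm p(1) v] by simp
  qed
  then have "AE \<omega> in iid \<mu>. (\<lambda>n. ln (opnorm (cocycle n \<omega>)) / real n) \<longlonglongrightarrow> l"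
    using l(1) by (auto elim!: eventually_mono intro: untruncated_limit(2))
  then show thesis using that lyapunov1_eqI[OF mu p(1) C] by blast
qed

text \<open>
  If for some level \<open>b\<close> the truncation is inactive, the truncated rate is the sum of the two Lyapunov
  exponents, which is below \<open>2 l\<close> by assumption. Otherwise every truncated rate is at most its own
  level \<open>- b\<close>, and a large \<open>b\<close> will do.
\<close>

lemma exterior_growth_gap:
  fixes \<mu> :: "(real^'m^'m) measure"
  assumes mu: "\<mu> \<in> moment_class p C" and p: "0 < p" "p \<le> 1" and C: "1 \<le> C"
    and gap: "lyapunov2 \<mu> < lyapunov1 \<mu>" and l: "lyapunov1 \<mu> = ereal l"
    and lim: "AE \<omega> in iid \<mu>. (\<lambda>n. ln (opnorm (cocycle n \<omega>)) / real n) \<longlonglongrightarrow> l"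
  obtains b L where "0 \<le> b" "L < 2 * l"
    "AE \<omega> in iid \<mu>. (\<lambda>n. ln (max (exterior_norm (cocycle n \<omega>)) (exp (- (b * real n)))) / real n) \<longlonglongrightarrow> L"
    "\<And>e. 0 < e \<Longrightarrow> \<exists>m\<ge>1. \<forall>k. (\<integral>g. ln (max (exterior_norm g) (exp (- (b * real (k * m))))) \<partial>law \<mu> (k * m)) \<le> real (k * m) * (L + e)"
proof -
  interpret prob_space "iid \<mu>" by (rule prob_space_iid[OF moment_classD(1)[OF mu]])
  have bd: "exterior_norm A \<le> 1 + (opnorm A)\<^sup>2" for A :: "real^'m^'m" using exterior_norm_le[of A] by simp
  have one: "exterior_norm (mat 1 :: real^'m^'m) \<le> 1" using exterior_norm_le[of "mat 1 :: real^'m^'m"] by (simp add: opnorm_mat_1)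
  have ms: "exterior_norm \<in> borel_measurable (borel :: (real^'m^'m) measure)"
    using borel_measurable_exterior_norm[of "\<lambda>x. x" borel] by simp
  define Q where "Q b L \<longleftrightarrow>
    (AE \<omega> in iid \<mu>. (\<lambda>n. ln (max (exterior_norm (cocycle n \<omega>)) (exp (- (b * real n)))) / real n) \<longlonglongrightarrow> L) \<and>
    (\<forall>e>0. \<exists>m\<ge>1. \<forall>k. (\<integral>g. ln (max (exterior_norm g) (exp (- (b * real (k * m))))) \<partial>law \<mu> (k * m)) \<le> real (k * m) * (L + e))" for b L
  have ex: "\<exists>L. Q b L" if b: "0 \<le> b" for b
  proof -
    obtain L where "AE \<omega> in iid \<mu>. (\<lambda>n. ln (max (exterior_norm (cocycle n \<omega>)) (exp (- (b * real n)))) / real n) \<longlonglongrightarrow> L"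
      "\<And>n. integrable (law \<mu> n) (\<lambda>g. ln (max (exterior_norm g) (exp (- (b * real n)))))"
      "\<And>e. 0 < e \<Longrightarrow> \<exists>m\<ge>1. \<forall>k. (\<integral>g. ln (max (exterior_norm g) (exp (- (b * real (k * m))))) \<partial>law \<mu> (k * m)) \<le> real (k * m) * (L + e)"
      by (rule truncated_growth_rate[OF mu p C ms exterior_norm_nonneg exterior_norm_mult one bd b]) (rule that)
    then show ?thesis unfolding Q_def by blast
  qed
  have "\<exists>b L. 0 \<le> b \<and> L < 2 * l \<and> Q b L"
  proof (cases "\<exists>b L. 0 \<le> b \<and> - b < L \<and> Q b L")
    case True
    then obtain b L where b: "0 \<le> b" "- b < L" "Q b L" by blast
    have limW: "AE \<omega> in iid \<mu>. (\<lambda>n. ln (max (exterior_norm (cocycle n \<omega>)) (exp (- (b * real n)))) / real n) \<longlonglongrightarrow> L"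
      using b(3) by (simp add: Q_def)
    have "AE \<omega> in iid \<mu>. (\<lambda>n. elog (singular_value 2 (cocycle n \<omega>)) / ereal (real n)) \<longlonglongrightarrow> ereal (L - l)"
      using limW lim AE_opnorm_cocycle_pos[OF mu p(1) C]
    proof eventually_elim
      case (elim \<omega>)
      define W where "W n = exterior_norm (cocycle n \<omega>)" for n
      define a where "a n = opnorm (cocycle n \<omega>)" for n
      define s where "s n = singular_value 2 (cocycle n \<omega>)" for n
      have a: "0 < a n" for n using elim(3) by (simp add: a_def)
      have Ws: "W n = a n * s n" for n by (simp add: W_def a_def s_def exterior_norm_def)
      note U = untruncated_limit[of W b L, OF elim(1)[folded W_def] b(2)]
      have s_pos: "eventually (\<lambda>n. 0 < s n) sequentially"
        using U(1)
      proof eventually_elim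
        case (elim n)
        then show ?case using a[of n] unfolding Ws by (rule zero_less_mult_pos)
      qed
      have "(\<lambda>n. ln (W n) / real n - ln (a n) / real n) \<longlonglongrightarrow> L - l"
        by (intro tendsto_diff U(2) elim(2)[folded a_def])
      then have "(\<lambda>n. ln (s n) / real n) \<longlonglongrightarrow> L - l"
      proof (rule Lim_transform_eventually)
        show "eventually (\<lambda>n. ln (W n) / real n - ln (a n) / real n = ln (s n) / real n) sequentially"
          using s_pos by eventually_elim (use a in \<open>simp add: Ws ln_mult_pos diff_divide_distrib[symmetric]\<close>)
      qed
      then show ?case using elog_limit[OF s_pos] by (simp add: s_def)
    qed
    then have "lyapunov2 \<mu> = ereal (L - l)" unfolding lyapunov2_def by (rule the_AE_limit)
    then have "L < 2 * l" using gap l by simp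
    then show ?thesis using b by blast
  next
    case False
    define b where "b = \<bar>2 * l\<bar> + 1"
    have b0: "0 \<le> b" by (simp add: b_def)
    obtain L where L: "Q b L" using ex[OF b0] by blast
    have "\<not> - b < L" using False b0 L by blast
    then have "L < 2 * l" using abs_ge_minus_self[of "2 * l"] by (simp add: b_def)
    then show ?thesis using L b0 by blast
  qed
  then show thesis using that unfolding Q_def by blast
qed

section \<open>Exponentially fast alignment\<close>

text \<open>
  The error term in the one-step estimate for growth ratios has exponential rate \<open>L - 2 l < 0\<close>: the single factor grows
  subexponentially, the exterior norm has rate \<open>L\<close> and the squared operator norm rate \<open>2 l\<close>. Half of this
  rate is kept.
\<close>

lemma AE_alignment:
  fixes \<mu> :: "(real^'m^'m) measure"
  assumes mu: "\<mu> \<in> moment_class p C" and p: "0 < p" and C: "1 \<le> C"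
    and lim: "AE \<omega> in iid \<mu>. (\<lambda>n. ln (opnorm (cocycle n \<omega>)) / real n) \<longlonglongrightarrow> l"
    and limW: "AE \<omega> in iid \<mu>. (\<lambda>n. ln (max (exterior_norm (cocycle n \<omega>)) (exp (- (b * real n)))) / real n) \<longlonglongrightarrow> L"
    and gap: "L < 2 * l"
  shows "AE \<omega> in iid \<mu>. eventually (\<lambda>n. \<forall>v. norm v = 1 \<longrightarrow>
    \<bar>(growth_ratio (cocycle (Suc n) \<omega>) v)\<^sup>2 - (growth_ratio (cocycle n \<omega>) v)\<^sup>2\<bar>
      \<le> exp (- ((2 * l - L) / 2)) ^ n) sequentially"
proof -
  note mu_props = moment_classD[OF mu]
  note [measurable_cong] = mu_props(2)
  interpret sequence_space \<mu> by (rule sequence_space_prob[OF mu_props(1)])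
  interpret E1: ergodic_map S "seq_shift 1" by (rule ergodic_shift) simp
  define h where "h = (\<lambda>g::real^'m^'m. ln (max (opnorm g) 1))"
  have [measurable]: "h \<in> borel_measurable borel" unfolding h_def by measurable
  have "integrable \<mu> h"
  proof (rule Bochner_Integration.integrable_bound)
    show "integrable \<mu> (\<lambda>g. opnorm g powr p / p)"
      using C by (intro integrable_divide opnorm_moment[OF mu]) simp
    show "AE g in \<mu>. norm (h g) \<le> norm (opnorm g powr p / p)"
    proof (intro AE_I2)
      fix g :: "real^'m^'m"
      have "ln (opnorm g) \<le> opnorm g powr p / p" if "1 \<le> opnorm g"
        by (rule ln_powr_bound[OF that p])
      then show "norm (h g) \<le> norm (opnorm g powr p / p)"
        using p by (auto simp: h_def max_def)
    qed
  qed measurable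
  then have "integrable (distr S \<mu> (\<lambda>\<omega>. \<omega> 0)) h" by (subst PiM_component) auto
  then have "integrable S (\<lambda>\<omega>. h (\<omega> 0))" by (subst (asm) integrable_distr_eq) auto
  then have "AE \<omega> in S. (\<lambda>n. h (seq_shift n \<omega> 0) / real n) \<longlonglongrightarrow> 0"
    using E1.orbit_value_sublinear[of "\<lambda>\<omega>. h (\<omega> 0)"] by (simp add: shift_funpow)
  with lim limW AE_opnorm_cocycle_pos[OF mu p C] show ?thesis
  proof eventually_elim
    case (elim \<omega>)
    define a where "a n = opnorm (cocycle n \<omega>)" for n
    define W where "W n = max (exterior_norm (cocycle n \<omega>)) (exp (- (b * real n)))" for n
    have a: "0 < a n" for n using elim(3) by (simp add: a_def)
    have Wp: "0 < W n" for n by (simp add: W_def less_max_iff_disj)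
    \<comment> \<open>The logarithm of an upper bound for the one-step error.\<close>
    define Y where "Y n = ln 5 + 2 * h (\<omega> n) + ln (W n) - 2 * ln (a (Suc n))" for n
    have la: "(\<lambda>n. ln (a (Suc n)) / real n) \<longlonglongrightarrow> l"
    proof -
      have "(\<lambda>n. ln (a (Suc n)) / real (Suc n) * (1 + 1 / real n)) \<longlonglongrightarrow> l * (1 + 0)"
        by (intro tendsto_intros lim_1_over_n LIMSEQ_Suc elim(1)[folded a_def])
      then have "(\<lambda>n. ln (a (Suc n)) / real (Suc n) * (1 + 1 / real n)) \<longlonglongrightarrow> l" by simp
      then show ?thesis
      proof (rule Lim_transform_eventually)
        show "eventually (\<lambda>n. ln (a (Suc n)) / real (Suc n) * (1 + 1 / real n) = ln (a (Suc n)) / real n) sequentially"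
          using eventually_gt_at_top[of 0]
        proof eventually_elim
          case (elim n)
          then have "1 + 1 / real n = real (Suc n) / real n" by (simp add: field_simps)
          then show ?case by simp
        qed
      qed
    qed
    have "(\<lambda>n. ln 5 * (1 / real n) + 2 * (h (\<omega> n) / real n) + ln (W n) / real n - 2 * (ln (a (Suc n)) / real n))
        \<longlonglongrightarrow> ln 5 * 0 + 2 * 0 + L - 2 * l"
      using elim(2,4) by (intro tendsto_intros lim_1_over_n la) (simp_all add: W_def seq_shift_def)
    then have "(\<lambda>n. Y n / real n) \<longlonglongrightarrow> L - 2 * l"
      by (simp add: Y_def add_divide_distrib diff_divide_distrib)
    moreover have "L - 2 * l < - ((2 * l - L) / 2)" using gap by (simp add: field_simps)
    ultimately have "eventually (\<lambda>n. Y n / real n < - ((2 * l - L) / 2)) sequentially"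
      by (rule order_tendstoD(2))
    then show ?case using eventually_gt_at_top[of 0]
    proof eventually_elim
      case (elim n)
      then have "Y n \<le> real n * (- ((2 * l - L) / 2))" by (simp add: pos_divide_less_eq mult.commute)
      then have Y: "exp (Y n) \<le> exp (- ((2 * l - L) / 2)) ^ n"
        by (simp only: exp_of_nat_mult[symmetric] exp_le_cancel_iff)
      have "5 * ((opnorm (\<omega> n))\<^sup>2 * exterior_norm (cocycle n \<omega>) / (a (Suc n))\<^sup>2) \<le> exp (Y n)"
      proof -
        have "exp (Y n) = 5 * ((max (opnorm (\<omega> n)) 1)\<^sup>2 * W n / (a (Suc n))\<^sup>2)"
          unfolding Y_def h_def using Wp[of n] a[of "Suc n"]
          by (simp add: exp_add exp_diff exp_double less_max_iff_disj)
        moreover have "(opnorm (\<omega> n))\<^sup>2 * exterior_norm (cocycle n \<omega>) \<le> (max (opnorm (\<omega> n)) 1)\<^sup>2 * W n"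
          by (intro mult_mono power_mono) (auto simp: W_def opnorm_nonneg exterior_norm_nonneg)
        ultimately show ?thesis by (simp add: divide_right_mono)
      qed
      with Y have bound: "5 * ((opnorm (\<omega> n))\<^sup>2 * exterior_norm (cocycle n \<omega>) / (a (Suc n))\<^sup>2)
        \<le> exp (- ((2 * l - L) / 2)) ^ n" by linarith
      show ?case
      proof (intro allI impI)
        fix v :: "real^'m" assume "norm v = 1"
        from growth_ratio_step[of "\<omega> n" "cocycle n \<omega>" v, OF _ this] a[of "Suc n"] bound
        show "\<bar>(growth_ratio (cocycle (Suc n) \<omega>) v)\<^sup>2 - (growth_ratio (cocycle n \<omega>) v)\<^sup>2\<bar>
          \<le> exp (- ((2 * l - L) / 2)) ^ n" by (simp add: a_def)
      qed
    qed
  qed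
qed

section \<open>No vector is asymptotically slow\<close>

lemma geometric_increments:
  fixes a :: "nat \<Rightarrow> real"
  assumes q: "0 < q" "q < 1" and inc: "\<And>n. N \<le> n \<Longrightarrow> \<bar>a (Suc n) - a n\<bar> \<le> q ^ n"
  shows "convergent a" and "a \<longlonglongrightarrow> x \<Longrightarrow> N \<le> n \<Longrightarrow> \<bar>a n - x\<bar> \<le> q ^ n / (1 - q)"
proof -
  have step: "\<bar>a (n + k) - a n\<bar> \<le> q ^ n / (1 - q)" if n: "N \<le> n" for n k
  proof -
    have "\<bar>a (n + k) - a n\<bar> \<le> q ^ n * (1 - q ^ k) / (1 - q)"
    proof (induction k)
      case (Suc k)
      have "\<bar>a (n + Suc k) - a n\<bar> \<le> \<bar>a (Suc (n + k)) - a (n + k)\<bar> + \<bar>a (n + k) - a n\<bar>" by simp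
      also have "\<dots> \<le> q ^ (n + k) + q ^ n * (1 - q ^ k) / (1 - q)"
        using inc[of "n + k"] n Suc by simp
      also have "\<dots> = q ^ n * (1 - q ^ Suc k) / (1 - q)"
        using q by (simp add: field_simps power_add)
      finally show ?case .
    qed simp
    also have "\<dots> \<le> q ^ n / (1 - q)"
      using q by (intro divide_right_mono) (auto simp: mult_le_cancel_left1)
    finally show ?thesis .
  qed
  have small: "(\<lambda>n. 2 * (q ^ n / (1 - q))) \<longlonglongrightarrow> 0"
  proof -
    have "(\<lambda>n. q ^ n) \<longlonglongrightarrow> 0" using q by (intro LIMSEQ_realpow_zero) auto
    from tendsto_mult_right[OF this, of "2 / (1 - q)"] show ?thesis by (simp add: field_simps)
  qed
  have "Cauchy a"
  proof (rule metric_CauchyI)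
    fix e :: real assume "0 < e"
    from order_tendstoD(2)[OF small this] eventually_ge_at_top[of N]
    have "eventually (\<lambda>n. 2 * (q ^ n / (1 - q)) < e \<and> N \<le> n) sequentially" by eventually_elim simp
    then obtain M where M: "2 * (q ^ M / (1 - q)) < e" "N \<le> M" by (auto simp: eventually_sequentially)
    have near: "\<bar>a m - a M\<bar> \<le> q ^ M / (1 - q)" if "M \<le> m" for m
      using step[OF M(2), of "m - M"] that by simp
    have "dist (a m) (a n) < e" if mn: "M \<le> m" "M \<le> n" for m n
      using near[OF mn(1)] near[OF mn(2)] M(1) unfolding dist_real_def by linarith
    then show "\<exists>M. \<forall>m\<ge>M. \<forall>n\<ge>M. dist (a m) (a n) < e" by blast
  qed
  then show "convergent a" by (rule Cauchy_convergent)
  assume x: "a \<longlonglongrightarrow> x" and n: "N \<le> n"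
  have "(\<lambda>k. \<bar>a (k + n) - a n\<bar>) \<longlonglongrightarrow> \<bar>x - a n\<bar>"
    using x by (intro tendsto_intros LIMSEQ_ignore_initial_segment)
  then have "\<bar>x - a n\<bar> \<le> q ^ n / (1 - q)"
    by (rule LIMSEQ_le_const2) (use step[OF n] in \<open>auto simp: add.commute\<close>)
  then show "\<bar>a n - x\<bar> \<le> q ^ n / (1 - q)" by (simp add: abs_minus_commute)
qed

text \<open>
  The vectors that decay along \<open>\<omega>\<close> form the random subspace of slow directions.
\<close>

definition decays :: "(nat \<Rightarrow> real^'m^'m) \<Rightarrow> real^'m \<Rightarrow> bool" where
  "decays \<omega> v \<longleftrightarrow> (\<lambda>n. growth_ratio (cocycle n \<omega>) v) \<longlonglongrightarrow> 0"

definition aligned :: "real \<Rightarrow> (nat \<Rightarrow> real^'m^'m) \<Rightarrow> bool" where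
  "aligned q \<omega> \<longleftrightarrow> eventually (\<lambda>n. \<forall>v. norm v = 1 \<longrightarrow>
    \<bar>(growth_ratio (cocycle (Suc n) \<omega>) v)\<^sup>2 - (growth_ratio (cocycle n \<omega>) v)\<^sup>2\<bar> \<le> q ^ n) sequentially"

lemma decays_zero: "decays \<omega> 0"
  by (simp add: decays_def growth_ratio_def)

lemma decays_scale: "decays \<omega> v \<Longrightarrow> decays \<omega> (c *\<^sub>R v)"
  unfolding decays_def growth_ratio_scale using tendsto_mult_right_zero by blast

lemma decays_scale_iff: "c \<noteq> 0 \<Longrightarrow> decays \<omega> (c *\<^sub>R v) \<longleftrightarrow> decays \<omega> v"
  using decays_scale[of \<omega> "c *\<^sub>R v" "inverse c"] decays_scale[of \<omega> v c] by auto

lemma decays_add: "decays \<omega> v \<Longrightarrow> decays \<omega> w \<Longrightarrow> decays \<omega> (v + w)"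
proof -
  assume "decays \<omega> v" "decays \<omega> w"
  then have lim: "(\<lambda>n. growth_ratio (cocycle n \<omega>) v + growth_ratio (cocycle n \<omega>) w) \<longlonglongrightarrow> 0"
    unfolding decays_def using tendsto_add by fastforce
  show ?thesis unfolding decays_def
    by (rule tendsto_sandwich[OF _ _ tendsto_const lim])
      (auto simp: growth_ratio_nonneg growth_ratio_add)
qed

text \<open>
  Only this implication is available: the matrix \<open>cocycle m \<omega>\<close> may be singular.
\<close>

lemma decays_shift:
  assumes pos: "\<And>n. 0 < opnorm (cocycle n \<omega>)" and d: "decays \<omega> v"
  shows "decays (seq_shift m \<omega>) (cocycle m \<omega> *v v)"
proof -
  define A where "A = cocycle m \<omega>"
  have lim: "(\<lambda>n. opnorm A * growth_ratio (cocycle (m + n) \<omega>) v) \<longlonglongrightarrow> 0"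
    using LIMSEQ_ignore_initial_segment[OF d[unfolded decays_def], of m]
    by (intro tendsto_mult_right_zero) (simp add: add.commute)
  have le: "growth_ratio (cocycle n (seq_shift m \<omega>)) (A *v v) \<le> opnorm A * growth_ratio (cocycle (m + n) \<omega>) v" for n
  proof -
    define B where "B = cocycle n (seq_shift m \<omega>)"
    have BA: "cocycle (m + n) \<omega> = B ** A" unfolding A_def B_def seq_shift_def by (rule cocycle_add)
    have "0 < opnorm (B ** A)" using pos[of "m + n"] by (simp add: BA)
    moreover have "opnorm (B ** A) \<le> opnorm B * opnorm A" by (rule opnorm_mult)
    moreover from calculation have "0 < opnorm B" using opnorm_nonneg[of B] by (cases "opnorm B = 0") auto
    ultimately have "1 / opnorm B \<le> opnorm A / opnorm (B ** A)" by (simp add: field_simps)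
    from mult_right_mono[OF this norm_ge_zero[of "(B ** A) *v v"]] show ?thesis
      by (simp add: growth_ratio_def BA[symmetric] B_def[symmetric]) (simp add: BA matrix_vector_mul_assoc)
  qed
  show ?thesis unfolding decays_def A_def[symmetric]
    by (rule tendsto_sandwich[OF _ _ tendsto_const lim]) (auto simp: growth_ratio_nonneg le)
qed

lemma decays_closed:
  assumes "\<And>e. 0 < e \<Longrightarrow> \<exists>w. decays \<omega> w \<and> norm (v - w) < e"
  shows "decays \<omega> v"
  unfolding decays_def
proof (rule LIMSEQ_I)
  fix r :: real assume r: "0 < r"
  then obtain w where w: "decays \<omega> w" "norm (v - w) < r / 2" using assms[of "r / 2"] by auto
  have "eventually (\<lambda>n. growth_ratio (cocycle n \<omega>) w < r / 2) sequentially"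
    using w(1) r unfolding decays_def by (intro order_tendstoD(2)) auto
  then have "eventually (\<lambda>n. norm (growth_ratio (cocycle n \<omega>) v - 0) < r) sequentially"
  proof eventually_elim
    case (elim n)
    have "growth_ratio (cocycle n \<omega>) v \<le> growth_ratio (cocycle n \<omega>) (v - w) + growth_ratio (cocycle n \<omega>) w"
      using growth_ratio_add[of "cocycle n \<omega>" "v - w" w] by simp
    then have "growth_ratio (cocycle n \<omega>) v < r"
      using elim growth_ratio_le_norm[of "cocycle n \<omega>" "v - w"] w(2) by linarith
    then show ?case using growth_ratio_nonneg[of "cocycle n \<omega>" v] by simp
  qed
  then show "\<exists>no. \<forall>n\<ge>no. norm (growth_ratio (cocycle n \<omega>) v - 0) < r" by (simp add: eventually_sequentially)
qed

text \<open>
  Along an aligned sequence, decay of the growth ratio is automatically exponential.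
\<close>

lemma decay_rate:
  assumes q: "0 < q" "q < 1" and al: "aligned q \<omega>" and v: "norm v = 1" and d: "decays \<omega> v"
  shows "eventually (\<lambda>n. (growth_ratio (cocycle n \<omega>) v)\<^sup>2 \<le> q ^ n / (1 - q)) sequentially"
proof -
  define a where "a n = (growth_ratio (cocycle n \<omega>) v)\<^sup>2" for n
  obtain N where N: "\<And>n. N \<le> n \<Longrightarrow> \<bar>a (Suc n) - a n\<bar> \<le> q ^ n"
    using al v unfolding aligned_def eventually_sequentially a_def by blast
  have "a \<longlonglongrightarrow> 0\<^sup>2" unfolding a_def using d unfolding decays_def by (intro tendsto_power)
  then have "a \<longlonglongrightarrow> 0" by simp
  have "a n \<le> q ^ n / (1 - q)" if "N \<le> n" for n
    using geometric_increments(2)[OF q N \<open>a \<longlonglongrightarrow> 0\<close> that] by simp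
  then show ?thesis unfolding a_def eventually_sequentially by blast
qed

text \<open>
  The growth ratio of \<open>v\<close> converges to a positive number, and growth ratios are 1-Lipschitz in the
  vector.
\<close>

lemma nondecay_robust:
  assumes q: "0 < q" "q < 1" and al: "aligned q \<omega>" and v: "norm v = 1" and d: "\<not> decays \<omega> v"
  obtains c where "0 < c"
    "eventually (\<lambda>n. \<forall>w. norm (v - w) < c \<longrightarrow> c \<le> growth_ratio (cocycle n \<omega>) w) sequentially"
proof -
  define a where "a n = (growth_ratio (cocycle n \<omega>) v)\<^sup>2" for n
  obtain N where N: "\<And>n. N \<le> n \<Longrightarrow> \<bar>a (Suc n) - a n\<bar> \<le> q ^ n"
    using al v unfolding aligned_def eventually_sequentially a_def by blast
  obtain x where x: "a \<longlonglongrightarrow> x" using geometric_increments(1)[OF q N] unfolding convergent_def by blast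
  have "(\<lambda>n. sqrt (a n)) \<longlonglongrightarrow> sqrt x" by (intro tendsto_real_sqrt x)
  then have r: "(\<lambda>n. growth_ratio (cocycle n \<omega>) v) \<longlonglongrightarrow> sqrt x"
    by (simp add: a_def growth_ratio_nonneg)
  have "0 \<le> sqrt x" by (rule LIMSEQ_le_const[OF r]) (simp add: growth_ratio_nonneg)
  moreover have "sqrt x \<noteq> 0" using d r unfolding decays_def by auto
  ultimately have x0: "0 < sqrt x" by simp
  define c where "c = sqrt x / 4"
  show thesis
  proof (rule that)
    show "0 < c" using x0 by (simp add: c_def)
    have "eventually (\<lambda>n. sqrt x / 2 < growth_ratio (cocycle n \<omega>) v) sequentially"
      using x0 by (intro order_tendstoD(1)[OF r]) auto
    then show "eventually (\<lambda>n. \<forall>w. norm (v - w) < c \<longrightarrow> c \<le> growth_ratio (cocycle n \<omega>) w) sequentially"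
    proof eventually_elim
      case (elim n)
      show ?case
      proof (intro allI impI)
        fix w assume w: "norm (v - w) < c"
        have "growth_ratio (cocycle n \<omega>) v \<le> growth_ratio (cocycle n \<omega>) (v - w) + growth_ratio (cocycle n \<omega>) w"
          using growth_ratio_add[of "cocycle n \<omega>" "v - w" w] by simp
        then show "c \<le> growth_ratio (cocycle n \<omega>) w"
          using elim growth_ratio_le_norm[of "cocycle n \<omega>" "v - w"] w x0 unfolding c_def by linarith
      qed
    qed
  qed
qed

lemma norm_image_le_sum_basis:
  fixes A :: "real^'m^'m"
  assumes fin: "finite B" and orth: "pairwise orthogonal B" and unit: "\<And>b. b \<in> B \<Longrightarrow> norm b = 1"
    and x: "x \<in> span B" "norm x = 1"
  shows "norm (A *v x) \<le> (\<Sum>b\<in>B. norm (A *v b))"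
proof -
  have ex: "(\<Sum>b\<in>B. (x \<bullet> b) *\<^sub>R b) = x"
    by (rule orthonormal_basis_expand[OF orth unit x(1) fin])
  have "A *v x = (\<Sum>b\<in>B. (x \<bullet> b) *\<^sub>R (A *v b))"
    using arg_cong[OF ex, of "(*v) A"] linear_sum[OF matrix_vector_mul_linear, of A "\<lambda>b. (x \<bullet> b) *\<^sub>R b" B]
    by (simp add: matrix_vector_mult_scaleR)
  also have "norm \<dots> \<le> (\<Sum>b\<in>B. norm ((x \<bullet> b) *\<^sub>R (A *v b)))" by (rule norm_sum)
  also have "\<dots> \<le> (\<Sum>b\<in>B. norm (A *v b))"
  proof (rule sum_mono)
    fix b assume "b \<in> B"
    then have "\<bar>x \<bullet> b\<bar> \<le> 1" using Cauchy_Schwarz_ineq2[of x b] unit x(2) by simp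
    then show "norm ((x \<bullet> b) *\<^sub>R (A *v b)) \<le> norm (A *v b)" by (simp add: mult_left_le_one_le)
  qed
  finally show ?thesis .
qed

lemma measurable_growth_ratio [measurable (raw)]:
  fixes f :: "'a \<Rightarrow> real^'m^'m"
  assumes [measurable]: "f \<in> borel_measurable M" "g \<in> borel_measurable M"
  shows "(\<lambda>x. growth_ratio (f x) (g x)) \<in> borel_measurable M"
  unfolding growth_ratio_def by measurable

text \<open>
  Some unit vector has growth ratio one at each time, and it is a combination of basis vectors.
\<close>

lemma slow_subspace_not_full:
  fixes \<omega> :: "nat \<Rightarrow> real^'m^'m"
  assumes pos: "\<And>n. 0 < opnorm (cocycle n \<omega>)"
  shows "\<exists>b\<in>Basis. \<not> decays \<omega> b"
proof (rule ccontr)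
  assume "\<not> ?thesis"
  then have "(\<lambda>n. \<Sum>b\<in>Basis. growth_ratio (cocycle n \<omega>) b) \<longlonglongrightarrow> (\<Sum>b\<in>(Basis :: (real^'m) set). 0)"
    by (intro tendsto_sum) (simp add: decays_def)
  then have lim: "(\<lambda>n. \<Sum>b\<in>Basis. growth_ratio (cocycle n \<omega>) b) \<longlonglongrightarrow> 0" by simp
  have "1 \<le> (\<Sum>b\<in>Basis. growth_ratio (cocycle n \<omega>) b)" for n
  proof -
    obtain e where e: "norm e = 1" "norm (cocycle n \<omega> *v e) = opnorm (cocycle n \<omega>)" by (rule opnorm_attained)
    have "norm (cocycle n \<omega> *v e) \<le> (\<Sum>b\<in>Basis. norm (cocycle n \<omega> *v b))"
      by (rule norm_image_le_sum_basis) (auto simp: pairwise_def orthogonal_def inner_Basis e span_Basis)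
    then show ?thesis using pos[of n] e
      by (simp add: growth_ratio_def sum_divide_distrib[symmetric])
  qed
  then have "1 \<le> (0::real)" by (intro LIMSEQ_le_const[OF lim]) auto
  then show False by simp
qed

lemma measurable_decays:
  assumes s: "sets \<mu> = sets borel"
  shows "{\<omega> \<in> space (iid \<mu>). decays \<omega> v} \<in> sets (iid \<mu>)"
proof -
  note [measurable] = measurable_cocycle[OF s]
  show ?thesis unfolding decays_def by measurable
qed

text \<open>
  If \<open>v\<close> decays, then its image after \<open>n\<close> steps decays along the shifted sequence, which is independent
  of the first \<open>n\<close> factors and of \<open>R\<close>.
\<close>

lemma decay_probability_le:
  fixes \<mu> :: "(real^'m^'m) measure"
  assumes mu: "\<mu> \<in> moment_class p C" and p: "0 < p" and C: "1 \<le> C" and v: "v \<noteq> 0"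
    and s: "\<And>w. w \<noteq> 0 \<Longrightarrow> emeasure (iid \<mu>) {\<omega> \<in> space (iid \<mu>). decays \<omega> w} \<le> s"
    and R: "{\<omega> \<in> space (iid \<mu>). R \<omega>} \<in> sets (iid \<mu>)" and dep: "\<And>\<omega> \<omega>'. R (comb_seq n \<omega> \<omega>') \<longleftrightarrow> R \<omega>"
  shows "emeasure (iid \<mu>) ({\<omega> \<in> space (iid \<mu>). decays \<omega> v} \<inter> {\<omega> \<in> space (iid \<mu>). R \<omega>})
    \<le> s * emeasure (iid \<mu>) {\<omega> \<in> space (iid \<mu>). R \<omega>}"
proof -
  note mu_props = moment_classD[OF mu]
  note [measurable_cong] = mu_props(2)
  note [measurable] = measurable_cocycle[OF mu_props(2)] R
  interpret sequence_space \<mu> by (rule sequence_space_prob[OF mu_props(1)])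
  let ?Q = "\<lambda>\<omega> \<eta>. R \<omega> \<and> decays \<eta> (cocycle n \<omega> *v v)"
  have Q: "{x \<in> space (S \<Otimes>\<^sub>M S). ?Q (fst x) (snd x)} \<in> sets (S \<Otimes>\<^sub>M S)"
  proof -
    have "{x \<in> space (S \<Otimes>\<^sub>M S). ?Q (fst x) (snd x)} =
      (fst -` {\<omega> \<in> space S. R \<omega>} \<inter> space (S \<Otimes>\<^sub>M S)) \<inter> {x \<in> space (S \<Otimes>\<^sub>M S). decays (snd x) (cocycle n (fst x) *v v)}"
      by (auto simp: space_pair_measure)
    moreover have "fst -` {\<omega> \<in> space S. R \<omega>} \<inter> space (S \<Otimes>\<^sub>M S) \<in> sets (S \<Otimes>\<^sub>M S)"
      by (rule measurable_sets[OF measurable_fst R])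
    moreover have "{x \<in> space (S \<Otimes>\<^sub>M S). decays (snd x) (cocycle n (fst x) *v v)} \<in> sets (S \<Otimes>\<^sub>M S)"
      unfolding decays_def by measurable
    ultimately show ?thesis by (simp only: sets.Int)
  qed
  have Q': "{\<omega> \<in> space S. ?Q \<omega> (seq_shift n \<omega>)} \<in> sets S"
  proof -
    have "(\<lambda>\<omega>. (\<omega>, seq_shift n \<omega>)) \<in> measurable S (S \<Otimes>\<^sub>M S)" by measurable
    from measurable_sets[OF this Q] show ?thesis
      by (rule back_subst[of "\<lambda>A. A \<in> sets S"])
        (auto simp: space_pair_measure measurable_space[OF measurable_shift])
  qed
  have "emeasure S ({\<omega> \<in> space S. decays \<omega> v} \<inter> {\<omega> \<in> space S. R \<omega>}) \<le> emeasure S {\<omega> \<in> space S. ?Q \<omega> (seq_shift n \<omega>)}"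
  proof (rule emeasure_mono_AE[OF _ Q'])
    show "AE \<omega> in S. \<omega> \<in> {\<omega> \<in> space S. decays \<omega> v} \<inter> {\<omega> \<in> space S. R \<omega>} \<longrightarrow> \<omega> \<in> {\<omega> \<in> space S. ?Q \<omega> (seq_shift n \<omega>)}"
      using AE_opnorm_cocycle_pos[OF mu p C] by eventually_elim (auto intro: decays_shift)
  qed
  also have "\<dots> = (\<integral>\<^sup>+ \<omega>. emeasure S {\<eta> \<in> space S. ?Q \<omega> \<eta>} \<partial>S)"
  proof (rule prob_shift_split[OF Q])
    fix \<omega> \<omega>' \<eta> :: "nat \<Rightarrow> real^'m^'m"
    have "cocycle n (comb_seq n \<omega> \<omega>') = cocycle n \<omega>" by (rule cocycle_cong) (simp add: comb_seq_def)
    then show "?Q (comb_seq n \<omega> \<omega>') \<eta> \<longleftrightarrow> ?Q \<omega> \<eta>" by (simp add: dep)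
  qed
  also have "\<dots> \<le> (\<integral>\<^sup>+ \<omega>. s * indicator {\<omega> \<in> space S. R \<omega>} \<omega> \<partial>S)"
  proof (rule nn_integral_mono_AE)
    show "AE \<omega> in S. emeasure S {\<eta> \<in> space S. ?Q \<omega> \<eta>} \<le> s * indicator {\<omega> \<in> space S. R \<omega>} \<omega>"
      using AE_cocycle_nonzero[OF mu p C v] AE_space
    proof eventually_elim
      case (elim \<omega>)
      show ?case
      proof (cases "R \<omega>")
        case True
        then show ?thesis using s[of "cocycle n \<omega> *v v"] elim by simp
      next
        case False
        then have z: "{\<eta> \<in> space S. ?Q \<omega> \<eta>} = {}" by blast
        show ?thesis unfolding z by simp
      qed
    qed
  qed
  also have "\<dots> = s * emeasure S {\<omega> \<in> space S. R \<omega>}" by (rule nn_integral_cmult_indicator[OF R])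
  finally show ?thesis .
qed

text \<open>
  If \<open>w k\<close> decays for infinitely many \<open>k\<close>, then so does the limit, because the slow vectors form a closed
  set.
\<close>

lemma decay_probability_usc:
  fixes \<mu> :: "(real^'m^'m) measure"
  assumes mu: "prob_space \<mu>" "sets \<mu> = sets borel" and lim: "w \<longlonglongrightarrow> v"
    and s: "\<And>k. s - 1 / real (Suc k) \<le> measure (iid \<mu>) {\<omega> \<in> space (iid \<mu>). decays \<omega> (w k)}"
  shows "s \<le> measure (iid \<mu>) {\<omega> \<in> space (iid \<mu>). decays \<omega> v}"
proof -
  interpret prob_space "iid \<mu>" by (rule prob_space_iid[OF mu(1)])
  define D where "D v = {\<omega> \<in> space (iid \<mu>). decays \<omega> v}" for v
  have D [measurable]: "D v \<in> sets (iid \<mu>)" for v unfolding D_def by (rule measurable_decays[OF mu(2)])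
  define U where "U n = (\<Union>k\<in>{n..}. D (w k))" for n
  have U [measurable]: "U n \<in> sets (iid \<mu>)" for n unfolding U_def by measurable
  have "decseq U" unfolding decseq_def U_def by (intro allI impI UN_mono) auto
  then have "(\<lambda>n. prob (U n)) \<longlonglongrightarrow> prob (\<Inter>n. U n)"
    by (intro finite_Lim_measure_decseq) auto
  moreover have "s \<le> prob (U n)" for n
  proof (rule field_le_epsilon)
    fix e :: real assume "0 < e"
    then obtain k where k: "1 / real (Suc k) < e" using nat_approx_posE by blast
    define j where "j = max n k"
    have "1 / real (Suc j) \<le> 1 / real (Suc k)" by (intro divide_left_mono) (auto simp: j_def)
    moreover have "D (w j) \<subseteq> U n" unfolding U_def by (rule UN_upper) (simp add: j_def)
    then have "prob (D (w j)) \<le> prob (U n)" by (intro finite_measure_mono) auto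
    ultimately show "s \<le> prob (U n) + e" using s[of j] k unfolding D_def[symmetric] by linarith
  qed
  ultimately have "s \<le> prob (\<Inter>n. U n)" by (intro LIMSEQ_le_const) auto
  also have "\<dots> \<le> prob (D v)"
  proof (intro finite_measure_mono D subsetI)
    fix \<omega> assume w: "\<omega> \<in> (\<Inter>n. U n)"
    have "decays \<omega> v"
    proof (rule decays_closed)
      fix e :: real assume "0 < e"
      then obtain N where N: "\<And>k. N \<le> k \<Longrightarrow> norm (w k - v) < e" using LIMSEQ_D[OF lim] by blast
      have "\<omega> \<in> U N" using w by blast
      then obtain k where "N \<le> k" "\<omega> \<in> D (w k)" by (auto simp: U_def)
      then show "\<exists>w. decays \<omega> w \<and> norm (v - w) < e"
        using N[of k] by (intro exI[of _ "w k"]) (auto simp: D_def norm_minus_commute)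
    qed
    moreover have "\<omega> \<in> space (iid \<mu>)" using w by (auto simp: U_def D_def)
    ultimately show "\<omega> \<in> D v" by (simp add: D_def)
  qed
  finally show ?thesis by (simp add: D_def)
qed

text \<open>
  At a maximiser, the bound for \<open>R\<close> and the bound for its complement add up to an equality, so the
  event is independent of every cylinder.
\<close>

lemma sure_decay_of_maximal_probability:
  fixes \<mu> :: "(real^'m^'m) measure"
  assumes mu: "\<mu> \<in> moment_class p C" and p: "0 < p" and C: "1 \<le> C" and v: "v \<noteq> 0"
    and pos: "0 < measure (iid \<mu>) {\<omega> \<in> space (iid \<mu>). decays \<omega> v}"
    and max: "\<And>w. w \<noteq> 0 \<Longrightarrow> measure (iid \<mu>) {\<omega> \<in> space (iid \<mu>). decays \<omega> w}
      \<le> measure (iid \<mu>) {\<omega> \<in> space (iid \<mu>). decays \<omega> v}"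
  shows "AE \<omega> in iid \<mu>. decays \<omega> v"
proof -
  note mu_props = moment_classD[OF mu]
  note [measurable_cong] = mu_props(2)
  interpret sequence_space \<mu> by (rule sequence_space_prob[OF mu_props(1)])
  define D where "D v = {\<omega> \<in> space S. decays \<omega> v}" for v
  have D [measurable]: "D v \<in> sets S" for v unfolding D_def by (rule measurable_decays[OF mu_props(2)])
  have le: "emeasure S (D v \<inter> {\<omega> \<in> space S. R \<omega>}) \<le> emeasure S (D v) * emeasure S {\<omega> \<in> space S. R \<omega>}"
    if "{\<omega> \<in> space S. R \<omega>} \<in> sets S" "\<And>\<omega> \<omega>'. R (comb_seq n \<omega> \<omega>') \<longleftrightarrow> R \<omega>" for R n
    unfolding D_def
    by (rule decay_probability_le[OF mu p C v _ that(1), of _ n])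
      (use max that(2) in \<open>simp_all add: P.emeasure_eq_measure ennreal_leI\<close>)
  have "emeasure S (D v) = 0 \<or> emeasure S (D v) = 1"
  proof (rule independent_of_cylinders_zero_one[OF D])
    fix n and A :: "nat \<Rightarrow> (real^'m^'m) set" assume A [measurable]: "\<And>i. A i \<in> sets \<mu>"
    let ?R = "\<lambda>\<omega>. \<forall>i<n. \<omega> i \<in> A i"
    let ?G = "{\<omega> \<in> space S. ?R \<omega>}" and ?H = "{\<omega> \<in> space S. \<not> ?R \<omega>}"
    have [measurable]: "?G \<in> sets S" "?H \<in> sets S" by measurable
    have dep: "?R (comb_seq n \<omega> \<omega>') \<longleftrightarrow> ?R \<omega>" for \<omega> \<omega>' by (simp add: comb_seq_def)
    have 1: "P.prob (D v \<inter> ?G) \<le> P.prob (D v) * P.prob ?G"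
      using le[of ?R n] dep by (simp add: P.emeasure_eq_measure ennreal_mult[symmetric])
    have 2: "P.prob (D v \<inter> ?H) \<le> P.prob (D v) * P.prob ?H"
      using le[of "\<lambda>\<omega>. \<not> ?R \<omega>" n] dep by (simp add: P.emeasure_eq_measure ennreal_mult[symmetric])
    have "P.prob (D v) = P.prob ((D v \<inter> ?G) \<union> (D v \<inter> ?H))"
      by (rule arg_cong[where f = P.prob]) (auto simp: D_def)
    also have "\<dots> = P.prob (D v \<inter> ?G) + P.prob (D v \<inter> ?H)"
      by (rule P.finite_measure_Union) auto
    finally have 3: "P.prob (D v) = P.prob (D v \<inter> ?G) + P.prob (D v \<inter> ?H)" .
    have "1 = P.prob (?G \<union> ?H)"
      unfolding P.prob_space[symmetric] by (rule arg_cong[where f = P.prob]) auto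
    also have "\<dots> = P.prob ?G + P.prob ?H" by (rule P.finite_measure_Union) auto
    finally have "P.prob ?H = 1 - P.prob ?G" by simp
    then have "P.prob (D v) * P.prob ?H = P.prob (D v) * (1 - P.prob ?G)" by (rule arg_cong)
    then have "P.prob (D v) * P.prob ?H = P.prob (D v) - P.prob (D v) * P.prob ?G"
      by (simp only: right_diff_distrib mult_1_right)
    then have "P.prob (D v \<inter> ?G) = P.prob (D v) * P.prob ?G" using 1 2 3 by linarith
    then show "emeasure S (D v \<inter> ?G) = emeasure S (D v) * emeasure S ?G"
      by (simp add: P.emeasure_eq_measure ennreal_mult)
  qed
  then have "P.prob (D v) = 1" using pos by (auto simp: P.emeasure_eq_measure D_def)
  then have "AE \<omega> in S. \<omega> \<in> D v" by (simp add: P.prob_eq_1)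
  then show ?thesis by eventually_elim (simp add: D_def)
qed

lemma sure_decay_invariant:
  fixes \<mu> :: "(real^'m^'m) measure"
  assumes mu: "\<mu> \<in> moment_class p C" and p: "0 < p" and C: "1 \<le> C"
    and d: "AE \<omega> in iid \<mu>. decays \<omega> w"
  shows "AE g in \<mu>. AE \<omega> in iid \<mu>. decays \<omega> (g *v w)"
proof -
  note mu_props = moment_classD[OF mu]
  note [measurable_cong] = mu_props(2)
  note [measurable] = measurable_cocycle[OF mu_props(2)]
  interpret sequence_space \<mu> by (rule sequence_space_prob[OF mu_props(1)])
  define Dc where "Dc v = {\<omega> \<in> space S. \<not> decays \<omega> v}" for v
  have Dc [measurable]: "Dc v \<in> sets S" for v
  proof -
    have "Dc v = space S - {\<omega> \<in> space S. decays \<omega> v}" by (auto simp: Dc_def)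
    then show ?thesis using measurable_decays[OF mu_props(2), of v] by simp
  qed
  let ?Q = "\<lambda>\<omega> \<eta>. \<not> decays \<eta> (\<omega> (0::nat) *v w)"
  have Q: "{x \<in> space (S \<Otimes>\<^sub>M S). ?Q (fst x) (snd x)} \<in> sets (S \<Otimes>\<^sub>M S)"
    unfolding decays_def by measurable
  have "emeasure S {\<omega> \<in> space S. ?Q \<omega> (seq_shift 1 \<omega>)} = (\<integral>\<^sup>+ \<omega>. emeasure S {\<eta> \<in> space S. ?Q \<omega> \<eta>} \<partial>S)"
    by (rule prob_shift_split[OF Q]) (simp add: comb_seq_def)
  moreover have "emeasure S {\<omega> \<in> space S. ?Q \<omega> (seq_shift 1 \<omega>)} = 0"
  proof -
    have N: "{\<omega> \<in> space S. ?Q \<omega> (seq_shift 1 \<omega>)} \<in> sets S" unfolding decays_def by measurable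
    have "AE \<omega> in S. decays (seq_shift 1 \<omega>) (\<omega> 0 *v w)"
      using d AE_opnorm_cocycle_pos[OF mu p C]
    proof eventually_elim
      case (elim \<omega>)
      then show ?case using decays_shift[of \<omega> w 1] by simp
    qed
    then show ?thesis using AE_iff_measurable[OF N, of "\<lambda>\<omega>. decays (seq_shift 1 \<omega>) (\<omega> 0 *v w)"] by simp
  qed
  ultimately have z: "(\<integral>\<^sup>+ \<omega>. emeasure S {\<eta> \<in> space S. ?Q \<omega> \<eta>} \<partial>S) = 0" by simp
  have m: "(\<lambda>g. emeasure S (Dc (g *v w))) \<in> borel_measurable \<mu>"
  proof -
    have "{x \<in> space (\<mu> \<Otimes>\<^sub>M S). \<not> decays (snd x) (fst x *v w)} \<in> sets (\<mu> \<Otimes>\<^sub>M S)"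
      unfolding decays_def by measurable
    from P.measurable_emeasure_Pair[OF this] show ?thesis
      by (rule measurable_cong[THEN iffD1, rotated])
        (auto simp: Dc_def space_pair_measure intro!: arg_cong[where f = "emeasure S"])
  qed
  have "(\<integral>\<^sup>+ g. emeasure S (Dc (g *v w)) \<partial>\<mu>) = (\<integral>\<^sup>+ g. emeasure S (Dc (g *v w)) \<partial>distr S \<mu> (\<lambda>\<omega>. \<omega> 0))"
    by (subst PiM_component) auto
  also have "\<dots> = (\<integral>\<^sup>+ \<omega>. emeasure S (Dc (\<omega> 0 *v w)) \<partial>S)"
    using m by (subst nn_integral_distr) auto
  also have "\<dots> = 0" using z by (simp add: Dc_def)
  finally have "AE g in \<mu>. emeasure S (Dc (g *v w)) = 0"
    using m by (subst (asm) nn_integral_0_iff_AE) auto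
  then show ?thesis
  proof eventually_elim
    case (elim g)
    then have "AE \<omega> in S. \<omega> \<notin> Dc (g *v w)" by (intro AE_not_in) (auto intro: null_setsI)
    with AE_space show ?case by eventually_elim (simp add: Dc_def)
  qed
qed

text \<open>
  If some vector decayed with positive probability, a vector of maximal decay probability on the sphere
  would decay almost surely. The vectors that decay almost surely form an invariant subspace \<open>E\<close>; it is
  proper, and on it the products grow exponentially slower than \<open>exp (l n)\<close>, so quasi-irreducibility
  forces \<open>E = {0}\<close>.
\<close>

lemma AE_not_decays:
  fixes \<mu> :: "(real^'m^'m) measure"
  assumes mu: "\<mu> \<in> moment_class p C" and p: "0 < p" and C: "1 \<le> C"
    and qi: "quasi_irreducible \<mu>" and l: "lyapunov1 \<mu> = ereal l"
    and lim: "AE \<omega> in iid \<mu>. (\<lambda>n. ln (opnorm (cocycle n \<omega>)) / real n) \<longlonglongrightarrow> l"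
    and q: "0 < q" "q < 1" and al: "AE \<omega> in iid \<mu>. aligned q \<omega>"
    and v: "v \<noteq> 0"
  shows "AE \<omega> in iid \<mu>. \<not> decays \<omega> v"
proof -
  note mu_props = moment_classD[OF mu]
  interpret P: prob_space "iid \<mu>" by (rule prob_space_iid[OF mu_props(1)])
  define D where "D v = {\<omega> \<in> space (iid \<mu>). decays \<omega> v}" for v
  have D [measurable]: "D v \<in> sets (iid \<mu>)" for v unfolding D_def by (rule measurable_decays[OF mu_props(2)])
  have D_scale: "D (c *\<^sub>R w) = D w" if "c \<noteq> 0" for c w using that by (simp add: D_def decays_scale_iff)
  have pos: "AE \<omega> in iid \<mu>. \<forall>n. 0 < opnorm (cocycle n \<omega>)" by (rule AE_opnorm_cocycle_pos[OF mu p C])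
  define E where "E = {w. AE \<omega> in iid \<mu>. decays \<omega> w}"
  have subE: "subspace E"
    unfolding subspace_def E_def
  proof (intro conjI ballI allI; simp)
    show "AE \<omega> in iid \<mu>. decays \<omega> 0" by (simp add: decays_zero)
    show "AE \<omega> in iid \<mu>. decays \<omega> (x + y)"
      if "AE \<omega> in iid \<mu>. decays \<omega> x" "AE \<omega> in iid \<mu>. decays \<omega> y" for x y
      using that by eventually_elim (rule decays_add)
    show "AE \<omega> in iid \<mu>. decays \<omega> (c *\<^sub>R x)" if "AE \<omega> in iid \<mu>. decays \<omega> x" for c x
      using that by eventually_elim (rule decays_scale)
  qed
  have neU: "E \<noteq> UNIV"
  proof
    assume "E = UNIV"
    then have "AE \<omega> in iid \<mu>. decays \<omega> b" for b unfolding E_def by blast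
    then have "AE \<omega> in iid \<mu>. \<forall>b\<in>Basis. decays \<omega> b" by (intro AE_finite_allI) auto
    with pos have "AE \<omega> in iid \<mu>. False"
    proof eventually_elim
      case (elim \<omega>)
      then show ?case using slow_subspace_not_full[of \<omega>] by blast
    qed
    then show False by simp
  qed
  have E0: "E = {0}"
  proof (rule ccontr)
    assume "E \<noteq> {0}"
    obtain B where B: "B \<subseteq> E" "pairwise orthogonal B" "\<And>x. x \<in> B \<Longrightarrow> norm x = 1"
      "independent B" "card B = dim E" "span B = E"
      using orthonormal_basis_subspace[OF subE] by metis
    have finB: "finite B" using B(4) by (rule independent_imp_finite)
    have "AE g in \<mu>. \<forall>b\<in>B. g *v b \<in> E"
    proof (rule AE_finite_allI[OF finB])
      fix b assume "b \<in> B"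
      then have "AE \<omega> in iid \<mu>. decays \<omega> b" using B(1) by (auto simp: E_def)
      from sure_decay_invariant[OF mu p C this] show "AE g in \<mu>. g *v b \<in> E" by (simp add: E_def)
    qed
    then have "AE g in \<mu>. (*v) g ` E \<subseteq> E"
    proof eventually_elim
      case (elim g)
      have "subspace {x. g *v x \<in> E}"
        using subE by (auto simp: subspace_def matrix_vector_right_distrib matrix_vector_mult_scaleR)
      then have "span B \<subseteq> {x. g *v x \<in> E}" using elim by (intro span_minimal) auto
      then show ?case using B(6) by auto
    qed
    then have "AE \<omega> in iid \<mu>. (\<lambda>n. elog (opnorm_on E (cocycle n \<omega>)) / ereal (real n)) \<longlonglongrightarrow> ereal l"
      using qi subE neU \<open>E \<noteq> {0}\<close> unfolding quasi_irreducible_def l by blast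
    moreover have "AE \<omega> in iid \<mu>. \<forall>b\<in>B. decays \<omega> b"
      by (rule AE_finite_allI[OF finB]) (use B(1) in \<open>auto simp: E_def\<close>)
    moreover note pos al lim
    ultimately have "AE \<omega> in iid \<mu>. False"
    proof eventually_elim
      case (elim \<omega>)
      define a where "a n = opnorm (cocycle n \<omega>)" for n
      define x where "x n = opnorm_on E (cocycle n \<omega>)" for n
      define K where "K = real (card B) * sqrt (1 / (1 - q))"
      have a: "0 < a n" for n using elim(3) by (simp add: a_def)
      have nz: "{v \<in> E. norm v = 1} \<noteq> {}"
      proof -
        obtain z where "z \<in> E" "z \<noteq> 0" using \<open>E \<noteq> {0}\<close> subspace_0[OF subE] by blast
        then have "z /\<^sub>R norm z \<in> {v \<in> E. norm v = 1}" using subE by (simp add: subspace_scale)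
        then show ?thesis by blast
      qed
      have "eventually (\<lambda>n. \<forall>b\<in>B. (growth_ratio (cocycle n \<omega>) b)\<^sup>2 \<le> q ^ n / (1 - q)) sequentially"
        using elim(2,4) B(3) by (intro eventually_ball_finite finB) (auto intro!: decay_rate[OF q])
      then have up: "eventually (\<lambda>n. x n \<le> K * a n * sqrt q ^ n) sequentially"
      proof eventually_elim
        case (elim n)
        have b: "norm (cocycle n \<omega> *v b) \<le> a n * (sqrt (1 / (1 - q)) * sqrt q ^ n)" if "b \<in> B" for b
        proof -
          have "growth_ratio (cocycle n \<omega>) b \<le> sqrt (q ^ n / (1 - q))"
            using elim that by (intro real_le_rsqrt) auto
          also have "\<dots> = sqrt (1 / (1 - q)) * sqrt q ^ n"
            by (simp add: real_sqrt_divide real_sqrt_power)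
          finally show ?thesis using a[of n] by (simp add: growth_ratio_def a_def[symmetric] field_simps)
        qed
        have "x n \<le> (\<Sum>b\<in>B. norm (cocycle n \<omega> *v b))"
          unfolding x_def opnorm_on_def
        proof (rule cSUP_least[OF nz])
          fix w assume "w \<in> {v \<in> E. norm v = 1}"
          then show "norm (cocycle n \<omega> *v w) \<le> (\<Sum>b\<in>B. norm (cocycle n \<omega> *v b))"
            using B by (intro norm_image_le_sum_basis finB) auto
        qed
        also have "\<dots> \<le> (\<Sum>b\<in>B. a n * (sqrt (1 / (1 - q)) * sqrt q ^ n))" by (intro sum_mono b)
        also have "\<dots> = K * a n * sqrt q ^ n" by (simp add: K_def)
        finally show ?case .
      qed
      \<comment> \<open>Strictly between \<open>l\<close> and the rate \<open>l + ln q / 2\<close> that holds on \<open>E\<close>.\<close>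
      define c where "c = l + ln q / 4"
      have lnq: "ln q < 0" using q by simp
      have "ereal c < ereal l" using lnq by (simp add: c_def)
      from order_tendstoD(1)[OF elim(1) this]
      have low: "eventually (\<lambda>n. ereal c < elog (x n) / ereal (real n)) sequentially" by (simp add: x_def)
      have "(\<lambda>n. ln K * (1 / real n) + ln (a n) / real n + ln q / 2) \<longlonglongrightarrow> ln K * 0 + l + ln q / 2"
        by (intro tendsto_intros lim_1_over_n elim(5)[folded a_def])
      moreover have "ln K * 0 + l + ln q / 2 < c" using lnq by (simp add: c_def)
      ultimately have "eventually (\<lambda>n. ln K * (1 / real n) + ln (a n) / real n + ln q / 2 < c) sequentially"
        by (rule order_tendstoD(2))
      from this low up eventually_gt_at_top[of 0] have "eventually (\<lambda>n::nat. False) sequentially"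
      proof eventually_elim
        case (elim n)
        have "x n \<noteq> 0"
        proof
          assume "x n = 0"
          then have "elog (x n) / ereal (real n) = -\<infinity>" using elim(4) by (simp add: elog_def)
          then show False using elim(2) by simp
        qed
        moreover have "0 \<le> x n"
        proof -
          obtain w where w: "w \<in> {v \<in> E. norm v = 1}" using nz by blast
          have "bdd_above ((\<lambda>v. norm (cocycle n \<omega> *v v)) ` {v \<in> E. norm v = 1})"
            by (rule bdd_aboveI[of _ "a n"]) (auto simp: a_def intro!: norm_image_le_unit)
          from cSUP_upper[OF w this] show ?thesis unfolding x_def opnorm_on_def
            using norm_ge_zero order_trans by blast
        qed
        ultimately have x: "0 < x n" by simp
        have sq: "0 < sqrt q ^ n" using q by simp
        have "0 < K * (a n * sqrt q ^ n)" using x elim(3) by (simp add: mult.assoc)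
        moreover have "0 < a n * sqrt q ^ n" using a[of n] sq by simp
        ultimately have K: "0 < K" by (rule zero_less_mult_pos2)
        have "ln (x n) \<le> ln (K * a n * sqrt q ^ n)" using x elim(3) by (intro ln_mono) auto
        also have "\<dots> = ln K + ln (a n) + real n * (ln q / 2)"
          using K a[of n] q sq by (simp add: ln_mult_pos ln_realpow ln_sqrt)
        finally have "ln (x n) / real n \<le> (ln K + ln (a n) + real n * (ln q / 2)) / real n"
          by (intro divide_right_mono) auto
        also have "\<dots> = ln K * (1 / real n) + ln (a n) / real n + ln q / 2"
          using elim(4) by (simp add: add_divide_distrib)
        also have "\<dots> < c" by (rule elim(1))
        finally have "ln (x n) / real n < c" .
        moreover have "c < ln (x n) / real n" using elim(2,4) x by (simp add: elog_def)
        ultimately show False by simp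
      qed
      then show False by simp
    qed
    then show False by simp
  qed
  have zero: "P.prob (D w) = 0" if w: "w \<noteq> 0" for w
  proof (rule ccontr)
    assume "P.prob (D w) \<noteq> 0"
    then have w_pos: "0 < P.prob (D w)" by (simp add: zero_less_measure_iff)
    define s where "s = (SUP z\<in>sphere 0 1. P.prob (D z))"
    have bdd: "bdd_above ((\<lambda>z. P.prob (D z)) ` sphere 0 1)"
      by (rule bdd_aboveI[of _ 1]) auto
    have le_s: "P.prob (D z) \<le> s" if "z \<noteq> 0" for z
    proof -
      have "P.prob (D (inverse (norm z) *\<^sub>R z)) \<le> s"
        unfolding s_def using that by (intro cSUP_upper bdd) simp
      then show ?thesis using that by (simp add: D_scale)
    qed
    have s_pos: "0 < s" using le_s[OF w] w_pos by linarith
    have "\<exists>z\<in>sphere 0 1. s - 1 / real (Suc k) < P.prob (D z)" for k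
    proof (rule ccontr)
      assume "\<not> ?thesis"
      moreover have "sphere (0::real^'m) 1 \<noteq> {}" using ex_unit_vector by force
      ultimately have "s \<le> s - 1 / real (Suc k)"
        by (subst (1) s_def) (intro cSUP_least, auto simp: not_less)
      then show False by simp
    qed
    then obtain z where z: "\<And>k. z k \<in> sphere 0 1" "\<And>k. s - 1 / real (Suc k) < P.prob (D (z k))" by metis
    obtain u r where u: "u \<in> sphere (0::real^'m) 1" and r: "strict_mono r" "(z \<circ> r) \<longlonglongrightarrow> u"
      using compact_sphere[of "0::real^'m" 1] z(1) unfolding compact_def by metis
    have "s \<le> P.prob (D u)"
      unfolding D_def
    proof (rule decay_probability_usc[OF mu_props(1,2) r(2)])
      fix k
      have "1 / real (Suc (r k)) \<le> 1 / real (Suc k)"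
        using seq_suble[OF r(1), of k] by (intro divide_left_mono) auto
      then show "s - 1 / real (Suc k) \<le> P.prob {\<omega> \<in> space (iid \<mu>). decays \<omega> ((z \<circ> r) k)}"
        using z(2)[of "r k"] unfolding D_def comp_def by linarith
    qed
    moreover have u0: "u \<noteq> 0" using u by auto
    ultimately have "AE \<omega> in iid \<mu>. decays \<omega> u"
      using le_s s_pos order_trans
      by (intro sure_decay_of_maximal_probability[OF mu p C]) (auto simp: D_def intro: less_le_trans order_trans)
    then have "u \<in> E" by (simp add: E_def)
    then show False using E0 u0 by simp
  qed
  have "AE \<omega> in iid \<mu>. \<omega> \<notin> D v" using zero[OF v] by (simp add: P.prob_eq_0)
  with AE_space show ?thesis by eventually_elim (simp add: D_def)
qed

text \<open>
  Otherwise there are times \<open>m k\<close> and unit vectors \<open>w k \<rightarrow> u\<close> with too small a mean. As \<open>u\<close> does not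
  decay, \<open>w k\<close> grows at rate \<open>l\<close> outside an event of vanishing probability, and on that event the
  negative moment bounds the loss.
\<close>

lemma uniform_growth:
  fixes \<mu> :: "(real^'m^'m) measure"
  assumes mu: "\<mu> \<in> moment_class p C" and p: "0 < p" and C: "1 \<le> C"
    and lim: "AE \<omega> in iid \<mu>. (\<lambda>n. ln (opnorm (cocycle n \<omega>)) / real n) \<longlonglongrightarrow> l"
    and q: "0 < q" "q < 1" and al: "AE \<omega> in iid \<mu>. aligned q \<omega>"
    and nd: "\<And>v. v \<noteq> 0 \<Longrightarrow> AE \<omega> in iid \<mu>. \<not> decays \<omega> v"
    and e: "0 < e"
  shows "\<exists>N. \<forall>n\<ge>N. \<forall>v. norm v = 1 \<longrightarrow> real n * (l - e) \<le> mean_log (law \<mu> n) v"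
proof (rule ccontr)
  assume "\<not> ?thesis"
  then have "\<forall>k. \<exists>n v. Suc k \<le> n \<and> norm v = 1 \<and> mean_log (law \<mu> n) v < real n * (l - e)"
    by (auto simp: not_le)
  then obtain n v where nv: "\<And>k. Suc k \<le> n k" "\<And>k. norm (v k) = 1"
    "\<And>k. mean_log (law \<mu> (n k)) (v k) < real (n k) * (l - e)" by metis
  note mu_props = moment_classD[OF mu]
  interpret P: prob_space "iid \<mu>" by (rule prob_space_iid[OF mu_props(1)])
  note [measurable] = measurable_cocycle[OF mu_props(2)]
  have pos: "AE \<omega> in iid \<mu>. \<forall>n. 0 < opnorm (cocycle n \<omega>)" by (rule AE_opnorm_cocycle_pos[OF mu p C])
  obtain u r where u: "u \<in> sphere (0::real^'m) 1" and r: "strict_mono r" "(v \<circ> r) \<longlonglongrightarrow> u"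
    using compact_sphere[of "0::real^'m" 1] nv(2) unfolding compact_def by (metis mem_sphere_0)
  define w where "w k = v (r k)" for k
  define m where "m k = n (r k)" for k
  have w: "w \<longlonglongrightarrow> u" using r(2) by (simp add: w_def[abs_def] comp_def)
  have w1: "norm (w k) = 1" for k using nv(2) by (simp add: w_def)
  have w0: "w k \<noteq> 0" for k using w1[of k] by auto
  have mk: "Suc k \<le> m k" for k using nv(1)[of "r k"] seq_suble[OF r(1), of k] by (simp add: m_def)
  have m_lim: "filterlim m at_top sequentially"
    by (rule filterlim_at_top_mono[OF filterlim_Suc]) (use mk in auto)
  define t where "t = l - e / 3"
  define G where "G k = {\<omega> \<in> space (iid \<mu>). ln (norm (cocycle (m k) \<omega> *v w k)) < real (m k) * t}" for k
  have G [measurable]: "G k \<in> sets (iid \<mu>)" for k unfolding G_def by measurable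
  have u0: "u \<noteq> 0" using u by auto
  have "AE \<omega> in iid \<mu>. eventually (\<lambda>k. \<omega> \<notin> G k) sequentially"
    using nd[OF u0] al lim pos
  proof eventually_elim
    case (elim \<omega>)
    obtain c where c: "0 < c" "eventually (\<lambda>n. \<forall>w. norm (u - w) < c \<longrightarrow> c \<le> growth_ratio (cocycle n \<omega>) w) sequentially"
      using nondecay_robust[OF q elim(2) _ elim(1)] u by auto
    define a where "a n = opnorm (cocycle n \<omega>)" for n
    have a: "0 < a n" for n using elim(4) by (simp add: a_def)
    have "(\<lambda>n. ln c * (1 / real n) + ln (a n) / real n) \<longlonglongrightarrow> ln c * 0 + l"
      by (intro tendsto_intros lim_1_over_n elim(3)[folded a_def])
    moreover have "t < ln c * 0 + l" using e by (simp add: t_def)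
    ultimately have "eventually (\<lambda>n. t < ln c * (1 / real n) + ln (a n) / real n) sequentially"
      by (rule order_tendstoD(1))
    then have 1: "eventually (\<lambda>k. t < ln c * (1 / real (m k)) + ln (a (m k)) / real (m k)) sequentially"
      using m_lim unfolding filterlim_iff by blast
    have 2: "eventually (\<lambda>k. \<forall>w. norm (u - w) < c \<longrightarrow> c \<le> growth_ratio (cocycle (m k) \<omega>) w) sequentially"
      using c(2) m_lim unfolding filterlim_iff by blast
    have "eventually (\<lambda>k. dist (w k) u < c) sequentially" using w c(1) by (rule tendstoD)
    from 1 2 this show ?case
    proof eventually_elim
      case (elim k)
      have mpos: "0 < real (m k)" using mk[of k] by simp
      have "norm (u - w k) < c" using elim(3) by (simp add: dist_norm norm_minus_commute)
      then have "c \<le> growth_ratio (cocycle (m k) \<omega>) (w k)" using elim(2) by blast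
      then have "c * a (m k) \<le> norm (cocycle (m k) \<omega> *v w k)"
        using a[of "m k"] by (simp add: growth_ratio_def a_def[symmetric] field_simps)
      then have "ln (c * a (m k)) \<le> ln (norm (cocycle (m k) \<omega> *v w k))" using c(1) a[of "m k"] by (intro ln_mono) auto
      then have "ln c + ln (a (m k)) \<le> ln (norm (cocycle (m k) \<omega> *v w k))"
        using c(1) a[of "m k"] by (simp add: ln_mult_pos)
      moreover have "t < (ln c + ln (a (m k))) / real (m k)" using elim(1) by (simp add: add_divide_distrib)
      then have "real (m k) * t < ln c + ln (a (m k))" using mpos by (simp add: pos_less_divide_eq mult.commute)
      ultimately show ?case by (simp add: G_def)
    qed
  qed
  then have "AE \<omega> in iid \<mu>. (\<lambda>k. indicator (G k) \<omega> :: real) \<longlonglongrightarrow> 0"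
    by eventually_elim (auto intro!: tendsto_eventually elim!: eventually_mono)
  then have "(\<lambda>k. \<integral>\<omega>. indicator (G k) \<omega> \<partial>iid \<mu>) \<longlonglongrightarrow> (\<integral>\<omega>. (0::real) \<partial>iid \<mu>)"
    by (intro integral_dominated_convergence[where w = "\<lambda>_. 1"]) (auto simp: indicator_def)
  then have G_lim: "(\<lambda>k. P.prob (G k)) \<longlonglongrightarrow> 0" by simp
  define K where "K = ln C / p"
  have K: "0 \<le> K" using C p by (simp add: K_def)
  \<comment> \<open>The loss per step on the exceptional event, up to the negative moment.\<close>
  define M where "M = \<bar>t\<bar> + K"
  have bound: "real (m k) * t - real (m k) * (M * P.prob (G k)) - 1 / p \<le> mean_log (law \<mu> (m k)) (w k)" for k
  proof -
    define Cm where "Cm = C ^ m k"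
    have Cm: "0 < Cm" using C by (simp add: Cm_def)
    note LK = law_moment_class[OF mu p C, of "m k", folded Cm_def]
    note V = vector_moment[OF LK Cm p w0]
    have I1: "integrable (iid \<mu>) (\<lambda>\<omega>. norm (cocycle (m k) \<omega> *v w k) powr -p)"
      and E1: "(\<integral>\<omega>. norm (cocycle (m k) \<omega> *v w k) powr -p \<partial>iid \<mu>) \<le> Cm"
      using V(2,3)[of k] w1[of k] by (simp_all add: integral_law[OF mu_props(2)])
    have I2: "integrable (iid \<mu>) (\<lambda>\<omega>. ln (norm (cocycle (m k) \<omega> *v w k)))"
      using integrable_ln_norm[OF LK Cm p w0] by (simp add: integral_law[OF mu_props(2)])
    have I3: "integrable (iid \<mu>) (indicator (G k) :: _ \<Rightarrow> real)" by (simp add: P.emeasure_eq_measure)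
    have "real (m k) * t - real (m k) * (M * P.prob (G k)) - 1 / p
        \<le> real (m k) * t - real (m k) * (M * P.prob (G k)) - (\<integral>\<omega>. norm (cocycle (m k) \<omega> *v w k) powr -p \<partial>iid \<mu>) / Cm / p"
    proof -
      have "(\<integral>\<omega>. norm (cocycle (m k) \<omega> *v w k) powr -p \<partial>iid \<mu>) / Cm \<le> 1" using E1 Cm by simp
      then have "(\<integral>\<omega>. norm (cocycle (m k) \<omega> *v w k) powr -p \<partial>iid \<mu>) / Cm / p \<le> 1 / p"
        using p by (intro divide_right_mono) auto
      then show ?thesis by linarith
    qed
    also have "\<dots> = (\<integral>\<omega>. real (m k) * t - real (m k) * (M * indicator (G k) \<omega>) - norm (cocycle (m k) \<omega> *v w k) powr -p / Cm / p \<partial>iid \<mu>)"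
      using I1 I3 by (simp add: P.prob_space)
    also have "\<dots> \<le> (\<integral>\<omega>. ln (norm (cocycle (m k) \<omega> *v w k)) \<partial>iid \<mu>)"
    proof (rule integral_mono_AE[OF _ I2])
      show "integrable (iid \<mu>) (\<lambda>\<omega>. real (m k) * t - real (m k) * (M * indicator (G k) \<omega>) - norm (cocycle (m k) \<omega> *v w k) powr -p / Cm / p)"
        using I1 I3 by (intro Bochner_Integration.integrable_diff integrable_mult_right integrable_divide) auto
      show "AE \<omega> in iid \<mu>. real (m k) * t - real (m k) * (M * indicator (G k) \<omega>) - norm (cocycle (m k) \<omega> *v w k) powr -p / Cm / p
          \<le> ln (norm (cocycle (m k) \<omega> *v w k))"
        using AE_cocycle_nonzero[OF mu p C w0[of k]] AE_space
      proof eventually_elim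
        case (elim \<omega>)
        define x where "x = norm (cocycle (m k) \<omega> *v w k)"
        have x: "0 < x" using elim(1) by (simp add: x_def)
        have y0: "0 \<le> x powr -p / Cm / p" using Cm p by simp
        show ?case unfolding x_def[symmetric]
        proof (cases "\<omega> \<in> G k")
          case False
          then have "real (m k) * t \<le> ln x" using elim(2) by (simp add: G_def x_def)
          then show "real (m k) * t - real (m k) * (M * indicator (G k) \<omega>) - x powr -p / Cm / p \<le> ln x"
            using False y0 by simp
        next
          case True
          have "ln (x powr -p / Cm) \<le> x powr -p / Cm" using ln_le_minus_one[of "x powr -p / Cm"] x Cm by simp
          moreover have "ln (x powr -p / Cm) = - p * ln x - real (m k) * ln C"
            using x Cm C by (simp add: ln_div ln_powr Cm_def ln_realpow)
          ultimately have "- p * ln x \<le> real (m k) * ln C + x powr -p / Cm" by linarith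
          then have "- ln x \<le> (real (m k) * ln C + x powr -p / Cm) / p" using p by (simp add: field_simps)
          then have "- ln x \<le> real (m k) * K + x powr -p / Cm / p" by (simp add: K_def add_divide_distrib)
          moreover have "real (m k) * t \<le> real (m k) * \<bar>t\<bar>" by (intro mult_left_mono) auto
          ultimately show "real (m k) * t - real (m k) * (M * indicator (G k) \<omega>) - x powr -p / Cm / p \<le> ln x"
            using True by (simp add: M_def distrib_left)
        qed
      qed
    qed
    also have "\<dots> = mean_log (law \<mu> (m k)) (w k)"
      unfolding mean_log_def by (rule integral_law(1)[OF mu_props(2), symmetric]) measurable
    finally show ?thesis .
  qed
  have "(\<lambda>k. M * P.prob (G k)) \<longlonglongrightarrow> 0" using G_lim by (rule tendsto_mult_right_zero)
  then have 1: "eventually (\<lambda>k. M * P.prob (G k) < e / 3) sequentially" using e by (intro order_tendstoD(2)) auto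
  obtain k0 :: nat where k0: "3 / (p * e) < real k0" using reals_Archimedean2 by blast
  from 1 eventually_ge_at_top[of k0] have "eventually (\<lambda>k. False) sequentially"
  proof eventually_elim
    case (elim k)
    have mp: "0 < real (m k)" using mk[of k] by simp
    have "3 / (p * e) < real (m k)" using k0 elim(2) mk[of k] by linarith
    then have "1 / p \<le> real (m k) * (e / 3)" using p e by (simp add: field_simps)
    moreover have "real (m k) * (M * P.prob (G k)) \<le> real (m k) * (e / 3)" using elim(1) by (intro mult_left_mono) auto
    ultimately have "real (m k) * t - real (m k) * (e / 3) - real (m k) * (e / 3) \<le> mean_log (law \<mu> (m k)) (w k)"
      using bound[of k] by linarith
    moreover have "real (m k) * t - real (m k) * (e / 3) - real (m k) * (e / 3) = real (m k) * (l - e)"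
      by (simp add: t_def algebra_simps)
    ultimately show False using nv(3)[of "r k"] by (simp add: m_def w_def)
  qed
  then show False by simp
qed

section \<open>Contraction on the projective space\<close>

lemma moment_class_mono:
  assumes "\<kappa> \<in> moment_class p D" "D \<le> D'"
  shows "\<kappa> \<in> moment_class p D'"
  using assms ennreal_leI[OF assms(2)] by (auto simp: moment_class_def intro: order_trans)

text \<open>
  The three terms have rates \<open>L\<close>, \<open>l\<close> and \<open>l\<close>, and \<open>L < 2 l\<close>. The time \<open>N = k m\<close> is a multiple of a block
  length \<open>m\<close> that is good for the exterior norm, and large enough for the uniform growth of vectors.
\<close>

lemma contraction_in_mean:
  fixes \<mu> :: "(real^'m^'m) measure"
  assumes mu: "\<mu> \<in> moment_class p C" and p: "0 < p" "p \<le> 1" and C: "1 \<le> C"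
    and qi: "quasi_irreducible \<mu>" and gap: "lyapunov2 \<mu> < lyapunov1 \<mu>"
  obtains N b where "1 \<le> N" "0 < b"
    "\<And>v w. norm v = 1 \<Longrightarrow> norm w = 1 \<Longrightarrow>
      (\<integral>g. ln (max (exterior_norm g) b) \<partial>law \<mu> N) - mean_log (law \<mu> N) v - mean_log (law \<mu> N) w \<le> -1"
proof -
  obtain l where l: "lyapunov1 \<mu> = ereal l" "AE \<omega> in iid \<mu>. (\<lambda>n. ln (opnorm (cocycle n \<omega>)) / real n) \<longlonglongrightarrow> l"
    by (rule lyapunov1_limit[OF mu p C])
  obtain b L where bL: "0 \<le> b" "L < 2 * l"
    "AE \<omega> in iid \<mu>. (\<lambda>n. ln (max (exterior_norm (cocycle n \<omega>)) (exp (- (b * real n)))) / real n) \<longlonglongrightarrow> L"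
    "\<And>e. 0 < e \<Longrightarrow> \<exists>m\<ge>1. \<forall>k. (\<integral>g. ln (max (exterior_norm g) (exp (- (b * real (k * m))))) \<partial>law \<mu> (k * m)) \<le> real (k * m) * (L + e)"
    by (rule exterior_growth_gap[OF mu p C gap l]) (rule that)
  define q where "q = exp (- ((2 * l - L) / 2))"
  have q: "0 < q" "q < 1" using bL(2) by (simp_all add: q_def)
  have al: "AE \<omega> in iid \<mu>. aligned q \<omega>"
    unfolding aligned_def q_def by (rule AE_alignment[OF mu p(1) C l(2) bL(3,2)])
  have nd: "AE \<omega> in iid \<mu>. \<not> decays \<omega> v" if "v \<noteq> 0" for v
    by (rule AE_not_decays[OF mu p(1) C qi l q al that])
  \<comment> \<open>With this choice \<open>(L + e) - 2 (l - e) = - 3 e\<close>.\<close>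
  define e where "e = (2 * l - L) / 6"
  have e: "0 < e" using bL(2) by (simp add: e_def)
  obtain N0 where N0: "\<And>n v. N0 \<le> n \<Longrightarrow> norm v = 1 \<Longrightarrow> real n * (l - e) \<le> mean_log (law \<mu> n) v"
    using uniform_growth[OF mu p(1) C l(2) q al nd e] by blast
  obtain m where m: "1 \<le> m" "\<And>k. (\<integral>g. ln (max (exterior_norm g) (exp (- (b * real (k * m))))) \<partial>law \<mu> (k * m)) \<le> real (k * m) * (L + e)"
    using bL(4)[OF e] by blast
  obtain k0 :: nat where k0: "1 / (3 * e) < real k0" using reals_Archimedean2 by blast
  define k where "k = max N0 k0"
  have km: "k \<le> k * m" using m(1) by simp
  have big: "1 \<le> real (k * m) * (3 * e)"
  proof -
    have "real k0 \<le> real (k * m)" using km by (simp only: of_nat_le_iff) (simp add: k_def)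
    then have "1 / (3 * e) < real (k * m)" using k0 by linarith
    then show ?thesis using e by (simp add: divide_less_eq)
  qed
  show thesis
  proof (rule that)
    have "0 < 1 / (3 * e)" using e by simp
    then have "0 < real k0" using k0 by linarith
    then have "1 \<le> k" by (auto simp: k_def)
    then show "1 \<le> k * m" using km by linarith
    show "0 < exp (- (b * real (k * m)))" by simp
    fix v w :: "real^'m" assume vw: "norm v = 1" "norm w = 1"
    have "N0 \<le> k * m" using km by (simp add: k_def)
    note N0[OF this vw(1)] N0[OF this vw(2)]
    moreover have "real (k * m) * (L + e) - real (k * m) * (l - e) - real (k * m) * (l - e) = - (real (k * m) * (3 * e))"
      by (simp add: e_def field_simps)
    ultimately show "(\<integral>g. ln (max (exterior_norm g) (exp (- (b * real (k * m))))) \<partial>law \<mu> (k * m))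
        - mean_log (law \<mu> (k * m)) v - mean_log (law \<mu> (k * m)) w \<le> -1"
      using m(2)[of k] big by linarith
  qed
qed

lemma coupled_integral_diff:
  fixes f h :: "real^'m^'m \<Rightarrow> real"
  assumes c: "\<rho> \<in> couplings \<kappa>' \<kappa>" and cost: "coupling_cost p \<rho> \<le> ennreal d" and d: "0 \<le> d"
    and f: "integrable \<kappa> f" "integrable \<kappa>' f"
    and [measurable]: "f \<in> borel_measurable borel" "h \<in> borel_measurable borel"
    and h: "integrable \<kappa> (\<lambda>g. (h g)\<^sup>2)" "(\<integral>g. (h g)\<^sup>2 \<partial>\<kappa>) \<le> H" "integrable \<kappa>' (\<lambda>g. (h g)\<^sup>2)" "(\<integral>g. (h g)\<^sup>2 \<partial>\<kappa>') \<le> H"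
    and le: "AE x in \<rho>. \<bar>f (fst x) - f (snd x)\<bar> \<le> opnorm (fst x - snd x) powr (p / 2) * (h (fst x) + h (snd x))"
    and t: "0 < t"
  shows "\<bar>(\<integral>g. f g \<partial>\<kappa>') - (\<integral>g. f g \<partial>\<kappa>)\<bar> \<le> 2 * d / t + 2 * t * H"
proof -
  note R = couplingsD[OF c]
  note [measurable_cong] = R(2)
  interpret prob_space \<rho> by (rule R)
  have m: "fst \<in> measurable \<rho> borel" "snd \<in> measurable \<rho> borel" by measurable
  note [measurable] = m
  have tr: "integrable \<rho> (\<lambda>x. F (fst x)) \<longleftrightarrow> integrable \<kappa>' F" "(\<integral>x. F (fst x) \<partial>\<rho>) = (\<integral>g. F g \<partial>\<kappa>')"
      "integrable \<rho> (\<lambda>x. F (snd x)) \<longleftrightarrow> integrable \<kappa> F" "(\<integral>x. F (snd x) \<partial>\<rho>) = (\<integral>g. F g \<partial>\<kappa>)"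
    if F: "F \<in> borel_measurable borel" for F :: "real^'m^'m \<Rightarrow> real"
    using integrable_distr_eq[OF m(1) F] integral_distr[OF m(1) F]
      integrable_distr_eq[OF m(2) F] integral_distr[OF m(2) F] unfolding R(3,4) by simp_all
  define D where "D x = opnorm (fst x - snd x) powr p" for x :: "(real^'m^'m) \<times> (real^'m^'m)"
  have Dm: "D \<in> borel_measurable \<rho>" unfolding D_def by measurable
  have intD: "integrable \<rho> D" "(\<integral>x. D x \<partial>\<rho>) \<le> d"
    using cost d unfolding coupling_cost_def D_def[symmetric]
    by (intro integrable_of_nn_integral_le Dm; simp add: D_def)+
  have fi: "integrable \<rho> (\<lambda>x. f (fst x))" "integrable \<rho> (\<lambda>x. f (snd x))" using f by (simp_all add: tr)
  have hi: "integrable \<rho> (\<lambda>x. (h (fst x))\<^sup>2)" "integrable \<rho> (\<lambda>x. (h (snd x))\<^sup>2)"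
    using h tr[of "\<lambda>g. (h g)\<^sup>2"] by simp_all
  have "\<bar>(\<integral>g. f g \<partial>\<kappa>') - (\<integral>g. f g \<partial>\<kappa>)\<bar> = \<bar>\<integral>x. f (fst x) - f (snd x) \<partial>\<rho>\<bar>"
    using fi by (simp add: tr)
  also have "\<dots> \<le> (\<integral>x. \<bar>f (fst x) - f (snd x)\<bar> \<partial>\<rho>)" by (rule integral_abs_bound)
  also have "\<dots> \<le> (\<integral>x. 2 * D x / t + t * (h (fst x))\<^sup>2 + t * (h (snd x))\<^sup>2 \<partial>\<rho>)"
  proof (rule integral_mono_AE)
    show "integrable \<rho> (\<lambda>x. \<bar>f (fst x) - f (snd x)\<bar>)" using fi by auto
    show "integrable \<rho> (\<lambda>x. 2 * D x / t + t * (h (fst x))\<^sup>2 + t * (h (snd x))\<^sup>2)"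
      using intD(1) hi by (intro Bochner_Integration.integrable_add integrable_mult_right integrable_divide)
    show "AE x in \<rho>. \<bar>f (fst x) - f (snd x)\<bar> \<le> 2 * D x / t + t * (h (fst x))\<^sup>2 + t * (h (snd x))\<^sup>2"
      using le
    proof eventually_elim
      case (elim x)
      define y where "y = opnorm (fst x - snd x) powr (p / 2)"
      have y2: "y\<^sup>2 = D x" by (simp add: y_def D_def power2_eq_square powr_add[symmetric])
      have "y * (h (fst x) + h (snd x)) \<le> (y\<^sup>2 / t + t * (h (fst x))\<^sup>2) + (y\<^sup>2 / t + t * (h (snd x))\<^sup>2)"
        unfolding distrib_left by (intro add_mono scaled_amgm t)
      then show ?case using elim unfolding y2 y_def[symmetric] by (simp add: add_divide_distrib)
    qed
  qed
  also have "\<dots> = 2 * (\<integral>x. D x \<partial>\<rho>) / t + t * (\<integral>g. (h g)\<^sup>2 \<partial>\<kappa>') + t * (\<integral>g. (h g)\<^sup>2 \<partial>\<kappa>)"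
    using intD(1) hi tr[of "\<lambda>g. (h g)\<^sup>2"] by simp
  also have "\<dots> \<le> 2 * d / t + t * H + t * H"
    using intD(2) h t by (intro add_mono divide_right_mono mult_left_mono) auto
  finally show ?thesis by (simp add: algebra_simps)
qed

lemma couplings_AE:
  assumes c: "\<rho> \<in> couplings \<kappa>' \<kappa>"
  shows "AE g in \<kappa>'. P g \<Longrightarrow> AE x in \<rho>. P (fst x)" "AE g in \<kappa>. P g \<Longrightarrow> AE x in \<rho>. P (snd x)"
proof -
  note R = couplingsD[OF c]
  note [measurable_cong] = R(2)
  have m: "fst \<in> measurable \<rho> borel" "snd \<in> measurable \<rho> borel" by measurable
  show "AE g in \<kappa>'. P g \<Longrightarrow> AE x in \<rho>. P (fst x)"
    using AE_distrD[OF m(1), of P] unfolding R(3) .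
  show "AE g in \<kappa>. P g \<Longrightarrow> AE x in \<rho>. P (snd x)"
    using AE_distrD[OF m(2), of P] unfolding R(4) .
qed

lemma mean_log_coupling:
  fixes \<kappa> :: "(real^'m^'m) measure"
  assumes k: "\<kappa> \<in> moment_class p D" "\<kappa>' \<in> moment_class p D" and D: "0 < D" and p: "0 < p" "p \<le> 1"
    and c: "\<rho> \<in> couplings \<kappa>' \<kappa>" and cost: "coupling_cost p \<rho> \<le> ennreal d" and d: "0 \<le> d" and t: "0 < t"
    and v: "norm v = 1"
  shows "\<bar>mean_log \<kappa>' v - mean_log \<kappa> v\<bar> \<le> 2 * d / t + 2 * t * (D * (2 / p)\<^sup>2)"
proof -
  have v0: "v \<noteq> 0" using v by auto
  define h where "h = (\<lambda>g::real^'m^'m. norm (g *v v) powr -(p/2) * (2 / p))"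
  have h2: "(h g)\<^sup>2 = norm (g *v v) powr -p * (2 / p)\<^sup>2" for g
    by (simp add: h_def power_mult_distrib power2_eq_square powr_add[symmetric])
  have hk: "integrable \<kappa> (\<lambda>g. (h g)\<^sup>2)" "(\<integral>g. (h g)\<^sup>2 \<partial>\<kappa>) \<le> D * (2 / p)\<^sup>2" if k: "\<kappa> \<in> moment_class p D" for \<kappa>
    using vector_moment(2,3)[OF k D p(1) v0] v unfolding h2
    by (simp_all add: mult_right_mono)
  show ?thesis unfolding mean_log_def
  proof (rule coupled_integral_diff[OF c cost d, of _ h])
    show "integrable \<kappa> (\<lambda>g. ln (norm (g *v v)))" "integrable \<kappa>' (\<lambda>g. ln (norm (g *v v)))"
      by (rule integrable_ln_norm[OF _ D p(1) v0], fact)+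
    show "(\<lambda>g::real^'m^'m. ln (norm (g *v v))) \<in> borel_measurable borel" "h \<in> borel_measurable borel"
      unfolding h_def by measurable
    show "AE x in \<rho>. \<bar>ln (norm (fst x *v v)) - ln (norm (snd x *v v))\<bar>
        \<le> opnorm (fst x - snd x) powr (p / 2) * (h (fst x) + h (snd x))"
      using couplings_AE(1)[OF c vector_moment(1)[OF k(2) D p(1) v0]]
        couplings_AE(2)[OF c vector_moment(1)[OF k(1) D p(1) v0]]
    proof eventually_elim
      case (elim x)
      let ?a = "norm (fst x *v v)" and ?b = "norm (snd x *v v)"
      have "\<bar>?a - ?b\<bar> \<le> norm ((fst x - snd x) *v v)"
        unfolding matrix_vector_mult_diff_rdistrib by (rule norm_triangle_ineq3)
      also have "\<dots> \<le> opnorm (fst x - snd x)" using norm_mult_le_opnorm[of "fst x - snd x" v] v by simp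
      finally have "\<bar>?a - ?b\<bar> powr (p/2) \<le> opnorm (fst x - snd x) powr (p/2)" using p by (intro powr_mono2) auto
      moreover have "\<bar>ln ?a - ln ?b\<bar> \<le> \<bar>?a - ?b\<bar> powr (p/2) * (?a powr -(p/2) + ?b powr -(p/2)) / (p/2)"
        using elim p by (intro ln_diff_le) auto
      moreover have "\<dots> = \<bar>?a - ?b\<bar> powr (p/2) * (h (fst x) + h (snd x))"
        by (simp add: h_def distrib_left distrib_right add_divide_distrib mult.assoc)
      moreover have "0 \<le> h (fst x) + h (snd x)" using p by (simp add: h_def)
      ultimately show ?case using mult_right_mono by fastforce
    qed
  qed (use hk k t in auto)
qed

lemma integrable_truncated_exterior:
  fixes \<kappa> :: "(real^'m^'m) measure" and g :: "real^'m^'m"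
  assumes k: "\<kappa> \<in> moment_class p D" and D: "0 < D" and p: "0 < p" and b: "0 < b"
  shows "integrable \<kappa> (\<lambda>g. ln (max (exterior_norm g) b))"
    and "max (exterior_norm g) b powr (p/2) \<le> opnorm g powr p + b powr (p/2)"
    and "max (exterior_norm g) b powr -(p/2) \<le> b powr -(p/2)"
proof -
  note [measurable_cong] = moment_classD(2)[OF k]
  interpret prob_space \<kappa> by (rule moment_classD(1)[OF k])
  have up: "max (exterior_norm g) b powr (p/2) \<le> opnorm g powr p + b powr (p/2)" for g :: "real^'m^'m"
  proof -
    have "((opnorm g)\<^sup>2) powr (p/2) = opnorm g powr p"
      using opnorm_nonneg[of g] p by (cases "opnorm g = 0") (simp_all add: powr_powr flip: powr_numeral)
    moreover have "exterior_norm g powr (p/2) \<le> ((opnorm g)\<^sup>2) powr (p/2)"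
      using p by (intro powr_mono2 exterior_norm_le exterior_norm_nonneg) auto
    ultimately have "exterior_norm g powr (p/2) \<le> opnorm g powr p" by simp
    then show ?thesis by (auto simp: max_def add_increasing add_increasing2)
  qed
  have low: "max (exterior_norm g) b powr -(p/2) \<le> b powr -(p/2)" for g :: "real^'m^'m"
    using b p by (intro powr_mono2') auto
  show "integrable \<kappa> (\<lambda>g. ln (max (exterior_norm g) b))"
  proof (rule Bochner_Integration.integrable_bound)
    show "integrable \<kappa> (\<lambda>g. (opnorm g powr p + b powr (p/2) + b powr -(p/2)) / (p/2))"
      using D by (intro integrable_divide Bochner_Integration.integrable_add opnorm_moment(1)[OF k]) auto
    show "AE g in \<kappa>. norm (ln (max (exterior_norm g) b)) \<le> norm ((opnorm g powr p + b powr (p/2) + b powr -(p/2)) / (p/2))"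
    proof (intro AE_I2)
      fix g :: "real^'m^'m"
      have "\<bar>ln (max (exterior_norm g) b)\<bar> \<le> (max (exterior_norm g) b powr (p/2) + max (exterior_norm g) b powr -(p/2)) / (p/2)"
        using b p by (intro abs_ln_le) (auto simp: less_max_iff_disj)
      also have "\<dots> \<le> (opnorm g powr p + b powr (p/2) + b powr -(p/2)) / (p/2)"
        using up[of g] low[of g] p by (intro divide_right_mono add_mono) auto
      finally have "\<bar>ln (max (exterior_norm g) b)\<bar> \<le> (opnorm g powr p + b powr (p/2) + b powr -(p/2)) / (p/2)" .
      moreover have "0 \<le> (opnorm g powr p + b powr (p/2) + b powr -(p/2)) / (p/2)" using p by simp
      ultimately show "norm (ln (max (exterior_norm g) b)) \<le> norm ((opnorm g powr p + b powr (p/2) + b powr -(p/2)) / (p/2))"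
        by (simp only: real_norm_def abs_of_nonneg)
    qed
  qed measurable
  show "max (exterior_norm g) b powr (p/2) \<le> opnorm g powr p + b powr (p/2)" by (rule up)
  show "max (exterior_norm g) b powr -(p/2) \<le> b powr -(p/2)" by (rule low)
qed

lemma exterior_coupling:
  fixes \<kappa> :: "(real^'m^'m) measure"
  assumes k: "\<kappa> \<in> moment_class p D" "\<kappa>' \<in> moment_class p D" and D: "0 < D" and p: "0 < p" "p \<le> 1"
    and c: "\<rho> \<in> couplings \<kappa>' \<kappa>" and cost: "coupling_cost p \<rho> \<le> ennreal d" and d: "0 \<le> d" and t: "0 < t"
    and b: "0 < b"
  shows "\<bar>(\<integral>g. ln (max (exterior_norm g) b) \<partial>\<kappa>') - (\<integral>g. ln (max (exterior_norm g) b) \<partial>\<kappa>)\<bar>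
    \<le> 2 * d / t + 2 * t * (D * (4 * b powr -(p/2) / p)\<^sup>2)"
proof -
  define B where "B = 4 * b powr -(p/2) / p"
  define h where "h = (\<lambda>g::real^'m^'m. opnorm g powr (p/2) * B)"
  have B: "0 \<le> B" using p by (simp add: B_def)
  have h2: "(h g)\<^sup>2 = opnorm g powr p * B\<^sup>2" for g
    by (simp add: h_def power_mult_distrib power2_eq_square powr_add[symmetric])
  have hk: "integrable \<kappa> (\<lambda>g. (h g)\<^sup>2)" "(\<integral>g. (h g)\<^sup>2 \<partial>\<kappa>) \<le> D * B\<^sup>2" if k: "\<kappa> \<in> moment_class p D" for \<kappa>
    using opnorm_moment[OF k] D unfolding h2
    by (simp_all add: mult_right_mono)
  show ?thesis unfolding B_def[symmetric]
  proof (rule coupled_integral_diff[OF c cost d, of _ h])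
    show "integrable \<kappa> (\<lambda>g. ln (max (exterior_norm g) b))" "integrable \<kappa>' (\<lambda>g. ln (max (exterior_norm g) b))"
      by (rule integrable_truncated_exterior(1)[OF _ D p(1) b], fact)+
    show "(\<lambda>g::real^'m^'m. ln (max (exterior_norm g) b)) \<in> borel_measurable borel" "h \<in> borel_measurable borel"
      unfolding h_def by measurable
    show "AE x in \<rho>. \<bar>ln (max (exterior_norm (fst x)) b) - ln (max (exterior_norm (snd x)) b)\<bar>
        \<le> opnorm (fst x - snd x) powr (p / 2) * (h (fst x) + h (snd x))"
    proof (intro AE_I2)
      fix x :: "(real^'m^'m) \<times> (real^'m^'m)"
      let ?a = "max (exterior_norm (fst x)) b" and ?b = "max (exterior_norm (snd x)) b"
      let ?d = "opnorm (fst x - snd x)"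
      have pos: "0 < ?a" "0 < ?b" using b by (auto simp: less_max_iff_disj)
      have "\<bar>?a - ?b\<bar> \<le> \<bar>exterior_norm (fst x) - exterior_norm (snd x)\<bar>" by (auto simp: max_def)
      also have "\<dots> \<le> ?d * (opnorm (fst x) + opnorm (snd x))" by (rule exterior_norm_diff)
      finally have "\<bar>?a - ?b\<bar> powr (p/2) \<le> (?d * (opnorm (fst x) + opnorm (snd x))) powr (p/2)"
        using p by (intro powr_mono2) auto
      also have "\<dots> = ?d powr (p/2) * (opnorm (fst x) + opnorm (snd x)) powr (p/2)"
        by (simp add: powr_mult opnorm_nonneg)
      also have "(opnorm (fst x) + opnorm (snd x)) powr (p/2) \<le> opnorm (fst x) powr (p/2) + opnorm (snd x) powr (p/2)"
        using p by (intro powr_subadditive opnorm_nonneg) auto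
      finally have 1: "\<bar>?a - ?b\<bar> powr (p/2) \<le> ?d powr (p/2) * (opnorm (fst x) powr (p/2) + opnorm (snd x) powr (p/2))"
        by (simp add: mult_left_mono)
      have "(?a powr -(p/2) + ?b powr -(p/2)) / (p/2) \<le> (b powr -(p/2) + b powr -(p/2)) / (p/2)"
        using p by (intro divide_right_mono add_mono integrable_truncated_exterior(3)[OF k(1) D p(1) b]) auto
      also have "\<dots> = B" by (simp add: B_def field_simps)
      finally have 2: "(?a powr -(p/2) + ?b powr -(p/2)) / (p/2) \<le> B" .
      have "\<bar>ln ?a - ln ?b\<bar> \<le> \<bar>?a - ?b\<bar> powr (p/2) * ((?a powr -(p/2) + ?b powr -(p/2)) / (p/2))"
        unfolding times_divide_eq_right using p by (intro ln_diff_le pos) auto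
      also have "\<dots> \<le> ?d powr (p/2) * (opnorm (fst x) powr (p/2) + opnorm (snd x) powr (p/2)) * B"
        using p by (intro mult_mono 1 2) auto
      also have "\<dots> = ?d powr (p / 2) * (h (fst x) + h (snd x))" by (simp add: h_def algebra_simps)
      finally show "\<bar>ln ?a - ln ?b\<bar> \<le> ?d powr (p / 2) * (h (fst x) + h (snd x))" .
    qed
  qed (use hk k t in auto)
qed

text \<open>
  The scale \<open>t\<close> makes the moment terms small, and then \<open>d\<close> makes the transport terms small.
\<close>

lemma contraction_in_mean_stable:
  fixes \<kappa> :: "(real^'m^'m) measure"
  assumes k: "\<kappa> \<in> moment_class p D" and D: "0 < D" and p: "0 < p" "p \<le> 1" and b: "0 < b"
    and con: "\<And>v w. norm v = 1 \<Longrightarrow> norm w = 1 \<Longrightarrow>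
      (\<integral>g. ln (max (exterior_norm g) b) \<partial>\<kappa>) - mean_log \<kappa> v - mean_log \<kappa> w \<le> -1"
  obtains d where "0 < d"
    "\<And>\<kappa>' \<rho> v w. \<kappa>' \<in> moment_class p D \<Longrightarrow> \<rho> \<in> couplings \<kappa>' \<kappa> \<Longrightarrow> coupling_cost p \<rho> \<le> ennreal d \<Longrightarrow>
      norm v = 1 \<Longrightarrow> norm w = 1 \<Longrightarrow>
      (\<integral>g. ln (max (exterior_norm g) b) \<partial>\<kappa>') - mean_log \<kappa>' v - mean_log \<kappa>' w \<le> -1/2"
proof -
  define H1 where "H1 = D * (2 / p)\<^sup>2"
  define H2 where "H2 = D * (4 * b powr -(p/2) / p)\<^sup>2"
  have H: "0 \<le> H1" "0 \<le> H2" using D by (simp_all add: H1_def H2_def)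
  define t where "t = 1 / (16 * (H1 + H2 + 1))"
  have t: "0 < t" using H by (simp add: t_def)
  define d where "d = t / 24"
  have d: "0 < d" "0 \<le> d" using t by (simp_all add: d_def)
  have dt: "2 * d / t = 1 / 12" using t by (simp add: d_def)
  have tH: "2 * t * (2 * H1 + H2) \<le> 1 / 4"
  proof -
    have "t * (H1 + H2 + 1) = 1 / 16" using H by (simp add: t_def)
    moreover have "t * (2 * H1 + H2) \<le> t * (2 * (H1 + H2 + 1))" using H t by (intro mult_left_mono) auto
    ultimately show ?thesis by (simp add: algebra_simps)
  qed
  show thesis
  proof (rule that[OF d(1)])
    fix \<kappa>' :: "(real^'m^'m) measure" and \<rho> and v w :: "real^'m"
    assume k': "\<kappa>' \<in> moment_class p D" and c: "\<rho> \<in> couplings \<kappa>' \<kappa>" and cost: "coupling_cost p \<rho> \<le> ennreal d"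
      and vw: "norm v = 1" "norm w = 1"
    note abs_le_D2[OF mean_log_coupling[OF k k' D p c cost d(2) t vw(1), folded H1_def]]
      abs_le_D2[OF mean_log_coupling[OF k k' D p c cost d(2) t vw(2), folded H1_def]]
      abs_le_D1[OF exterior_coupling[OF k k' D p c cost d(2) t b, folded H2_def]]
    moreover have "2 * t * (2 * H1 + H2) = 2 * t * H1 + 2 * t * H1 + 2 * t * H2" by (simp add: algebra_simps)
    ultimately show "(\<integral>g. ln (max (exterior_norm g) b) \<partial>\<kappa>') - mean_log \<kappa>' v - mean_log \<kappa>' w \<le> -1/2"
      using con[OF vw] tH dt by linarith
  qed
qed

text \<open>
  The sine of the angle between two lines, the metric on the projective space used below.
\<close>

definition sine :: "real^'m \<Rightarrow> real^'m \<Rightarrow> real" where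
  "sine x y = area x y / (norm x * norm y)"

lemma sine_nonneg: "0 \<le> sine x y"
  by (simp add: sine_def area_nonneg)

lemma sine_le_1: "sine x y \<le> 1"
  using area_le[of x y] by (auto simp: sine_def divide_le_eq_1)

lemma area_scale: "area (c *\<^sub>R x) (d *\<^sub>R y) = \<bar>c * d\<bar> * area x y"
proof -
  have "(norm (c *\<^sub>R x))\<^sup>2 * (norm (d *\<^sub>R y))\<^sup>2 - ((c *\<^sub>R x) \<bullet> (d *\<^sub>R y))\<^sup>2
    = (c * d)\<^sup>2 * ((norm x)\<^sup>2 * (norm y)\<^sup>2 - (x \<bullet> y)\<^sup>2)"
    by (simp add: power_mult_distrib algebra_simps)
  then show ?thesis unfolding area_def by (simp add: real_sqrt_mult)
qed

lemma sine_direction: "x \<noteq> 0 \<Longrightarrow> y \<noteq> 0 \<Longrightarrow> sine (x /\<^sub>R norm x) (y /\<^sub>R norm y) = sine x y"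
  by (simp add: sine_def area_scale abs_mult field_simps)

lemma borel_measurable_sine [measurable (raw)]:
  fixes f g :: "'a \<Rightarrow> real^'m"
  assumes [measurable]: "f \<in> borel_measurable M" "g \<in> borel_measurable M"
  shows "(\<lambda>x. sine (f x) (g x)) \<in> borel_measurable M"
  unfolding sine_def area_def by measurable

lemma mult3_le_cubes: "x * y * z \<le> x ^ 3 + y ^ 3 + z ^ 3"
  if "0 \<le> x" "0 \<le> y" "0 \<le> z" for x y z :: real
proof -
  define m where "m = max x (max y z)"
  have m: "x \<le> m" "y \<le> m" "z \<le> m" "0 \<le> m" using that by (auto simp: m_def)
  have "x * y * z \<le> m * m * m" using that m by (intro mult_mono) auto
  also have "\<dots> = m ^ 3" by (simp add: power3_eq_cube)
  also have "\<dots> \<le> x ^ 3 + y ^ 3 + z ^ 3"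
    using that zero_le_power[of x 3] zero_le_power[of y 3] zero_le_power[of z 3] by (auto simp: m_def max_def)
  finally show ?thesis .
qed

lemma exp_ln_norm_moment:
  assumes k: "\<kappa> \<in> moment_class p D" and D: "0 < D" and p: "0 < p" and v: "norm v = 1"
  shows "AE g in \<kappa>. exp (p * \<bar>ln (norm (g *v v))\<bar>) \<le> opnorm g powr p + norm (g *v v) powr -p"
    and "AE g in \<kappa>. exp (p / 2 * \<bar>ln (norm (g *v v))\<bar>) \<le> 2 + opnorm g powr p + norm (g *v v) powr -p"
proof -
  have v0: "v \<noteq> 0" using v by auto
  have le: "norm (g *v v) powr p \<le> opnorm g powr p" for g
    using norm_mult_le_opnorm[of g v] v p by (intro powr_mono2) auto
  show "AE g in \<kappa>. exp (p * \<bar>ln (norm (g *v v))\<bar>) \<le> opnorm g powr p + norm (g *v v) powr -p"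
    using vector_moment(1)[OF k D p v0]
  proof eventually_elim
    case (elim g)
    then show ?case using exp_abs_ln_le[of "norm (g *v v)" p] p le[of g] by simp
  qed
  show "AE g in \<kappa>. exp (p / 2 * \<bar>ln (norm (g *v v))\<bar>) \<le> 2 + opnorm g powr p + norm (g *v v) powr -p"
    using vector_moment(1)[OF k D p v0]
  proof eventually_elim
    case (elim g)
    let ?x = "norm (g *v v)"
    have "?x powr (p/2) \<le> 1 + ?x powr p" using p by (intro powr_sum_mono) auto
    moreover have "?x powr -(p/2) \<le> 1 + ?x powr -p"
      using powr_sum_mono[of "1 / ?x" "p/2" p] p elim by (simp add: powr_divide powr_minus_divide)
    moreover have "exp (p / 2 * \<bar>ln ?x\<bar>) \<le> ?x powr (p/2) + ?x powr -(p/2)"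
      using elim p by (intro exp_abs_ln_le) auto
    ultimately show ?case using le[of g] by linarith
  qed
qed

text \<open>
  The sine is multiplied by at most \<open>exp Z\<close> with \<open>E Z \<le> -1/2\<close>, and \<open>E (exp (a Z)) \<le> 1 + a E Z + O(a\<^sup>2)\<close>, where
  the constant depends only on \<open>p\<close>, \<open>D\<close> and \<open>b\<close>. The exponent \<open>p / 12\<close> leaves room for the product of the
  three exponential moments, which is split into cubes.
\<close>

lemma sine_contraction:
  fixes p D b :: real
  assumes D: "0 < D" and p: "0 < p" "p \<le> 1" and b: "0 < b"
  obtains a where "0 < a" "a \<le> p / 12"
    "\<And>(\<kappa> :: (real^'m^'m) measure) v w. \<kappa> \<in> moment_class p D \<Longrightarrow>
      (\<integral>g. ln (max (exterior_norm g) b) \<partial>\<kappa>) - mean_log \<kappa> v - mean_log \<kappa> w \<le> -1/2 \<Longrightarrow>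
      norm v = 1 \<Longrightarrow> norm w = 1 \<Longrightarrow>
      integrable \<kappa> (\<lambda>g. sine (g *v v) (g *v w) powr a) \<and>
      (\<integral>g. sine (g *v v) (g *v w) powr a \<partial>\<kappa>) \<le> (1 - a / 4) * sine v w powr a"
proof -
  define s where "s = p / 12"
  have s: "0 < s" using p by (simp add: s_def)
  define B0 where "B0 = D + (b powr (p/2) + b powr -(p/2)) + 2 * (2 + D + D)"
  have B0: "0 < B0" using D b by (simp add: B0_def add_pos_nonneg)
  define B where "B = 2 / s\<^sup>2 * B0"
  have B: "0 < B" using B0 s by (simp add: B_def)
  \<comment> \<open>The quadratic term \<open>a\<^sup>2 B\<close> takes back at most half of the gain \<open>a / 2\<close>.\<close>
  define a where "a = min s (1 / (4 * B))"
  have a: "0 < a" "a \<le> s" "a * B \<le> 1 / 4"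
    using s B by (auto simp: a_def min_def field_simps)
  show thesis
  proof (rule that[OF a(1)])
    show "a \<le> p / 12" using a(2) by (simp add: s_def)
    fix \<kappa> :: "(real^'m^'m) measure" and v w :: "real^'m"
    assume k: "\<kappa> \<in> moment_class p D" and vw: "norm v = 1" "norm w = 1"
      and con: "(\<integral>g. ln (max (exterior_norm g) b) \<partial>\<kappa>) - mean_log \<kappa> v - mean_log \<kappa> w \<le> -1/2"
    have v0: "v \<noteq> 0" "w \<noteq> 0" using vw by auto
    interpret prob_space \<kappa> by (rule moment_classD(1)[OF k])
    note [measurable_cong] = moment_classD(2)[OF k]
    note V = vector_moment[OF k D p(1) v0(1)] and W = vector_moment[OF k D p(1) v0(2)]
    note O = opnorm_moment[OF k less_imp_le[OF D]]
    note X = integrable_truncated_exterior[OF k D p(1) b]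
    define Z where "Z g = ln (max (exterior_norm g) b) - ln (norm (g *v v)) - ln (norm (g *v w))" for g
    have Zm [measurable]: "Z \<in> borel_measurable \<kappa>" unfolding Z_def by measurable
    have Zi: "integrable \<kappa> Z" unfolding Z_def
      by (intro Bochner_Integration.integrable_diff X(1) integrable_ln_norm[OF k D p(1)] v0)
    have EZ: "(\<integral>g. Z g \<partial>\<kappa>) \<le> -1/2"
      using con unfolding Z_def mean_log_def
      by (simp add: X(1) integrable_ln_norm[OF k D p(1)] v0)
    define R where "R g = (opnorm g powr p + b powr (p/2) + b powr -(p/2)) +
      (2 + opnorm g powr p + norm (g *v v) powr -p) + (2 + opnorm g powr p + norm (g *v w) powr -p)" for g
    have Ri: "integrable \<kappa> R" unfolding R_def
      by (intro Bochner_Integration.integrable_add O V W) auto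
    have ER: "(\<integral>g. R g \<partial>\<kappa>) \<le> B0"
    proof -
      have "(\<integral>g. R g \<partial>\<kappa>) = ((\<integral>g. opnorm g powr p \<partial>\<kappa>) + b powr (p/2) + b powr -(p/2)) +
        (2 + (\<integral>g. opnorm g powr p \<partial>\<kappa>) + (\<integral>g. norm (g *v v) powr -p \<partial>\<kappa>)) +
        (2 + (\<integral>g. opnorm g powr p \<partial>\<kappa>) + (\<integral>g. norm (g *v w) powr -p \<partial>\<kappa>))"
        unfolding R_def by (simp add: O V W prob_space)
      then show ?thesis using O(2) V(3) W(3) vw by (simp add: B0_def)
    qed
    have Zb: "AE g in \<kappa>. (Z g)\<^sup>2 * exp (s * \<bar>Z g\<bar>) \<le> 2 / s\<^sup>2 * R g"
      using exp_ln_norm_moment(2)[OF k D p(1) vw(1)] exp_ln_norm_moment(2)[OF k D p(1) vw(2)]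
    proof eventually_elim
      case (elim g)
      let ?A = "\<bar>ln (max (exterior_norm g) b)\<bar>" and ?B = "\<bar>ln (norm (g *v v))\<bar>" and ?C = "\<bar>ln (norm (g *v w))\<bar>"
      have A: "exp (p / 2 * ?A) \<le> opnorm g powr p + b powr (p/2) + b powr -(p/2)"
      proof -
        have "exp (p / 2 * ?A) \<le> max (exterior_norm g) b powr (p/2) + max (exterior_norm g) b powr -(p/2)"
          using b p by (intro exp_abs_ln_le) (auto simp: less_max_iff_disj)
        then show ?thesis using X(2)[of g] X(3)[of g] by linarith
      qed
      have "\<bar>Z g\<bar> \<le> ?A + ?B + ?C" unfolding Z_def by linarith
      then have "exp (2 * s * \<bar>Z g\<bar>) \<le> exp (2 * s * (?A + ?B + ?C))" using s by simp
      also have "\<dots> = exp (2 * s * ?A) * exp (2 * s * ?B) * exp (2 * s * ?C)"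
        by (simp add: exp_add[symmetric] distrib_left)
      also have "\<dots> \<le> exp (2 * s * ?A) ^ 3 + exp (2 * s * ?B) ^ 3 + exp (2 * s * ?C) ^ 3"
        by (rule mult3_le_cubes) auto
      also have "\<dots> = exp (p / 2 * ?A) + exp (p / 2 * ?B) + exp (p / 2 * ?C)"
        by (simp add: exp_of_nat_mult[symmetric] s_def)
      also have "\<dots> \<le> R g" using A elim by (simp add: R_def)
      finally have 1: "exp (2 * s * \<bar>Z g\<bar>) \<le> R g" .
      have "(Z g)\<^sup>2 * exp (s * \<bar>Z g\<bar>) \<le> (2 / s\<^sup>2 * exp (s * \<bar>Z g\<bar>)) * exp (s * \<bar>Z g\<bar>)"
        by (intro mult_right_mono square_le_exp s) auto
      also have "\<dots> = 2 / s\<^sup>2 * exp (2 * s * \<bar>Z g\<bar>)" by (simp add: exp_add[symmetric])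
      also have "\<dots> \<le> 2 / s\<^sup>2 * R g" using 1 by (intro mult_left_mono) auto
      finally show ?case .
    qed
    define U where "U g = 1 + a * Z g + a\<^sup>2 * (2 / s\<^sup>2 * R g)" for g
    have Ui: "integrable \<kappa> U" unfolding U_def
      by (intro Bochner_Integration.integrable_add integrable_mult_right Zi Ri) auto
    have EU: "(\<integral>g. U g \<partial>\<kappa>) \<le> 1 - a / 4"
    proof -
      have "(\<integral>g. U g \<partial>\<kappa>) = 1 + a * (\<integral>g. Z g \<partial>\<kappa>) + a\<^sup>2 * (2 / s\<^sup>2 * (\<integral>g. R g \<partial>\<kappa>))"
        unfolding U_def by (simp add: Zi Ri prob_space)
      also have "\<dots> \<le> 1 + a * (-1/2) + a\<^sup>2 * B"
        unfolding B_def using a EZ ER by (intro add_mono mult_left_mono) auto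
      also have "a\<^sup>2 * B \<le> a * (1 / 4)"
        using mult_left_mono[OF a(3), of a] a(1) by (simp add: power2_eq_square mult.assoc)
      finally show ?thesis by simp
    qed
    define y where "y = sine v w"
    have y: "0 \<le> y" by (simp add: y_def sine_nonneg)
    have le: "AE g in \<kappa>. sine (g *v v) (g *v w) powr a \<le> U g * y powr a"
      using Zb V(1) W(1)
    proof eventually_elim
      case (elim g)
      have pos: "0 < norm (g *v v)" "0 < norm (g *v w)" using elim by auto
      have mx: "0 < max (exterior_norm g) b" using b by (simp add: less_max_iff_disj)
      have "sine (g *v v) (g *v w) \<le> max (exterior_norm g) b * area v w / (norm (g *v v) * norm (g *v w))"
        unfolding sine_def
        by (intro divide_right_mono order_trans[OF area_image_le] mult_right_mono) (auto simp: area_nonneg)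
      also have "\<dots> = exp (Z g) * y"
        using pos mx vw by (simp add: Z_def exp_diff y_def sine_def)
      finally have "sine (g *v v) (g *v w) powr a \<le> (exp (Z g) * y) powr a"
        using a by (intro powr_mono2) (auto simp: sine_nonneg)
      also have "\<dots> = exp (a * Z g) * y powr a"
        using y by (simp add: powr_mult exp_powr_real mult.commute)
      also have "exp (a * Z g) \<le> U g"
      proof -
        have "exp (a * Z g) \<le> 1 + a * Z g + (a * Z g)\<^sup>2 * exp \<bar>a * Z g\<bar>" by (rule exp_le_quadratic)
        also have "(a * Z g)\<^sup>2 * exp \<bar>a * Z g\<bar> \<le> a\<^sup>2 * ((Z g)\<^sup>2 * exp (s * \<bar>Z g\<bar>))"
          using a by (simp add: abs_mult power_mult_distrib mult.assoc mult_left_mono mult_right_mono)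
        also have "\<dots> \<le> a\<^sup>2 * (2 / s\<^sup>2 * R g)" by (intro mult_left_mono elim) auto
        finally show ?thesis by (simp add: U_def)
      qed
      finally show ?case by (simp add: mult_right_mono)
    qed
    have int: "integrable \<kappa> (\<lambda>g. sine (g *v v) (g *v w) powr a)"
    proof (rule Bochner_Integration.integrable_bound)
      show "integrable \<kappa> (\<lambda>g. 1::real)" by simp
      show "AE g in \<kappa>. norm (sine (g *v v) (g *v w) powr a) \<le> norm (1::real)"
        using a powr_mono2[of a _ 1] by (intro AE_I2) (simp add: sine_nonneg sine_le_1 powr_le1)
    qed measurable
    have "(\<integral>g. sine (g *v v) (g *v w) powr a \<partial>\<kappa>) \<le> (\<integral>g. U g * y powr a \<partial>\<kappa>)"
      using le by (intro integral_mono_AE int integrable_mult_left Ui)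
    also have "\<dots> \<le> (1 - a / 4) * y powr a" using EU by (simp add: mult_right_mono)
    finally show "integrable \<kappa> (\<lambda>g. sine (g *v v) (g *v w) powr a) \<and>
      (\<integral>g. sine (g *v v) (g *v w) powr a \<partial>\<kappa>) \<le> (1 - a / 4) * sine v w powr a"
      using int by (simp add: y_def)
  qed
qed

section \<open>Bounded oscillation of the mean logarithm\<close>

text \<open>
  The mean logarithm is even in the vector, so \<open>w\<close> may be replaced by the nearer of \<open>w\<close> and \<open>- w\<close>.
\<close>

lemma mean_log_holder:
  fixes \<kappa> :: "(real^'m^'m) measure"
  assumes k: "\<kappa> \<in> moment_class p D" and D: "0 < D" and p: "0 < p" "p \<le> 1" and a: "0 < a" "a \<le> p / 12"
    and vw: "norm v = 1" "norm w = 1"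
  shows "\<bar>mean_log \<kappa> v - mean_log \<kappa> w\<bar> \<le> 8 * (1 + D) / a * sine v w powr a"
proof -
  interpret prob_space \<kappa> by (rule moment_classD(1)[OF k])
  note [measurable_cong] = moment_classD(2)[OF k]
  obtain s where s: "s \<in> {1, -1::real}" "norm (v - s *\<^sub>R w) \<le> 2 * area v w"
    using area_controls_distance[OF vw] by blast
  define z where "z = s *\<^sub>R w"
  have z: "norm z = 1" using s(1) vw by (auto simp: z_def)
  have v0: "v \<noteq> 0" "z \<noteq> 0" "w \<noteq> 0" using vw z by auto
  have "mean_log \<kappa> z = ln \<bar>s\<bar> + mean_log \<kappa> w"
    unfolding z_def using s(1) by (intro mean_log_scale[OF k D p(1)] v0) auto
  then have zw: "mean_log \<kappa> z = mean_log \<kappa> w" using s(1) by auto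
  define y where "y = sine v w"
  have y: "0 \<le> y" "norm (v - z) \<le> 2 * y" using s(2) vw by (simp_all add: y_def sine_def z_def area_nonneg)
  note V = vector_moment[OF k D p(1) v0(1)] and W = vector_moment[OF k D p(1) v0(2)]
  note O = opnorm_moment[OF k less_imp_le[OF D]]
  define R where "R g = (2 + opnorm g powr p + norm (g *v v) powr -p) + (2 + opnorm g powr p + norm (g *v z) powr -p)" for g
  have Ri: "integrable \<kappa> R" unfolding R_def by (intro Bochner_Integration.integrable_add O V W) auto
  have ER: "(\<integral>g. R g \<partial>\<kappa>) \<le> 4 * (1 + D)"
  proof -
    have "(\<integral>g. R g \<partial>\<kappa>) = (2 + (\<integral>g. opnorm g powr p \<partial>\<kappa>) + (\<integral>g. norm (g *v v) powr -p \<partial>\<kappa>)) +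
        (2 + (\<integral>g. opnorm g powr p \<partial>\<kappa>) + (\<integral>g. norm (g *v z) powr -p \<partial>\<kappa>))"
      unfolding R_def by (simp add: O V W prob_space)
    then show ?thesis using O(2) V(3) W(3) vw z by simp
  qed
  have le: "AE g in \<kappa>. \<bar>ln (norm (g *v v)) - ln (norm (g *v z))\<bar> \<le> 2 * y powr a / a * R g"
    using V(1) W(1)
  proof eventually_elim
    case (elim g)
    let ?x = "norm (g *v v)" and ?z = "norm (g *v z)" and ?o = "opnorm g"
    have pos: "0 < ?x" "0 < ?z" using elim by auto
    have prod: "?o powr a * u powr -a \<le> 2 + ?o powr p + u powr -p" if u: "0 < u" for u
    proof -
      have "?o powr a * u powr -a \<le> (?o powr a)\<^sup>2 + (u powr -a)\<^sup>2"
        using scaled_amgm[of 1 "?o powr a" "u powr -a"] by simp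
      moreover have "(?o powr a)\<^sup>2 \<le> 1 + ?o powr p"
        using powr_sum_mono[of ?o "a + a" p] a p opnorm_nonneg[of g] by (simp add: power2_eq_square powr_add[symmetric])
      moreover have "(u powr -a)\<^sup>2 \<le> 1 + u powr -p"
        using powr_sum_mono[of "1 / u" "a + a" p] a p u
        by (simp add: power2_eq_square powr_add[symmetric] powr_divide powr_minus_divide)
      ultimately show ?thesis by linarith
    qed
    have "\<bar>?x - ?z\<bar> \<le> norm (g *v (v - z))"
      unfolding matrix_vector_mult_diff_distrib by (rule norm_triangle_ineq3)
    also have "\<dots> \<le> ?o * norm (v - z)" by (rule norm_mult_le_opnorm)
    also have "\<dots> \<le> ?o * (2 * y)" by (intro mult_left_mono y opnorm_nonneg)
    finally have "\<bar>?x - ?z\<bar> powr a \<le> (?o * (2 * y)) powr a" using a by (intro powr_mono2) auto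
    also have "\<dots> = ?o powr a * 2 powr a * y powr a" using y by (simp add: powr_mult opnorm_nonneg)
    also have "\<dots> \<le> ?o powr a * 2 * y powr a"
      using powr_mono[of a 1 "2::real"] a p by (intro mult_right_mono mult_left_mono) auto
    finally have xz: "\<bar>?x - ?z\<bar> powr a \<le> ?o powr a * 2 * y powr a" .
    have "\<bar>ln ?x - ln ?z\<bar> \<le> \<bar>?x - ?z\<bar> powr a * (?x powr -a + ?z powr -a) / a"
      using a p by (intro ln_diff_le pos) auto
    also have "\<dots> \<le> ?o powr a * 2 * y powr a * (?x powr -a + ?z powr -a) / a"
      using a xz by (intro divide_right_mono mult_right_mono) auto
    also have "\<dots> = 2 * y powr a / a * (?o powr a * ?x powr -a + ?o powr a * ?z powr -a)"
      by (simp add: algebra_simps add_divide_distrib)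
    also have "\<dots> \<le> 2 * y powr a / a * R g"
      unfolding R_def using a by (intro mult_left_mono add_mono prod pos) auto
    finally show ?case .
  qed
  note iv = integrable_ln_norm[OF k D p(1) v0(1)] integrable_ln_norm[OF k D p(1) v0(2)]
  have "\<bar>mean_log \<kappa> v - mean_log \<kappa> z\<bar> = \<bar>\<integral>g. ln (norm (g *v v)) - ln (norm (g *v z)) \<partial>\<kappa>\<bar>"
    unfolding mean_log_def using iv by simp
  also have "\<dots> \<le> (\<integral>g. \<bar>ln (norm (g *v v)) - ln (norm (g *v z))\<bar> \<partial>\<kappa>)" by (rule integral_abs_bound)
  also have "\<dots> \<le> (\<integral>g. 2 * y powr a / a * R g \<partial>\<kappa>)"
    using le iv by (intro integral_mono_AE integrable_mult_right Ri) auto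
  also have "\<dots> = 2 * y powr a / a * (\<integral>g. R g \<partial>\<kappa>)" by simp
  also have "\<dots> \<le> 2 * y powr a / a * (4 * (1 + D))"
    using a by (intro mult_left_mono ER) auto
  also have "\<dots> = 8 * (1 + D) / a * y powr a" by simp
  finally show ?thesis by (simp add: zw y_def)
qed

text \<open>
  The Markov property of the direction of \<open>A\<^sup>n v\<close>.
\<close>

lemma mean_log_cocycle_step:
  fixes \<nu> :: "(real^'m^'m) measure" and m n :: nat
  assumes nu: "\<nu> \<in> moment_class p C" and p: "0 < p" and C: "1 \<le> C" and v: "v \<noteq> 0"
  defines "psi \<equiv> \<lambda>g. mean_log (law \<nu> n) ((g *v v) /\<^sub>R norm (g *v v))"
  shows "integrable (law \<nu> m) psi"
    and "mean_log (law \<nu> (m + n)) v = mean_log (law \<nu> m) v + (\<integral>g. psi g \<partial>law \<nu> m)"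
    and "AE g in law \<nu> m. mean_log (law \<nu> n) (g *v v) = ln (norm (g *v v)) + psi g"
proof -
  note P = moment_classD[OF nu]
  have Ck: "0 < C ^ k" for k using C by simp
  note [measurable] = mean_log_borel[OF P(1,2), of n]
  note A = mean_log_law_add[OF nu p C v, where m = m and n = n]
  show eq: "AE g in law \<nu> m. mean_log (law \<nu> n) (g *v v) = ln (norm (g *v v)) + psi g"
    using vector_moment(1)[OF law_moment_class[OF nu p C] Ck p v, of m]
    unfolding psi_def by eventually_elim (rule mean_log_direction[OF law_moment_class[OF nu p C] Ck p])
  note L = integrable_ln_norm[OF law_moment_class[OF nu p C] Ck p v, of m]
  have "integrable (law \<nu> m) (\<lambda>g. mean_log (law \<nu> n) (g *v v) - ln (norm (g *v v)))"
    using A(2) L by auto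
  moreover have "AE g in law \<nu> m. mean_log (law \<nu> n) (g *v v) - ln (norm (g *v v)) = psi g"
    using eq by eventually_elim simp
  moreover have m: "psi \<in> borel_measurable (law \<nu> m)" unfolding psi_def by measurable
  ultimately show i: "integrable (law \<nu> m) psi"
    using integrable_cong_AE[of "\<lambda>g. mean_log (law \<nu> n) (g *v v) - ln (norm (g *v v))" "law \<nu> m" psi] by auto
  have "mean_log (law \<nu> (m + n)) v = (\<integral>g. ln (norm (g *v v)) + psi g \<partial>law \<nu> m)"
    unfolding A(1) using eq A(2) L m by (intro integral_cong_AE) auto
  also have "\<dots> = mean_log (law \<nu> m) v + (\<integral>g. psi g \<partial>law \<nu> m)"
    using i L by (simp add: mean_log_def)
  finally show "mean_log (law \<nu> (m + n)) v = mean_log (law \<nu> m) v + (\<integral>g. psi g \<partial>law \<nu> m)" .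
qed

text \<open>
  The first \<open>N\<close> factors contribute a Hoelder function; the remaining ones contribute the same bound at
  contracted directions. With Hoelder constant \<open>K a / 4\<close> and contraction factor \<open>1 - a / 4\<close>, the constant \<open>K\<close>
  reproduces itself.
\<close>

lemma mean_log_oscillation:
  fixes \<nu> :: "(real^'m^'m) measure"
  assumes nu: "\<nu> \<in> moment_class p C" and p: "0 < p" "p \<le> 1" and C: "1 \<le> C" and a: "0 < a" "a \<le> p / 12"
    and N: "1 \<le> N"
    and con: "\<And>v w. norm v = 1 \<Longrightarrow> norm w = 1 \<Longrightarrow>
      integrable (law \<nu> N) (\<lambda>g. sine (g *v v) (g *v w) powr a) \<and>
      (\<integral>g. sine (g *v v) (g *v w) powr a \<partial>law \<nu> N) \<le> (1 - a / 4) * sine v w powr a"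
    and vw: "norm v = 1" "norm w = 1"
  shows "\<bar>mean_log (law \<nu> n) v - mean_log (law \<nu> n) w\<bar> \<le> 32 * (1 + C ^ N) / a\<^sup>2 * sine v w powr a"
proof -
  define D where "D = C ^ N"
  have D: "0 < D" using C by (simp add: D_def)
  have LD: "law \<nu> k \<in> moment_class p D" if "k \<le> N" for k
    unfolding D_def using that C by (intro moment_class_mono[OF law_moment_class[OF nu p(1) C, of k]] power_increasing) auto
  define K where "K = 32 * (1 + D) / a\<^sup>2"
  have K: "0 \<le> K" using D by (simp add: K_def)
  have K': "8 * (1 + D) / a = K * (a / 4)" using a by (simp add: K_def field_simps power2_eq_square)
  have "\<bar>mean_log (law \<nu> n) v - mean_log (law \<nu> n) w\<bar> \<le> K * sine v w powr a"
    using vw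
  proof (induction n arbitrary: v w rule: less_induct)
    case (less n)
    have H: "\<bar>mean_log (law \<nu> k) v - mean_log (law \<nu> k) w\<bar> \<le> K * (a / 4) * sine v w powr a" if "k \<le> N" for k
      using mean_log_holder[OF LD[OF that] D p a less.prems] unfolding K' .
    show ?case
    proof (cases "n < N")
      case True
      have "K * (a / 4) * sine v w powr a \<le> K * sine v w powr a"
        using K a p by (intro mult_right_mono mult_left_le) auto
      then show ?thesis using H[of n] True by simp
    next
      case False
      define k where "k = n - N"
      have n: "n = N + k" "k < n" using False N by (auto simp: k_def)
      have v0: "v \<noteq> 0" "w \<noteq> 0" using less.prems by auto
      define psi where "psi u g = mean_log (law \<nu> k) ((g *v u) /\<^sub>R norm (g *v u))"
        for u :: "real^'m" and g :: "real^'m^'m"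
      note Sv = mean_log_cocycle_step[OF nu p(1) C v0(1), where m = N and n = k, folded psi_def]
      note Sw = mean_log_cocycle_step[OF nu p(1) C v0(2), where m = N and n = k, folded psi_def]
      have "\<bar>(\<integral>g. psi v g \<partial>law \<nu> N) - (\<integral>g. psi w g \<partial>law \<nu> N)\<bar> = \<bar>\<integral>g. psi v g - psi w g \<partial>law \<nu> N\<bar>"
        using Sv(1) Sw(1) by simp
      also have "\<dots> \<le> (\<integral>g. \<bar>psi v g - psi w g\<bar> \<partial>law \<nu> N)" by (rule integral_abs_bound)
      also have "\<dots> \<le> (\<integral>g. K * sine (g *v v) (g *v w) powr a \<partial>law \<nu> N)"
      proof (rule integral_mono_AE)
        show "integrable (law \<nu> N) (\<lambda>g. \<bar>psi v g - psi w g\<bar>)" using Sv(1) Sw(1) by auto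
        show "integrable (law \<nu> N) (\<lambda>g. K * sine (g *v v) (g *v w) powr a)"
          using con[OF less.prems] by (intro integrable_mult_right) auto
        show "AE g in law \<nu> N. \<bar>psi v g - psi w g\<bar> \<le> K * sine (g *v v) (g *v w) powr a"
          using vector_moment(1)[OF LD[OF order_refl] D p(1) v0(1)] vector_moment(1)[OF LD[OF order_refl] D p(1) v0(2)]
        proof eventually_elim
          case (elim g)
          have "\<bar>psi v g - psi w g\<bar> \<le> K * sine ((g *v v) /\<^sub>R norm (g *v v)) ((g *v w) /\<^sub>R norm (g *v w)) powr a"
            unfolding psi_def using elim by (intro less.IH n) auto
          then show ?case using elim by (simp add: sine_direction)
        qed
      qed
      also have "\<dots> = K * (\<integral>g. sine (g *v v) (g *v w) powr a \<partial>law \<nu> N)" by simp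
      also have "\<dots> \<le> K * ((1 - a / 4) * sine v w powr a)"
        using con[OF less.prems] K by (intro mult_left_mono) auto
      finally have "\<bar>mean_log (law \<nu> n) v - mean_log (law \<nu> n) w\<bar>
          \<le> K * (a / 4) * sine v w powr a + K * ((1 - a / 4) * sine v w powr a)"
        using H[of N] unfolding n(1) Sv(2) Sw(2) by linarith
      also have "\<dots> = K * sine v w powr a" by (simp add: algebra_simps)
      finally show ?thesis .
    qed
  qed
  then show ?thesis by (simp add: K_def D_def)
qed

section \<open>Exponential concentration\<close>

text \<open>
  The quotients \<open>f n / n\<close> form a Cauchy sequence, since \<open>f (k n)\<close> and \<open>k f n\<close> differ by at most \<open>k K\<close>.
\<close>

lemma quasi_additive_limit:
  fixes f :: "nat \<Rightarrow> real"
  assumes qa: "\<And>m n. \<bar>f (m + n) - f m - f n\<bar> \<le> K"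
  obtains l where "\<And>n. \<bar>f n - real n * l\<bar> \<le> K"
proof -
  have K: "0 \<le> K" using qa[of 0 0] abs_ge_zero order_trans by blast
  have mult: "\<bar>f (k * n) - real k * f n\<bar> \<le> real k * K" if "1 \<le> k" for k n
    using that
  proof (induction k rule: nat_induct_at_least)
    case base
    then show ?case using K by simp
  next
    case (Suc k)
    have "\<bar>f (n + k * n) - f n - f (k * n)\<bar> \<le> K" by (rule qa)
    then show ?case using Suc.IH by (simp add: algebra_simps abs_le_iff)
  qed
  define g where "g n = f n / real n" for n
  have cross: "\<bar>g m - g n\<bar> \<le> K / real m + K / real n" if mn: "1 \<le> m" "1 \<le> n" for m n
  proof -
    have half: "\<bar>g (k * n) - g n\<bar> \<le> K / real n" if "1 \<le> k" "1 \<le> n" for k n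
    proof -
      have pos: "0 < real k * real n" using that by simp
      have "g (k * n) - g n = (f (k * n) - real k * f n) / (real k * real n)"
        using that by (simp add: g_def diff_divide_distrib)
      also have "\<bar>\<dots>\<bar> = \<bar>f (k * n) - real k * f n\<bar> / (real k * real n)"
        using pos by (simp only: abs_divide abs_of_pos)
      also have "\<dots> \<le> real k * K / (real k * real n)"
        using mult[OF that(1), of n] pos by (intro divide_right_mono) auto
      also have "\<dots> = K / real n" using that by simp
      finally show ?thesis .
    qed
    from half[OF mn] half[OF mn(2) mn(1)] show ?thesis
      unfolding mult.commute[of n m] by linarith
  qed
  have small: "(\<lambda>n. K / real n) \<longlonglongrightarrow> 0" using tendsto_mult_right_zero[OF lim_1_over_n, of K] by simp
  have "Cauchy g"
  proof (rule metric_CauchyI)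
    fix e :: real assume "0 < e"
    then have "0 < e / 2" by simp
    from order_tendstoD(2)[OF small this] eventually_ge_at_top[of 1]
    have "eventually (\<lambda>n. K / real n < e / 2 \<and> 1 \<le> n) sequentially" by eventually_elim simp
    then obtain M where M: "\<And>n. M \<le> n \<Longrightarrow> K / real n < e / 2 \<and> 1 \<le> n" by (auto simp: eventually_sequentially)
    have "dist (g m) (g n) < e" if "M \<le> m" "M \<le> n" for m n
      using cross[of m n] M[OF that(1)] M[OF that(2)] unfolding dist_real_def by linarith
    then show "\<exists>M. \<forall>m\<ge>M. \<forall>n\<ge>M. dist (g m) (g n) < e" by blast
  qed
  then obtain l where l: "g \<longlonglongrightarrow> l" using Cauchy_convergent convergent_def by blast
  show thesis
  proof (rule that)
    fix n
    show "\<bar>f n - real n * l\<bar> \<le> K"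
    proof (cases "n = 0")
      case True
      then show ?thesis using qa[of 0 0] by simp
    next
      case False
      have "(\<lambda>m. \<bar>g m - g n\<bar>) \<longlonglongrightarrow> \<bar>l - g n\<bar>" by (intro tendsto_intros l)
      moreover have "(\<lambda>m. K / real m + K / real n) \<longlonglongrightarrow> 0 + K / real n" by (intro tendsto_intros small)
      ultimately have "\<bar>l - g n\<bar> \<le> 0 + K / real n"
        by (rule LIMSEQ_le) (use cross False in \<open>auto intro!: exI[of _ 1]\<close>)
      then have "real n * \<bar>l - g n\<bar> \<le> K" using False by (simp add: field_simps)
      moreover have "real n * \<bar>l - g n\<bar> = \<bar>f n - real n * l\<bar>"
      proof -
        have "f n - real n * l = - (real n * (l - g n))" using False by (simp add: g_def field_simps)
        then show ?thesis by (simp add: abs_mult)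
      qed
      ultimately show ?thesis by simp
    qed
  qed
qed

lemma mean_log_cocycle_close:
  fixes \<nu> :: "(real^'m^'m) measure"
  assumes nu: "\<nu> \<in> moment_class p C" and p: "0 < p" and C: "1 \<le> C"
    and osc: "\<And>n v w. norm v = 1 \<Longrightarrow> norm w = 1 \<Longrightarrow> \<bar>mean_log (law \<nu> n) v - mean_log (law \<nu> n) w\<bar> \<le> K"
    and vw: "norm v = 1" "norm w = 1"
  shows "\<bar>mean_log (law \<nu> (m + n)) v - mean_log (law \<nu> m) v - mean_log (law \<nu> n) w\<bar> \<le> K"
proof -
  note P = moment_classD[OF nu]
  interpret L: prob_space "law \<nu> m" by (rule prob_space_law[OF P(1,2)])
  have v0: "v \<noteq> 0" using vw by auto
  have Ck: "0 < C ^ k" for k using C by simp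
  define psi where "psi g = mean_log (law \<nu> n) ((g *v v) /\<^sub>R norm (g *v v))" for g :: "real^'m^'m"
  note S = mean_log_cocycle_step[OF nu p C v0, where m = m and n = n, folded psi_def]
  have "mean_log (law \<nu> (m + n)) v - mean_log (law \<nu> m) v - mean_log (law \<nu> n) w
      = (\<integral>g. psi g - mean_log (law \<nu> n) w \<partial>law \<nu> m)"
    using S(1,2) L.prob_space by simp
  also have "\<bar>\<dots>\<bar> \<le> (\<integral>g. \<bar>psi g - mean_log (law \<nu> n) w\<bar> \<partial>law \<nu> m)" by (rule integral_abs_bound)
  also have "\<dots> \<le> (\<integral>g. K \<partial>law \<nu> m)"
  proof (rule integral_mono_AE)
    show "AE g in law \<nu> m. \<bar>psi g - mean_log (law \<nu> n) w\<bar> \<le> K"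
      using vector_moment(1)[OF law_moment_class[OF nu p C] Ck p v0, of m]
      by eventually_elim (use vw in \<open>auto simp: psi_def intro!: osc\<close>)
  qed (use S(1) in auto)
  also have "\<dots> = K" using L.prob_space by simp
  finally show ?thesis .
qed

lemma centered_exponential_moment:
  fixes X :: "'a \<Rightarrow> real"
  assumes "prob_space M" and X: "integrable M X" "(\<integral>x. X x \<partial>M) = 0" and s: "0 < s"
    and R: "integrable M R" "(\<integral>x. R x \<partial>M) \<le> B" "AE x in M. exp (2 * s * \<bar>X x\<bar>) \<le> R x" and t: "\<bar>t\<bar> \<le> s"
  shows "(\<integral>\<^sup>+ x. ennreal (exp (t * X x)) \<partial>M) \<le> ennreal (exp (2 / s\<^sup>2 * B * t\<^sup>2))"
proof -
  interpret prob_space M by fact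
  have [measurable]: "X \<in> borel_measurable M" "R \<in> borel_measurable M" using X R by auto
  define U where "U x = 1 + t * X x + t\<^sup>2 * (2 / s\<^sup>2 * R x)" for x
  have Ui: "integrable M U" unfolding U_def using X R by auto
  have le: "AE x in M. exp (t * X x) \<le> U x"
    using R(3)
  proof eventually_elim
    case (elim x)
    have "exp (t * X x) \<le> 1 + t * X x + (t * X x)\<^sup>2 * exp \<bar>t * X x\<bar>" by (rule exp_le_quadratic)
    also have "(t * X x)\<^sup>2 * exp \<bar>t * X x\<bar> \<le> (t\<^sup>2 * (2 / s\<^sup>2 * exp (s * \<bar>X x\<bar>))) * exp (s * \<bar>X x\<bar>)"
      unfolding power_mult_distrib abs_mult
      by (intro mult_mono mult_left_mono square_le_exp s) (use t in \<open>auto simp: mult_right_mono\<close>)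
    also have "\<dots> = t\<^sup>2 * (2 / s\<^sup>2 * exp (2 * s * \<bar>X x\<bar>))" by (simp add: exp_add[symmetric])
    also have "\<dots> \<le> t\<^sup>2 * (2 / s\<^sup>2 * R x)" using elim by (intro mult_left_mono) auto
    finally show ?case by (simp add: U_def)
  qed
  have "(\<integral>\<^sup>+ x. ennreal (exp (t * X x)) \<partial>M) \<le> (\<integral>\<^sup>+ x. ennreal (U x) \<partial>M)"
    using le by (intro nn_integral_mono_AE) (auto elim!: eventually_mono intro: ennreal_leI)
  also have "\<dots> = ennreal (\<integral>x. U x \<partial>M)"
  proof (rule nn_integral_eq_integral[OF Ui])
    show "AE x in M. 0 \<le> U x"
      using le by eventually_elim (rule order_trans[OF less_imp_le[OF exp_gt_zero]])
  qed
  also have "(\<integral>x. U x \<partial>M) = 1 + t\<^sup>2 * (2 / s\<^sup>2 * (\<integral>x. R x \<partial>M))"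
    unfolding U_def using X R by (simp add: prob_space)
  also have "ennreal \<dots> \<le> ennreal (exp (2 / s\<^sup>2 * B * t\<^sup>2))"
  proof (rule ennreal_leI)
    have "t\<^sup>2 * (2 / s\<^sup>2 * (\<integral>x. R x \<partial>M)) \<le> t\<^sup>2 * (2 / s\<^sup>2 * B)" using R(2) by (intro mult_left_mono) auto
    moreover have "2 / s\<^sup>2 * B * t\<^sup>2 = t\<^sup>2 * (2 / s\<^sup>2 * B)" by (simp only: mult.commute)
    ultimately show "1 + t\<^sup>2 * (2 / s\<^sup>2 * (\<integral>x. R x \<partial>M)) \<le> exp (2 / s\<^sup>2 * B * t\<^sup>2)"
      using exp_ge_add_one_self[of "2 / s\<^sup>2 * B * t\<^sup>2"] by linarith
  qed
  finally show ?thesis .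
qed

text \<open>
  Induction over the first factor \<open>g\<close>. Conditionally on \<open>g\<close>, the remaining product has the bound for \<open>n\<close>
  factors at the direction of \<open>g v\<close>, and the centred variable \<open>X g\<close> differs from \<open>ln |g v|\<close> by an amount
  bounded independently of \<open>n\<close>, because the oscillation is bounded.
\<close>

lemma cocycle_exponential_moment:
  fixes \<nu> :: "(real^'m^'m) measure"
  assumes nu: "\<nu> \<in> moment_class p C" and p: "0 < p" and C: "1 \<le> C"
    and osc: "\<And>n v w. norm v = 1 \<Longrightarrow> norm w = 1 \<Longrightarrow> \<bar>mean_log (law \<nu> n) v - mean_log (law \<nu> n) w\<bar> \<le> K"
    and t: "\<bar>t\<bar> \<le> p / 2" and v: "norm v = 1"
  defines "B \<equiv> 2 / (p / 2)\<^sup>2 * (exp (p * (2 * K + 2 * C / p)) * (2 * C))"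
  shows "(\<integral>\<^sup>+ g. ennreal (exp (t * (ln (norm (g *v v)) - mean_log (law \<nu> n) v))) \<partial>law \<nu> n) \<le> ennreal (exp (B * t\<^sup>2 * real n))"
  using v
proof (induction n arbitrary: v)
  case 0
  note P = moment_classD[OF nu]
  have "mean_log (law \<nu> 0) v = 0" unfolding mean_log_def law_0[OF P(1)]
    using 0 by (subst integral_return) auto
  then show ?case unfolding law_0[OF P(1)] using 0 by (subst nn_integral_return) auto
next
  case (Suc n)
  note P = moment_classD[OF nu]
  note [measurable_cong] = P(2)
  interpret prob_space \<nu> by (rule P)
  have v0: "v \<noteq> 0" using Suc.prems by auto
  have C0: "0 < C" "0 \<le> C" using C by auto
  have Ck: "0 < C ^ k" for k using C by simp
  have l1: "law \<nu> (Suc 0) = \<nu>" using law_1[OF P(1,2)] by simp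
  have l1': "law \<nu> 1 = \<nu>" by (rule law_1[OF P(1,2)])
  have K0: "0 \<le> K" using osc[OF Suc.prems Suc.prems, of 0] by simp
  note V = vector_moment[OF nu C0(1) p v0] and O = opnorm_moment[OF nu C0(2)]
  define b where "b = mean_log (law \<nu> (1 + n)) v"
  define X where "X g = mean_log (law \<nu> n) (g *v v) - b" for g
  note [measurable] = mean_log_borel[OF P(1,2), of n]
  have Xm: "X \<in> borel_measurable \<nu>" unfolding X_def by measurable
  note S = mean_log_law_add[OF nu p C v0, where m = 1 and n = n, unfolded l1', folded b_def]
  have X: "integrable \<nu> X" "(\<integral>g. X g \<partial>\<nu>) = 0"
    using S by (simp_all add: X_def[abs_def] prob_space)
  define c where "c = 2 * K + 2 * C / p"
  have mean1: "\<bar>mean_log \<nu> v\<bar> \<le> 2 * C / p"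
  proof -
    have "\<bar>mean_log \<nu> v\<bar> \<le> (\<integral>g. \<bar>ln (norm (g *v v))\<bar> \<partial>\<nu>)" unfolding mean_log_def by (rule integral_abs_bound)
    also have "\<dots> \<le> (\<integral>g. (opnorm g powr p + norm (g *v v) powr -p) / p \<partial>\<nu>)"
    proof (rule integral_mono_AE)
      show "integrable \<nu> (\<lambda>g. \<bar>ln (norm (g *v v))\<bar>)" using integrable_ln_norm[OF nu C0(1) p v0] by auto
      show "integrable \<nu> (\<lambda>g. (opnorm g powr p + norm (g *v v) powr -p) / p)"
        by (intro integrable_divide Bochner_Integration.integrable_add O V)
      show "AE g in \<nu>. \<bar>ln (norm (g *v v))\<bar> \<le> (opnorm g powr p + norm (g *v v) powr -p) / p"
        using V(1)
      proof eventually_elim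
        case (elim g)
        have "norm (g *v v) powr p \<le> opnorm g powr p"
          using norm_mult_le_opnorm[of g v] Suc.prems p by (intro powr_mono2) auto
        then have "(norm (g *v v) powr p + norm (g *v v) powr -p) / p \<le> (opnorm g powr p + norm (g *v v) powr -p) / p"
          using p by (intro divide_right_mono) auto
        moreover have "\<bar>ln (norm (g *v v))\<bar> \<le> (norm (g *v v) powr p + norm (g *v v) powr -p) / p"
          using elim p by (intro abs_ln_le) auto
        ultimately show ?case by linarith
      qed
    qed
    also have "\<dots> = ((\<integral>g. opnorm g powr p \<partial>\<nu>) + (\<integral>g. norm (g *v v) powr -p \<partial>\<nu>)) / p"
      using O(1) V(2) by simp
    also have "\<dots> \<le> 2 * C / p" using O(2) V(3) Suc.prems p by (intro divide_right_mono) auto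
    finally show ?thesis .
  qed
  define R where "R g = exp (p * c) * (opnorm g powr p + norm (g *v v) powr -p)" for g
  have R: "integrable \<nu> R" unfolding R_def by (intro integrable_mult_right Bochner_Integration.integrable_add O V)
  have ER: "(\<integral>g. R g \<partial>\<nu>) \<le> exp (p * c) * (2 * C)"
  proof -
    have "(\<integral>g. R g \<partial>\<nu>) = exp (p * c) * ((\<integral>g. opnorm g powr p \<partial>\<nu>) + (\<integral>g. norm (g *v v) powr -p \<partial>\<nu>))"
      unfolding R_def using O(1) V(2) by simp
    also have "\<dots> \<le> exp (p * c) * (2 * C)" using O(2) V(3) Suc.prems by (intro mult_left_mono) auto
    finally show ?thesis .
  qed
  have XR: "AE g in \<nu>. exp (2 * (p / 2) * \<bar>X g\<bar>) \<le> R g"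
    using V(1) exp_ln_norm_moment(1)[OF nu C0(1) p Suc.prems]
  proof eventually_elim
    case (elim g)
    define u where "u = (g *v v) /\<^sub>R norm (g *v v)"
    have u: "norm u = 1" using elim by (simp add: u_def)
    have dir: "mean_log (law \<nu> n) (g *v v) = ln (norm (g *v v)) + mean_log (law \<nu> n) u"
      unfolding u_def by (rule mean_log_direction[OF law_moment_class[OF nu p C] Ck p elim(1)])
    have "\<bar>mean_log (law \<nu> (1 + n)) v - mean_log (law \<nu> 1) v - mean_log (law \<nu> n) u\<bar> \<le> K"
      by (rule mean_log_cocycle_close[OF nu p C _ Suc.prems u]) (rule osc)
    then have "\<bar>b - mean_log \<nu> v - mean_log (law \<nu> n) u\<bar> \<le> K" unfolding b_def l1' .
    then have "\<bar>X g\<bar> \<le> \<bar>ln (norm (g *v v))\<bar> + c"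
      using mean1 K0 unfolding X_def dir c_def by linarith
    then have "exp (p * \<bar>X g\<bar>) \<le> exp (p * c) * exp (p * \<bar>ln (norm (g *v v))\<bar>)"
      using p by (simp add: exp_add[symmetric] distrib_left[symmetric] add.commute)
    also have "\<dots> \<le> R g" unfolding R_def using elim(2) by (intro mult_left_mono) auto
    finally show ?case by simp
  qed
  have EX: "(\<integral>\<^sup>+ g. ennreal (exp (t * X g)) \<partial>\<nu>) \<le> ennreal (exp (B * t\<^sup>2))"
    using centered_exponential_moment[OF P(1) X _ R ER XR t] p unfolding B_def c_def by simp
  have "(\<integral>\<^sup>+ g. ennreal (exp (t * (ln (norm (g *v v)) - mean_log (law \<nu> (Suc n)) v))) \<partial>law \<nu> (Suc n))
    = (\<integral>\<^sup>+ g. \<integral>\<^sup>+ h. ennreal (exp (t * (ln (norm ((h ** g) *v v)) - b))) \<partial>law \<nu> n \<partial>\<nu>)"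
    using nn_integral_law_add[OF P(1,2), of "\<lambda>g. ennreal (exp (t * (ln (norm (g *v v)) - b)))" 1 n]
    unfolding l1' by (simp add: b_def)
  also have "\<dots> \<le> (\<integral>\<^sup>+ g. ennreal (exp (t * X g)) * ennreal (exp (B * t\<^sup>2 * real n)) \<partial>\<nu>)"
  proof (rule nn_integral_mono_AE)
    show "AE g in \<nu>. (\<integral>\<^sup>+ h. ennreal (exp (t * (ln (norm ((h ** g) *v v)) - b))) \<partial>law \<nu> n)
      \<le> ennreal (exp (t * X g)) * ennreal (exp (B * t\<^sup>2 * real n))"
      using V(1)
    proof eventually_elim
      case (elim g)
      define u where "u = (g *v v) /\<^sub>R norm (g *v v)"
      have u: "norm u = 1" using elim by (simp add: u_def)
      then have u0: "u \<noteq> 0" by auto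
      have gv: "g *v v = norm (g *v v) *\<^sub>R u" using elim by (simp add: u_def)
      have dir: "mean_log (law \<nu> n) (g *v v) = ln (norm (g *v v)) + mean_log (law \<nu> n) u"
        unfolding u_def by (rule mean_log_direction[OF law_moment_class[OF nu p C] Ck p elim])
      have "(\<integral>\<^sup>+ h. ennreal (exp (t * (ln (norm ((h ** g) *v v)) - b))) \<partial>law \<nu> n)
        = (\<integral>\<^sup>+ h. ennreal (exp (t * X g)) * ennreal (exp (t * (ln (norm (h *v u)) - mean_log (law \<nu> n) u))) \<partial>law \<nu> n)"
      proof (rule nn_integral_cong_AE)
        show "AE h in law \<nu> n. ennreal (exp (t * (ln (norm ((h ** g) *v v)) - b))) =
            ennreal (exp (t * X g)) * ennreal (exp (t * (ln (norm (h *v u)) - mean_log (law \<nu> n) u)))"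
          using vector_moment(1)[OF law_moment_class[OF nu p C] Ck p u0, of n]
        proof eventually_elim
          case (elim h)
          have "norm ((h ** g) *v v) = norm (g *v v) * norm (h *v u)"
            unfolding matrix_vector_mul_assoc[symmetric] by (subst gv) (simp add: matrix_vector_mult_scaleR)
          then have "ln (norm ((h ** g) *v v)) = ln (norm (g *v v)) + ln (norm (h *v u))"
            using elim \<open>g *v v \<noteq> 0\<close> by (simp add: ln_mult_pos)
          then have "t * (ln (norm ((h ** g) *v v)) - b) = t * X g + t * (ln (norm (h *v u)) - mean_log (law \<nu> n) u)"
            unfolding X_def dir by (simp add: algebra_simps)
          then show ?case by (simp add: exp_add ennreal_mult)
        qed
      qed
      also have "\<dots> = ennreal (exp (t * X g)) * (\<integral>\<^sup>+ h. ennreal (exp (t * (ln (norm (h *v u)) - mean_log (law \<nu> n) u))) \<partial>law \<nu> n)"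
        by (rule nn_integral_cmult) measurable
      also have "\<dots> \<le> ennreal (exp (t * X g)) * ennreal (exp (B * t\<^sup>2 * real n))"
        by (intro mult_left_mono Suc.IH u) auto
      finally show ?case .
    qed
  qed
  also have "\<dots> = (\<integral>\<^sup>+ g. ennreal (exp (t * X g)) \<partial>\<nu>) * ennreal (exp (B * t\<^sup>2 * real n))"
    unfolding X_def by (rule nn_integral_multc) measurable
  also have "\<dots> \<le> ennreal (exp (B * t\<^sup>2)) * ennreal (exp (B * t\<^sup>2 * real n))" by (intro mult_right_mono EX) auto
  also have "\<dots> = ennreal (exp (B * t\<^sup>2 * real (Suc n)))"
    by (simp add: ennreal_mult[symmetric] exp_add[symmetric] algebra_simps)
  finally show ?case .
qed

lemma chernoff_bound:
  fixes Y :: "'a \<Rightarrow> real"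
  assumes "prob_space M" and [measurable]: "Y \<in> borel_measurable M"
    and mgf: "(\<integral>\<^sup>+ x. ennreal (exp (t * Y x)) \<partial>M) \<le> ennreal (exp (A * t\<^sup>2))"
  shows "measure M {x \<in> space M. y \<le> t * Y x} \<le> exp (A * t\<^sup>2 - y)"
proof -
  interpret prob_space M by fact
  have "emeasure M {x \<in> space M. y \<le> t * Y x} = (\<integral>\<^sup>+ x. indicator {x \<in> space M. y \<le> t * Y x} x \<partial>M)"
    by (rule nn_integral_indicator[symmetric]) measurable
  also have "\<dots> \<le> (\<integral>\<^sup>+ x. ennreal (exp (- y)) * ennreal (exp (t * Y x)) \<partial>M)"
  proof (intro nn_integral_mono)
    fix x
    have "1 \<le> exp (- y) * exp (t * Y x)" if "y \<le> t * Y x" using that by (simp add: exp_add[symmetric])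
    then have "ennreal 1 \<le> ennreal (exp (- y) * exp (t * Y x))" if "y \<le> t * Y x" using that by (intro ennreal_leI) auto
    then show "indicator {x \<in> space M. y \<le> t * Y x} x \<le> ennreal (exp (- y)) * ennreal (exp (t * Y x))"
      by (auto simp: indicator_def ennreal_mult[symmetric])
  qed
  also have "\<dots> = ennreal (exp (- y)) * (\<integral>\<^sup>+ x. ennreal (exp (t * Y x)) \<partial>M)"
    by (rule nn_integral_cmult) measurable
  also have "\<dots> \<le> ennreal (exp (- y)) * ennreal (exp (A * t\<^sup>2))" by (intro mult_left_mono mgf) auto
  also have "\<dots> = ennreal (exp (A * t\<^sup>2 - y))" by (simp add: ennreal_mult[symmetric] exp_add[symmetric])
  finally show ?thesis by (simp add: emeasure_eq_measure)
qed

text \<open>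
  The optimal parameter is \<open>x / (2 B)\<close>; it is admissible for \<open>x \<le> 2 B s\<close>, and larger \<open>x\<close> are reduced to that
  value.
\<close>

lemma subgaussian_tail:
  fixes Y :: "'a \<Rightarrow> real"
  assumes M: "prob_space M" and Y [measurable]: "Y \<in> borel_measurable M" and s: "0 < s" and B: "0 < B" and x: "0 < x"
    and mgf: "\<And>t. \<bar>t\<bar> \<le> s \<Longrightarrow> (\<integral>\<^sup>+ w. ennreal (exp (t * Y w)) \<partial>M) \<le> ennreal (exp (B * t\<^sup>2 * real n))"
  shows "measure M {w \<in> space M. real n * x \<le> \<bar>Y w\<bar>} \<le> 2 * exp (- (real n * ((min x (2 * B * s))\<^sup>2 / (4 * B))))"
proof -
  interpret prob_space M by (rule M)
  define y where "y = min x (2 * B * s)"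
  have y: "0 < y" "y \<le> x" using x B s by (auto simp: y_def)
  define t where "t = y / (2 * B)"
  have t: "0 < t" "t \<le> s" using y B by (auto simp: t_def y_def min_def field_simps)
  have mgf': "(\<integral>\<^sup>+ w. ennreal (exp (u * Y w)) \<partial>M) \<le> ennreal (exp ((B * real n) * u\<^sup>2))" if "\<bar>u\<bar> \<le> s" for u
    using mgf[OF that] by (simp add: mult_ac)
  have e: "(B * real n) * t\<^sup>2 - real n * y * t = - (real n * (y\<^sup>2 / (4 * B)))"
    using B by (simp add: t_def power2_eq_square field_simps)
  have 1: "prob {w \<in> space M. real n * y * t \<le> t * Y w} \<le> exp (- (real n * (y\<^sup>2 / (4 * B))))"
    using chernoff_bound[OF M Y mgf'[of t], of "real n * y * t"] t unfolding e by simp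
  have 2: "prob {w \<in> space M. real n * y * t \<le> (- t) * Y w} \<le> exp (- (real n * (y\<^sup>2 / (4 * B))))"
    using chernoff_bound[OF M Y mgf'[of "- t"], of "real n * y * t"] t unfolding power2_minus e by simp
  have "{w \<in> space M. real n * x \<le> \<bar>Y w\<bar>} \<subseteq> {w \<in> space M. real n * y * t \<le> t * Y w} \<union> {w \<in> space M. real n * y * t \<le> (- t) * Y w}"
  proof
    fix w assume w: "w \<in> {w \<in> space M. real n * x \<le> \<bar>Y w\<bar>}"
    have "real n * y \<le> real n * x" using y by (intro mult_left_mono) auto
    then have "real n * y \<le> \<bar>Y w\<bar>" using w by simp
    then have "real n * y \<le> Y w \<or> real n * y \<le> - Y w" by linarith
    then show "w \<in> {w \<in> space M. real n * y * t \<le> t * Y w} \<union> {w \<in> space M. real n * y * t \<le> (- t) * Y w}"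
    proof
      assume "real n * y \<le> Y w"
      from mult_right_mono[OF this, of t] t w show ?thesis by (simp add: mult.commute)
    next
      assume "real n * y \<le> - Y w"
      from mult_right_mono[OF this, of t] t w show ?thesis by (simp add: mult.commute)
    qed
  qed
  then have "prob {w \<in> space M. real n * x \<le> \<bar>Y w\<bar>} \<le>
      prob ({w \<in> space M. real n * y * t \<le> t * Y w} \<union> {w \<in> space M. real n * y * t \<le> (- t) * Y w})"
    by (intro finite_measure_mono) measurable
  also have "\<dots> \<le> prob {w \<in> space M. real n * y * t \<le> t * Y w} + prob {w \<in> space M. real n * y * t \<le> (- t) * Y w}"
    by (rule measure_Un_le) measurable
  finally show ?thesis using 1 2 unfolding y_def[symmetric] by linarith
qed

text \<open>
  For \<open>n e \<ge> 4 K\<close> the bias \<open>2 K\<close> of the mean uses up at most half of the deviation. For smaller \<open>n\<close> the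
  exponential factor is bounded below and the bound is trivial.
\<close>

lemma cocycle_concentration:
  fixes K p C :: real
  assumes p: "0 < p" and C: "1 \<le> C" and K: "0 \<le> K"
  shows "\<exists>k>0. \<exists>C0>0. \<forall>\<nu>\<in>moment_class p C :: (real^'m^'m) measure set.
      (\<forall>n v w. norm v = 1 \<longrightarrow> norm w = 1 \<longrightarrow> \<bar>mean_log (law \<nu> n) v - mean_log (law \<nu> n) w\<bar> \<le> K) \<longrightarrow>
      (\<exists>l. \<forall>n\<ge>1. \<forall>e>0. \<forall>v. norm v = 1 \<longrightarrow>
        measure (iid \<nu>) {\<omega> \<in> space (iid \<nu>). e < \<bar>ln (norm (cocycle n \<omega> *v v)) / real n - l\<bar>}
          < C0 * exp (- (k * (min e (1/4))\<^sup>2 * real n)))"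
proof -
  define s where "s = p / 2"
  define B where "B = 2 / (p / 2)\<^sup>2 * (exp (p * (2 * K + 2 * C / p)) * (2 * C))"
  have s: "0 < s" using p by (simp add: s_def)
  have B: "0 < B" using p C by (simp add: B_def)
  \<comment> \<open>Chosen so that \<open>k min(e, 1/4)\<^sup>2\<close> is at most the rate in the tail bound at \<open>e / 2\<close>.\<close>
  define k where "k = (min (1/2) (8 * B * s))\<^sup>2 / (4 * B)"
  have "0 < min (1/2) (8 * B * s)" using B s by simp
  then have k: "0 < k" unfolding k_def using B by (intro divide_pos_pos zero_less_power) auto
  define C0 where "C0 = 3 + exp (k * K)"
  have C0: "0 < C0" by (simp add: C0_def add_pos_pos)
  show ?thesis
  proof (rule exI[of _ k], rule conjI[OF k], rule exI[of _ C0], rule conjI[OF C0], intro ballI impI)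
    fix \<nu> :: "(real^'m^'m) measure"
    assume nu: "\<nu> \<in> moment_class p C"
      and "\<forall>n v w. norm v = 1 \<longrightarrow> norm w = 1 \<longrightarrow> \<bar>mean_log (law \<nu> n) v - mean_log (law \<nu> n) w\<bar> \<le> K"
    then have osc: "\<And>n v w. norm v = 1 \<Longrightarrow> norm w = 1 \<Longrightarrow> \<bar>mean_log (law \<nu> n) v - mean_log (law \<nu> n) w\<bar> \<le> K"
      by blast
    note P = moment_classD[OF nu]
    note [measurable] = measurable_cocycle[OF P(2)]
    interpret I: prob_space "iid \<nu>" by (rule prob_space_iid[OF P(1)])
    obtain v0 :: "real^'m" where v0: "norm v0 = 1" using ex_unit_vector by blast
    have qa: "\<bar>mean_log (law \<nu> (m + n)) v0 - mean_log (law \<nu> m) v0 - mean_log (law \<nu> n) v0\<bar> \<le> K" for m n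
      by (rule mean_log_cocycle_close[OF nu p C _ v0 v0]) (rule osc)
    obtain l where l: "\<And>n. \<bar>mean_log (law \<nu> n) v0 - real n * l\<bar> \<le> K"
      by (rule quasi_additive_limit[of "\<lambda>n. mean_log (law \<nu> n) v0" K, OF qa]) (rule that)
    show "\<exists>l. \<forall>n\<ge>1. \<forall>e>0. \<forall>v. norm v = 1 \<longrightarrow>
        measure (iid \<nu>) {\<omega> \<in> space (iid \<nu>). e < \<bar>ln (norm (cocycle n \<omega> *v v)) / real n - l\<bar>}
          < C0 * exp (- (k * (min e (1/4))\<^sup>2 * real n))"
    proof (intro exI[of _ l] allI impI)
      fix n :: nat and e :: real and v :: "real^'m" assume n: "1 \<le> n" and e: "0 < e" and v: "norm v = 1"
      have n0: "0 < real n" using n by simp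
      define a where "a = mean_log (law \<nu> n) v"
      have a: "\<bar>a - real n * l\<bar> \<le> 2 * K" using l[of n] osc[OF v v0, of n] unfolding a_def by linarith
      define Y where "Y \<omega> = ln (norm (cocycle n \<omega> *v v)) - a" for \<omega>
      have Y [measurable]: "Y \<in> borel_measurable (iid \<nu>)" unfolding Y_def by measurable
      let ?E = "{\<omega> \<in> space (iid \<nu>). e < \<bar>ln (norm (cocycle n \<omega> *v v)) / real n - l\<bar>}"
      define q where "q = (min e (1/4))\<^sup>2"
      show "measure (iid \<nu>) ?E < C0 * exp (- (k * (min e (1/4))\<^sup>2 * real n))"
      proof (cases "4 * K \<le> real n * e")
        case True
        have "?E \<subseteq> {\<omega> \<in> space (iid \<nu>). real n * (e / 2) \<le> \<bar>Y \<omega>\<bar>}"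
        proof
          fix \<omega> assume w: "\<omega> \<in> ?E"
          define x where "x = ln (norm (cocycle n \<omega> *v v))"
          have "e < \<bar>x / real n - l\<bar>" using w by (simp add: x_def)
          from mult_strict_left_mono[OF this n0] have "real n * e < \<bar>real n * (x / real n - l)\<bar>"
            using n0 by (simp only: abs_mult)
          also have "real n * (x / real n - l) = x - real n * l" using n0 by (simp add: field_simps)
          finally have "real n * e < \<bar>x - real n * l\<bar>" .
          then have "real n * (e / 2) \<le> \<bar>x - a\<bar>" using a True unfolding times_divide_eq_right by linarith
          then show "\<omega> \<in> {\<omega> \<in> space (iid \<nu>). real n * (e / 2) \<le> \<bar>Y \<omega>\<bar>}" using w by (simp add: Y_def x_def)
        qed
        then have "measure (iid \<nu>) ?E \<le> measure (iid \<nu>) {\<omega> \<in> space (iid \<nu>). real n * (e / 2) \<le> \<bar>Y \<omega>\<bar>}"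
          by (intro I.finite_measure_mono) measurable
        also have "\<dots> \<le> 2 * exp (- (real n * ((min (e / 2) (2 * B * s))\<^sup>2 / (4 * B))))"
        proof (rule subgaussian_tail[OF I.prob_space_axioms Y s B])
          show "0 < e / 2" using e by simp
          fix t assume t: "\<bar>t\<bar> \<le> s"
          have "(\<integral>\<^sup>+ w. ennreal (exp (t * Y w)) \<partial>iid \<nu>) = (\<integral>\<^sup>+ g. ennreal (exp (t * (ln (norm (g *v v)) - a))) \<partial>law \<nu> n)"
            unfolding law_def Y_def by (subst nn_integral_distr) auto
          also have "\<dots> \<le> ennreal (exp (B * t\<^sup>2 * real n))"
            unfolding a_def B_def
            by (rule cocycle_exponential_moment[OF nu p C osc t[unfolded s_def] v])
          finally show "(\<integral>\<^sup>+ w. ennreal (exp (t * Y w)) \<partial>iid \<nu>) \<le> ennreal (exp (B * t\<^sup>2 * real n))" .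
        qed
        also have "\<dots> \<le> 2 * exp (- (k * q * real n))"
        proof -
          have "min e (1/4) * min (1/2) (8 * B * s) \<le> min (e / 2) (2 * B * s)"
          proof (rule min.boundedI)
            have "min e (1/4) * min (1/2) (8 * B * s) \<le> e * (1/2)" using e B s by (intro mult_mono) auto
            then show "min e (1/4) * min (1/2) (8 * B * s) \<le> e / 2" by simp
            have "min e (1/4) * min (1/2) (8 * B * s) \<le> (1/4) * (8 * B * s)" using e B s by (intro mult_mono) auto
            then show "min e (1/4) * min (1/2) (8 * B * s) \<le> 2 * B * s" by simp
          qed
          then have "(min e (1/4) * min (1/2) (8 * B * s))\<^sup>2 \<le> (min (e / 2) (2 * B * s))\<^sup>2"
            using e B s by (intro power_mono) auto
          then have "q * (min (1/2) (8 * B * s))\<^sup>2 / (4 * B) \<le> (min (e / 2) (2 * B * s))\<^sup>2 / (4 * B)"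
            using B by (intro divide_right_mono) (auto simp: power_mult_distrib q_def)
          then have "k * q \<le> (min (e / 2) (2 * B * s))\<^sup>2 / (4 * B)" by (simp add: k_def mult.commute)
          from mult_left_mono[OF this, of "real n"] have "k * q * real n \<le> real n * ((min (e / 2) (2 * B * s))\<^sup>2 / (4 * B))"
            by (simp add: mult_ac)
          then show ?thesis by simp
        qed
        also have "\<dots> < C0 * exp (- (k * q * real n))"
          by (intro mult_strict_right_mono) (auto simp: C0_def add_pos_pos)
        finally show ?thesis by (simp add: q_def)
      next
        case False
        have "q \<le> e * (1/4)" unfolding q_def power2_eq_square using e by (intro mult_mono) auto
        then have "q * real n \<le> e * (1/4) * real n" by (intro mult_right_mono) auto
        also have "\<dots> \<le> K" using False by (simp add: mult.commute)
        finally have "k * (q * real n) \<le> k * K" using k by (intro mult_left_mono) auto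
        then have "1 \<le> exp (k * K) * exp (- (k * q * real n))" by (simp add: exp_add[symmetric] mult.assoc)
        also have "\<dots> < C0 * exp (- (k * q * real n))" by (intro mult_strict_right_mono) (auto simp: C0_def)
        finally show ?thesis using I.prob_le_1[of ?E] unfolding q_def by linarith
      qed
    qed
  qed
qed

text \<open>
  Borel-Cantelli for the basis vectors, whose images control the operator norm up to a constant
  factor.
\<close>

lemma lyapunov1_of_concentration:
  fixes \<nu> :: "(real^'m^'m) measure"
  assumes nu: "\<nu> \<in> moment_class p C" and p: "0 < p" and C: "1 \<le> C"
    and conc: "\<And>n e v. 1 \<le> n \<Longrightarrow> 0 < e \<Longrightarrow> norm v = 1 \<Longrightarrow>
      measure (iid \<nu>) {\<omega> \<in> space (iid \<nu>). e < \<bar>ln (norm (cocycle n \<omega> *v v)) / real n - l\<bar>}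
        < C0 * exp (- (c e * real n))" and c: "\<And>e. 0 < e \<Longrightarrow> 0 < c e"
  shows "lyapunov1 \<nu> = ereal l"
proof (rule lyapunov1_eqI[OF nu p C])
  note P = moment_classD[OF nu]
  note [measurable] = measurable_cocycle[OF P(2)]
  interpret I: prob_space "iid \<nu>" by (rule prob_space_iid[OF P(1)])
  have BC: "AE \<omega> in iid \<nu>. eventually (\<lambda>n. \<bar>ln (norm (cocycle n \<omega> *v v)) / real n - l\<bar> \<le> e) sequentially"
    if v: "norm v = 1" and e: "0 < e" for v e
  proof -
    define A where "A n = {\<omega> \<in> space (iid \<nu>). e < \<bar>ln (norm (cocycle n \<omega> *v v)) / real n - l\<bar>}" for n
    have A [measurable]: "A n \<in> sets (iid \<nu>)" for n unfolding A_def by measurable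
    have "summable (\<lambda>n. measure (iid \<nu>) (A n))"
    proof (rule summable_comparison_test_ev)
      show "summable (\<lambda>n. C0 * exp (- c e) ^ n)"
        using c[OF e] by (intro summable_mult summable_geometric) simp
      show "eventually (\<lambda>n. norm (measure (iid \<nu>) (A n)) \<le> C0 * exp (- c e) ^ n) sequentially"
        using eventually_ge_at_top[of 1]
      proof eventually_elim
        case (elim n)
        have "exp (- (c e * real n)) = exp (- c e) ^ n" by (simp add: exp_of_nat_mult[symmetric] mult.commute)
        then show ?case using conc[OF elim e v] by (simp add: A_def)
      qed
    qed
    then have "AE \<omega> in iid \<nu>. eventually (\<lambda>n. \<omega> \<in> space (iid \<nu>) - A n) sequentially"
      by (intro borel_cantelli_AE1) (auto simp: less_top[symmetric])
    then show ?thesis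
      by eventually_elim (auto elim!: eventually_mono simp: A_def not_less)
  qed
  have "AE \<omega> in iid \<nu>. \<forall>j::nat. \<forall>b\<in>Basis. eventually (\<lambda>n. \<bar>ln (norm (cocycle n \<omega> *v b)) / real n - l\<bar> \<le> 1 / real (Suc j)) sequentially"
    unfolding AE_all_countable by (intro allI AE_finite_allI BC) auto
  moreover have "AE \<omega> in iid \<nu>. \<forall>b\<in>Basis. \<forall>n. cocycle n \<omega> *v b \<noteq> 0"
    by (intro AE_finite_allI AE_cocycle_nonzero[OF nu p C]) auto
  ultimately show "AE \<omega> in iid \<nu>. (\<lambda>n. ln (opnorm (cocycle n \<omega>)) / real n) \<longlonglongrightarrow> l"
  proof eventually_elim
    case (elim \<omega>)
    define N where "N = card (Basis :: (real^'m) set)"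
    have N: "1 \<le> N" unfolding N_def using DIM_positive[where 'a = "real^'m"] by linarith
    obtain b0 :: "real^'m" where b0: "b0 \<in> Basis" using nonempty_Basis by blast
    show ?case
    proof (rule LIMSEQ_I)
      fix r :: real assume "0 < r"
      then obtain j where j: "1 / real (Suc j) < r / 2" using nat_approx_posE[of "r / 2"] by auto
      have 1: "eventually (\<lambda>n. \<forall>b\<in>Basis. \<bar>ln (norm (cocycle n \<omega> *v b)) / real n - l\<bar> \<le> 1 / real (Suc j)) sequentially"
        using elim(1) by (intro eventually_ball_finite) auto
      have "(\<lambda>n. ln (real N) * (1 / real n)) \<longlonglongrightarrow> ln (real N) * 0" by (intro tendsto_intros lim_1_over_n)
      then have 2: "eventually (\<lambda>n. ln (real N) * (1 / real n) < r / 2) sequentially"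
        using \<open>0 < r\<close> by (intro order_tendstoD(2)) auto
      from 1 2 eventually_gt_at_top[of 0]
      have "eventually (\<lambda>n. norm (ln (opnorm (cocycle n \<omega>)) / real n - l) < r) sequentially"
      proof eventually_elim
        case (elim n)
        define A where "A = cocycle n \<omega>"
        have n0: "0 < real n" using elim(3) by simp
        have nz: "0 < norm (A *v b)" if "b \<in> Basis" for b
          using \<open>\<forall>b\<in>Basis. \<forall>n. cocycle n \<omega> *v b \<noteq> 0\<close> that by (simp add: A_def)
        have low: "norm (A *v b0) \<le> opnorm A" using norm_mult_le_opnorm[of A b0] b0 by simp
        define M where "M = exp (real n * (l + 1 / real (Suc j)))"
        have Mb: "norm (A *v b) \<le> M" if b: "b \<in> Basis" for b
        proof -
          have "ln (norm (A *v b)) / real n \<le> l + 1 / real (Suc j)"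
            using bspec[OF elim(1) b] unfolding A_def abs_le_iff by linarith
          then have "ln (norm (A *v b)) \<le> real n * (l + 1 / real (Suc j))"
            using n0 by (simp only: pos_divide_le_eq mult.commute)
          then have "exp (ln (norm (A *v b))) \<le> M" unfolding M_def by (simp only: exp_le_cancel_iff)
          then show ?thesis using nz[OF b] by simp
        qed
        obtain e where e: "norm e = 1" "norm (A *v e) = opnorm A" by (rule opnorm_attained)
        have "opnorm A \<le> (\<Sum>b\<in>Basis. norm (A *v b))"
          unfolding e(2)[symmetric]
          by (rule norm_image_le_sum_basis) (auto simp: pairwise_def orthogonal_def inner_Basis e span_Basis)
        also have "\<dots> \<le> real N * M"
          using sum_mono[of Basis "\<lambda>b. norm (A *v b)" "\<lambda>_. M"] Mb by (simp add: N_def)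
        finally have up: "opnorm A \<le> real N * M" .
        have pos: "0 < opnorm A" using low nz[OF b0] by linarith
        have "ln (opnorm A) \<le> ln (real N * M)" using up pos by (intro ln_mono) auto
        also have "\<dots> = ln (real N) + real n * (l + 1 / real (Suc j))"
          using N by (subst ln_mult_pos) (auto simp: M_def)
        finally have "ln (opnorm A) / real n \<le> (ln (real N) + real n * (l + 1 / real (Suc j))) / real n"
          using n0 by (intro divide_right_mono) auto
        also have "\<dots> = ln (real N) * (1 / real n) + (l + 1 / real (Suc j))" using n0 by (simp add: add_divide_distrib)
        finally have U: "ln (opnorm A) / real n < l + r" using elim(2) j by linarith
        have "ln (norm (A *v b0)) / real n \<le> ln (opnorm A) / real n"
          using low nz[OF b0] n0 by (intro divide_right_mono ln_mono) auto
        moreover have "l - 1 / real (Suc j) \<le> ln (norm (A *v b0)) / real n"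
          using bspec[OF elim(1) b0] unfolding A_def abs_le_iff by linarith
        ultimately have "l - r < ln (opnorm A) / real n" using j \<open>0 < r\<close> by linarith
        with U show ?case by (simp add: A_def abs_less_iff)
      qed
      then show "\<exists>no. \<forall>n\<ge>no. norm (ln (opnorm (cocycle n \<omega>)) / real n - l) < r" by (simp add: eventually_sequentially)
    qed
  qed
qed

theorem theorem2p2:
  fixes \<mu> :: "(real^'m^'m) measure" and p C :: real
  assumes "0 < p" and "p \<le> 1" and "1 \<le> C"
    and "\<mu> \<in> moment_class p C"
    and "quasi_irreducible \<mu>"
    and "lyapunov1 \<mu> > lyapunov2 \<mu>"
  shows "\<exists>C\<^sub>0 \<delta> :: real. \<exists>c :: real \<Rightarrow> real.
    C\<^sub>0 > 0 \<and> \<delta> > 0 \<and> (\<forall>\<epsilon>>0. c \<epsilon> > 0) \<and>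
    c \<in> \<Theta>[at_right 0](\<lambda>\<epsilon>. \<epsilon>\<^sup>2 / ln (1 / \<epsilon>)) \<and>
    (\<forall>\<nu> \<in> moment_class p C. Wasserstein p \<nu> \<mu> < ennreal \<delta> \<longrightarrow>
      (\<forall>n::nat. n \<ge> 1 \<longrightarrow> (\<forall>\<epsilon>>0. \<forall>v::real^'m. norm v = 1 \<longrightarrow>
        measure (iid \<nu>)
          {\<omega> \<in> space (iid \<nu>).
             \<bar>elog (norm (cocycle n \<omega> *v v)) / ereal (real n) - lyapunov1 \<nu>\<bar> > ereal \<epsilon>}
        < C\<^sub>0 * exp (- c \<epsilon> * real n))))"
proof -
  note p = assms(1,2) and C = assms(3) and mu = assms(4)
  obtain N b where N1: "1 \<le> N" and Nb: "0 < b"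
    "\<And>v w. norm v = 1 \<Longrightarrow> norm w = 1 \<Longrightarrow>
      (\<integral>g. ln (max (exterior_norm g) b) \<partial>law \<mu> N) - mean_log (law \<mu> N) v - mean_log (law \<mu> N) w \<le> -1"
    by (rule contraction_in_mean[OF mu p C assms(5,6)]) (rule that)
  define D where "D = C ^ N"
  have D: "0 < D" using C by (simp add: D_def)
  obtain d where d: "0 < d"
    "\<And>\<kappa>' \<rho> v w. \<kappa>' \<in> moment_class p D \<Longrightarrow> \<rho> \<in> couplings \<kappa>' (law \<mu> N) \<Longrightarrow> coupling_cost p \<rho> \<le> ennreal d \<Longrightarrow>
      norm v = 1 \<Longrightarrow> norm w = 1 \<Longrightarrow>
      (\<integral>g. ln (max (exterior_norm g) b) \<partial>\<kappa>') - mean_log \<kappa>' v - mean_log \<kappa>' w \<le> -1/2"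
    by (rule contraction_in_mean_stable[OF law_moment_class[OF mu p(1) C, of N, folded D_def] D p Nb(1)],
        rule Nb(2), assumption, assumption) (rule that)
  obtain a where a: "0 < a" "a \<le> p / 12"
    "\<And>(\<kappa> :: (real^'m^'m) measure) v w. \<kappa> \<in> moment_class p D \<Longrightarrow>
      (\<integral>g. ln (max (exterior_norm g) b) \<partial>\<kappa>) - mean_log \<kappa> v - mean_log \<kappa> w \<le> -1/2 \<Longrightarrow>
      norm v = 1 \<Longrightarrow> norm w = 1 \<Longrightarrow>
      integrable \<kappa> (\<lambda>g. sine (g *v v) (g *v w) powr a) \<and>
      (\<integral>g. sine (g *v v) (g *v w) powr a \<partial>\<kappa>) \<le> (1 - a / 4) * sine v w powr a"
    by (rule sine_contraction[OF D p Nb(1)]) (rule that)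
  define K where "K = 32 * (1 + D) / a\<^sup>2"
  have K: "0 \<le> K" using D by (simp add: K_def)
  obtain k C0 where kC: "0 < k" "0 < C0"
    and conc: "\<forall>\<nu>\<in>moment_class p C :: (real^'m^'m) measure set.
      (\<forall>n v w. norm v = 1 \<longrightarrow> norm w = 1 \<longrightarrow> \<bar>mean_log (law \<nu> n) v - mean_log (law \<nu> n) w\<bar> \<le> K) \<longrightarrow>
      (\<exists>l. \<forall>n\<ge>1. \<forall>e>0. \<forall>v. norm v = 1 \<longrightarrow>
        measure (iid \<nu>) {\<omega> \<in> space (iid \<nu>). e < \<bar>ln (norm (cocycle n \<omega> *v v)) / real n - l\<bar>}
          < C0 * exp (- (k * (min e (1/4))\<^sup>2 * real n)))"
    using cocycle_concentration[OF p(1) C K] by (elim exE conjE)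
  \<comment> \<open>Passing to \<open>N\<close> factors multiplies the transport cost by at most \<open>N D\<close>.\<close>
  define \<delta> where "\<delta> = d / (real N * D + 1)"
  have \<delta>: "0 < \<delta>" using d(1) D by (simp add: \<delta>_def add_nonneg_pos)
  \<comment> \<open>Capping \<open>\<epsilon>\<close> at \<open>1/4\<close> keeps the logarithm above one, so \<open>c\<close> is positive and below the rate just obtained.\<close>
  define c where "c \<epsilon> = k * (min \<epsilon> (1/4))\<^sup>2 / ln (1 / min \<epsilon> (1/4))" for \<epsilon> :: real
  have ln4: "1 \<le> ln (1 / min \<epsilon> (1/4))" if "0 < \<epsilon>" for \<epsilon> :: real
  proof -
    have "exp 1 \<le> (3::real)" by (rule exp_le)
    also have "3 \<le> 1 / min \<epsilon> (1/4)" using that by (simp add: field_simps min_def)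
    finally have "ln (exp 1) \<le> ln (1 / min \<epsilon> (1/4))" by (intro ln_mono) auto
    then show ?thesis by simp
  qed
  have c_pos: "0 < c \<epsilon>" and c_le: "c \<epsilon> \<le> k * (min \<epsilon> (1/4))\<^sup>2" if "0 < \<epsilon>" for \<epsilon>
  proof -
    have num: "0 < k * (min \<epsilon> (1/4))\<^sup>2" using kC(1) that by simp
    then show "0 < c \<epsilon>" unfolding c_def using ln4[OF that] by (intro divide_pos_pos) auto
    have "k * (min \<epsilon> (1/4))\<^sup>2 / ln (1 / min \<epsilon> (1/4)) \<le> k * (min \<epsilon> (1/4))\<^sup>2 / 1"
      using ln4[OF that] num by (intro divide_left_mono) auto
    then show "c \<epsilon> \<le> k * (min \<epsilon> (1/4))\<^sup>2" by (simp add: c_def)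
  qed
  have c_Theta: "c \<in> \<Theta>[at_right 0](\<lambda>\<epsilon>. \<epsilon>\<^sup>2 / ln (1 / \<epsilon>))"
  proof -
    have "eventually (\<lambda>\<epsilon>::real. \<epsilon> \<in> {0<..<1/4}) (at_right 0)" by (rule eventually_at_right_real) simp
    then have "eventually (\<lambda>\<epsilon>. c \<epsilon> = k * (\<epsilon>\<^sup>2 / ln (1 / \<epsilon>))) (at_right 0)"
      by eventually_elim (simp add: c_def min_def)
    then have "c \<in> \<Theta>[at_right 0](\<lambda>\<epsilon>. \<epsilon>\<^sup>2 / ln (1 / \<epsilon>)) \<longleftrightarrow>
        (\<lambda>\<epsilon>. k * (\<epsilon>\<^sup>2 / ln (1 / \<epsilon>))) \<in> \<Theta>[at_right 0](\<lambda>\<epsilon>. \<epsilon>\<^sup>2 / ln (1 / \<epsilon>))"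
      by (rule landau_theta.in_cong)
    also have "\<dots>" using kC(1) by (simp only: landau_theta.cmult_in_iff) simp
    finally show ?thesis .
  qed
  show ?thesis
  proof (rule exI[of _ C0], rule exI[of _ \<delta>], rule exI[of _ c], intro conjI ballI allI impI)
    show "0 < C0" "0 < \<delta>" by (fact kC(2) \<delta>)+
    show "0 < c \<epsilon>" if "0 < \<epsilon>" for \<epsilon> by (rule c_pos[OF that])
    show "c \<in> \<Theta>[at_right 0](\<lambda>\<epsilon>. \<epsilon>\<^sup>2 / ln (1 / \<epsilon>))" by (rule c_Theta)
    fix \<nu> :: "(real^'m^'m) measure" and n :: nat and \<epsilon> :: real and v :: "real^'m"
    assume nu: "\<nu> \<in> moment_class p C" and near: "Wasserstein p \<nu> \<mu> < ennreal \<delta>"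
      and n: "1 \<le> n" and e: "0 < \<epsilon>" and v: "norm v = 1"
    note P = moment_classD[OF nu]
    note [measurable] = measurable_cocycle[OF P(2)]
    interpret I: prob_space "iid \<nu>" by (rule prob_space_iid[OF P(1)])
    obtain \<pi> where pi: "\<pi> \<in> couplings \<nu> \<mu>" "coupling_cost p \<pi> < ennreal \<delta>"
      using near unfolding Wasserstein_def INF_less_iff coupling_cost_def split_beta by blast
    obtain \<rho> where rho: "\<rho> \<in> couplings (law \<nu> N) (law \<mu> N)"
      "coupling_cost p \<rho> \<le> ennreal (real N * C ^ N) * coupling_cost p \<pi>"
      using coupling_law[OF nu mu p C pi(1), of N] by blast
    have cost: "coupling_cost p \<rho> \<le> ennreal d"
    proof -
      note rho(2)
      also have "ennreal (real N * C ^ N) * coupling_cost p \<pi> \<le> ennreal (real N * D) * ennreal \<delta>"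
        unfolding D_def using pi(2) by (intro mult_left_mono) auto
      also have "\<dots> = ennreal (real N * D * \<delta>)" using D \<delta> by (intro ennreal_mult[symmetric]) auto
      also have "real N * D * \<delta> \<le> d"
      proof -
        have "real N * D * d \<le> d * (real N * D + 1)" using d(1) by (simp add: algebra_simps)
        moreover have "0 < real N * D + 1" using D by (simp add: add_nonneg_pos)
        ultimately show ?thesis unfolding \<delta>_def times_divide_eq_right by (simp only: pos_divide_le_eq)
      qed
      then have "ennreal (real N * D * \<delta>) \<le> ennreal d" by (rule ennreal_leI)
      finally show ?thesis .
    qed
    note LN = law_moment_class[OF nu p(1) C, of N, folded D_def]
    have con: "integrable (law \<nu> N) (\<lambda>g. sine (g *v v) (g *v w) powr a) \<and>
        (\<integral>g. sine (g *v v) (g *v w) powr a \<partial>law \<nu> N) \<le> (1 - a / 4) * sine v w powr a"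
      if "norm v = 1" "norm w = 1" for v w :: "real^'m"
      by (rule a(3)[OF LN d(2)[OF LN rho(1) cost that] that])
    have osc: "\<bar>mean_log (law \<nu> n) v - mean_log (law \<nu> n) w\<bar> \<le> K"
      if vw: "norm v = 1" "norm w = 1" for n and v w :: "real^'m"
    proof -
      have "sine v w powr a \<le> 1" using a(1) by (intro powr_le1) (auto simp: sine_nonneg sine_le_1)
      from mult_left_mono[OF this K] have "K * sine v w powr a \<le> K" by simp
      moreover have "\<bar>mean_log (law \<nu> n) v - mean_log (law \<nu> n) w\<bar> \<le> K * sine v w powr a"
        unfolding K_def D_def by (rule mean_log_oscillation[OF nu p C a(1,2) N1 _ vw]) (rule con)
      ultimately show ?thesis by linarith
    qed
    have osc': "\<forall>n v w. norm v = 1 \<longrightarrow> norm w = 1 \<longrightarrow> \<bar>mean_log (law \<nu> n) v - mean_log (law \<nu> n) w\<bar> \<le> K"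
      by (intro allI impI osc)
    obtain l where "\<forall>n\<ge>1. \<forall>e>0. \<forall>v. norm v = 1 \<longrightarrow>
        measure (iid \<nu>) {\<omega> \<in> space (iid \<nu>). e < \<bar>ln (norm (cocycle n \<omega> *v v)) / real n - l\<bar>}
          < C0 * exp (- (k * (min e (1/4))\<^sup>2 * real n))"
      using mp[OF bspec[OF conc nu] osc'] by (elim exE)
    then have l: "measure (iid \<nu>) {\<omega> \<in> space (iid \<nu>). e < \<bar>ln (norm (cocycle n \<omega> *v v)) / real n - l\<bar>}
          < C0 * exp (- (k * (min e (1/4))\<^sup>2 * real n))" if "1 \<le> n" "0 < e" "norm v = 1" for n e v
      using that by simp
    have lyap: "lyapunov1 \<nu> = ereal l"
      by (rule lyapunov1_of_concentration[OF nu p(1) C, where c = "\<lambda>e. k * (min e (1/4))\<^sup>2"])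
        (use kC(1) in \<open>auto intro!: l mult_pos_pos\<close>)
    have v0: "v \<noteq> 0" using v by auto
    have "measure (iid \<nu>) {\<omega> \<in> space (iid \<nu>).
        \<bar>elog (norm (cocycle n \<omega> *v v)) / ereal (real n) - lyapunov1 \<nu>\<bar> > ereal \<epsilon>}
      \<le> measure (iid \<nu>) {\<omega> \<in> space (iid \<nu>). \<epsilon> < \<bar>ln (norm (cocycle n \<omega> *v v)) / real n - l\<bar>}"
    proof (rule I.finite_measure_mono_AE)
      show "AE \<omega> in iid \<nu>. \<omega> \<in> {\<omega> \<in> space (iid \<nu>).
          \<bar>elog (norm (cocycle n \<omega> *v v)) / ereal (real n) - lyapunov1 \<nu>\<bar> > ereal \<epsilon>} \<longrightarrow>
        \<omega> \<in> {\<omega> \<in> space (iid \<nu>). \<epsilon> < \<bar>ln (norm (cocycle n \<omega> *v v)) / real n - l\<bar>}"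
        using AE_cocycle_nonzero[OF nu p(1) C v0]
        by eventually_elim (use n in \<open>simp add: elog_def lyap\<close>)
      show "{\<omega> \<in> space (iid \<nu>). \<epsilon> < \<bar>ln (norm (cocycle n \<omega> *v v)) / real n - l\<bar>} \<in> sets (iid \<nu>)" by measurable
    qed
    also have "\<dots> < C0 * exp (- (k * (min \<epsilon> (1/4))\<^sup>2 * real n))" by (rule l[OF n e v])
    also have "\<dots> \<le> C0 * exp (- c \<epsilon> * real n)"
      using c_le[OF e] kC(2) by (intro mult_left_mono) (auto intro: mult_right_mono)
    finally show "measure (iid \<nu>) {\<omega> \<in> space (iid \<nu>).
        \<bar>elog (norm (cocycle n \<omega> *v v)) / ereal (real n) - lyapunov1 \<nu>\<bar> > ereal \<epsilon>} < C0 * exp (- c \<epsilon> * real n)" .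
  qed
qed

end
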